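(* When $p=0$ and $q=\omega=e^{2\pi i/3}$, $$\tilde Z_n(\omega,\dots,\omega;1,\dots,1;\lambda) =\frac{\omega^{\binom{n+1}2}}{(1-\lambda\omega^{n+1})(1-\lambda\omega^{n+2})}\left(A_n(1+\omega^{n}\lambda^2 )+(-1)^{n} C_n\omega^{2n}\lambda\right),$$ where $A_n=\prod_{j=1}^n\frac{(3j-2)!}{(n+j-1)!}$ is the number of $n\times n$ alternating sign matrices and $C_n=\prod_{j=1}^n\frac{(3j-1)(3j-3)!}{(n+j-1)!}$.
   Context: Fix $\tau,\eta$ with $\operatorname{Im}(\tau)>0$, $\eta\notin\mathbb Z+\tau\mathbb Z$; $p=e^{2\pi i\tau}$, $q=e^{2\pi i\eta}$, $q^x=e^{2\pi i\eta x}$, $[x]=q^{-x/2}\prod_{j\ge0}(1-p^jq^x)(1-p^{j+1}q^{-x})$. A state is an $(n+1)\times(n+1)$ integer matrix with adjacent entries differing by $1$, first row and first column $0,1,\dots,n$, last row and last column $n,n-1,\dots,0$. Each block $\left(\begin{smallmatrix}a&b\\c&d\end{smallmatrix}\right)$ (adjacent $2\times2$ submatrix) at position $(i,j)$ has weight $R^{b-a,d-b}_{d-c,c-a}(\lambda+a,x_i-y_j)$, with $R^{++}_{++}=R^{--}_{--}=[u+1]/[1]$, $R^{+-}_{+-}(\lambda,u)=[u][\lambda+1]/([1][\lambda])$, $R^{-+}_{-+}(\lambda,u)=[u][\lambda-1]/([1][\lambda])$, $R^{-+}_{+-}(\lambda,u)=[\lambda+u]/[\lambda]$, $R^{+-}_{-+}(\lambda,u)=[\lambda-u]/[\lambda]$;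 $Z_n(x;y;\lambda)$ is the sum over states of products of block weights (8VSOS, domain wall boundary conditions). $\tilde Z_n$ is defined by $\tilde Z_n(q^{x_1},\dots,q^{x_n};q^{y_1},\dots,q^{y_n};q^\lambda)=q^{n(|x|+|y|)/2}Z_n(x;y;\lambda)$, $|x|=\sum x_i$, $|y|=\sum y_i$. *)

theory Defs
  imports
    "HOL-Analysis.Analysis"
    "Jordan_Normal_Form.Matrix"
begin

definition qpow :: "complex \<Rightarrow> complex \<Rightarrow> complex" where
  "qpow \<eta> x = exp (2 * of_real pi * \<i> * \<eta> * x)"

(* The function [x].  The nome p is a parameter of its own, so that the trigonometric
   limit is literally p = 0; since 0 ^ 0 = 1, only the factor 1 - q^x then survives. *)
definition br :: "complex \<Rightarrow> complex \<Rightarrow> complex \<Rightarrow> complex" where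
  "br p \<eta> x = qpow \<eta> (- x / 2) *
     prodinf (\<lambda>j. (1 - p ^ j * qpow \<eta> x) * (1 - p ^ (j + 1) * qpow \<eta> (- x)))"

(* Rweight p eta k m r s lam u is the entry with upper indices k, m and lower indices r, s.
   The signs + and - are the integers 1 and -1.  Only the six listed cases occur as
   blocks of a state. *)
definition Rweight ::
  "complex \<Rightarrow> complex \<Rightarrow> int \<Rightarrow> int \<Rightarrow> int \<Rightarrow> int \<Rightarrow> complex \<Rightarrow> complex \<Rightarrow> complex" where
  "Rweight p \<eta> k m r s lam u =
    (if (k, m, r, s) = (1, 1, 1, 1) \<or> (k, m, r, s) = (-1, -1, -1, -1)
       then br p \<eta> (u + 1) / br p \<eta> 1
     else if (k, m, r, s) = (1, -1, 1, -1)
       then br p \<eta> u * br p \<eta> (lam + 1) / (br p \<eta> 1 * br p \<eta> lam)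
     else if (k, m, r, s) = (-1, 1, -1, 1)
       then br p \<eta> u * br p \<eta> (lam - 1) / (br p \<eta> 1 * br p \<eta> lam)
     else if (k, m, r, s) = (-1, 1, 1, -1)
       then br p \<eta> (lam + u) / br p \<eta> lam
     else if (k, m, r, s) = (1, -1, -1, 1)
       then br p \<eta> (lam - u) / br p \<eta> lam
     else 0)"

(* Rows and columns are numbered 0, ..., n. *)
definition states :: "nat \<Rightarrow> int mat set" where
  "states n = {M \<in> carrier_mat (n + 1) (n + 1).
     (\<forall>i\<le>n. \<forall>j<n. \<bar>M $$ (i, j + 1) - M $$ (i, j)\<bar> = 1) \<and>
     (\<forall>i<n. \<forall>j\<le>n. \<bar>M $$ (i + 1, j) - M $$ (i, j)\<bar> = 1) \<and>
     (\<forall>k\<le>n. M $$ (0, k) = int k \<and> M $$ (k, 0) = int k \<and>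
            M $$ (n, k) = int n - int k \<and> M $$ (k, n) = int n - int k)}"

definition block_weight ::
  "complex \<Rightarrow> complex \<Rightarrow> (nat \<Rightarrow> complex) \<Rightarrow> (nat \<Rightarrow> complex) \<Rightarrow> complex \<Rightarrow> int mat
     \<Rightarrow> nat \<Rightarrow> nat \<Rightarrow> complex" where
  "block_weight p \<eta> x y lam M i j =
    (let a = M $$ (i, j); b = M $$ (i, j + 1);
         c = M $$ (i + 1, j); d = M $$ (i + 1, j + 1)
     in Rweight p \<eta> (b - a) (d - b) (d - c) (c - a) (lam + of_int a) (x i - y j))"

(* The spectral parameters are x 0, ..., x (n - 1) and y 0, ..., y (n - 1). *)
definition Z ::
  "complex \<Rightarrow> complex \<Rightarrow> nat \<Rightarrow> (nat \<Rightarrow> complex) \<Rightarrow> (nat \<Rightarrow> complex) \<Rightarrow> complex \<Rightarrow> complex" where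
  "Z p \<eta> n x y lam = (\<Sum>M\<in>states n. \<Prod>i<n. \<Prod>j<n. block_weight p \<eta> x y lam M i j)"

(* Ztilde is the function of the multiplicative variables X i = q^(x i), Y i = q^(y i)
   and L = q^lam determined by its values in terms of x, y, lam: the description operator
   yields the common value over all choices of these logarithms. *)
definition Ztilde ::
  "complex \<Rightarrow> complex \<Rightarrow> nat \<Rightarrow> (nat \<Rightarrow> complex) \<Rightarrow> (nat \<Rightarrow> complex) \<Rightarrow> complex \<Rightarrow> complex" where
  "Ztilde p \<eta> n X Y L = (THE z. \<forall>x y lam.
     (\<forall>i<n. qpow \<eta> (x i) = X i) \<and> (\<forall>i<n. qpow \<eta> (y i) = Y i) \<and> qpow \<eta> lam = L
     \<longrightarrow> z = qpow \<eta> (of_nat n * ((\<Sum>i<n. x i) + (\<Sum>i<n. y i)) / 2) * Z p \<eta> n x y lam)"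

definition omega :: complex where
  "omega = exp (2 * of_real pi * \<i> / 3)"

definition A_num :: "nat \<Rightarrow> complex" where
  "A_num n = (\<Prod>j=1..n. fact (3 * j - 2) / fact (n + j - 1))"

definition C_num :: "nat \<Rightarrow> complex" where
  "C_num n = (\<Prod>j=1..n. of_nat (3 * j - 1) * fact (3 * j - 3) / fact (n + j - 1))"

definition alternating_sign_matrices :: "nat \<Rightarrow> int mat set" where
  "alternating_sign_matrices n = {M \<in> carrier_mat n n.
     (\<forall>i<n. \<forall>j<n. M $$ (i, j) \<in> {-1, 0, 1}) \<and>
     (\<forall>i<n. (\<Sum>j<n. M $$ (i, j)) = 1) \<and>
     (\<forall>j<n. (\<Sum>i<n. M $$ (i, j)) = 1) \<and>
     (\<forall>i<n. \<forall>j<n. \<forall>k<n. j < k \<and> M $$ (i, j) \<noteq> 0 \<and> M $$ (i, k) \<noteq> 0 \<and>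
        (\<forall>l. j < l \<and> l < k \<longrightarrow> M $$ (i, l) = 0) \<longrightarrow> M $$ (i, k) = - M $$ (i, j)) \<and>
     (\<forall>j<n. \<forall>i<n. \<forall>k<n. i < k \<and> M $$ (i, j) \<noteq> 0 \<and> M $$ (k, j) \<noteq> 0 \<and>
        (\<forall>l. i < l \<and> l < k \<longrightarrow> M $$ (l, j) = 0) \<longrightarrow> M $$ (k, j) = - M $$ (i, j))}"

lemma br_nome_0: "br 0 \<eta> x = qpow \<eta> (- x / 2) * (1 - qpow \<eta> x)"
proof -
  have "prodinf (\<lambda>j. (1 - 0 ^ j * qpow \<eta> x) * (1 - 0 ^ (j + 1) * qpow \<eta> (- x)))
      = (\<Prod>j\<in>{0::nat}. (1 - 0 ^ j * qpow \<eta> x) * (1 - 0 ^ (j + 1) * qpow \<eta> (- x)))"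
    by (rule prodinf_finite) auto
  then show ?thesis by (simp add: br_def)
qed

lemma finite_states: "finite (states n)"
proof (rule finite_surj)
  define F :: "(nat \<times> nat \<Rightarrow> int) set"
    where "F = PiE ({..n} \<times> {..n}) (\<lambda>_. {- int (2 * n)..int (2 * n)})"
  show "finite F" unfolding F_def by (intro finite_PiE) auto
  show "states n \<subseteq> mat (n + 1) (n + 1) ` F"
  proof
    fix M assume M: "M \<in> states n"
    then have dim: "M \<in> carrier_mat (n + 1) (n + 1)"
      and step: "\<And>i j. i \<le> n \<Longrightarrow> j < n \<Longrightarrow> \<bar>M $$ (i, j + 1) - M $$ (i, j)\<bar> = 1"
      and col: "\<And>i. i \<le> n \<Longrightarrow> M $$ (i, 0) = int i"
      unfolding states_def by blast+
    have b: "\<bar>M $$ (i, j)\<bar> \<le> int (i + j)" if "i \<le> n" "j \<le> n" for i j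
      using that(2)
    proof (induction j)
      case 0
      then show ?case using col[OF that(1)] by simp
    next
      case (Suc j)
      then have "\<bar>M $$ (i, j + 1) - M $$ (i, j)\<bar> = 1" "\<bar>M $$ (i, j)\<bar> \<le> int (i + j)"
        using step[OF that(1)] by auto
      then show ?case by simp
    qed
    have "M $$ (i, j) \<in> {- int (2 * n)..int (2 * n)}" if "i \<le> n" "j \<le> n" for i j
      using b[OF that] that unfolding atLeastAtMost_iff by linarith
    then have "restrict (($$) M) ({..n} \<times> {..n}) \<in> F"
      unfolding F_def by (intro restrict_PiE_iff[THEN iffD2]) blast
    moreover have "M = mat (n + 1) (n + 1) (restrict (($$) M) ({..n} \<times> {..n}))"
      using dim by (intro eq_matI) auto
    ultimately show "M \<in> mat (n + 1) (n + 1) ` F" by blast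
  qed
qed

end

(*
  In multiplicative variables the weights of the trigonometric 8VSOS model are rational, and the
  partition function is a polynomial of degree n in each Y j.  At q = omega it is determined by
  interpolation (Izergin-Korepin): the dynamical Yang-Baxter equation makes it symmetric in the X i,
  and at Y (n - 1) = X 0 and Y (n - 1) = omega * X (n - 1) a corner block is frozen, which forces a
  whole row and column and leaves the partition function of size n - 1.  The solution of the
  recursion is a combination of two Schur polynomials in the 2n variables X i, omega * Y j, whose
  exponents avoid one residue class modulo 3: for such exponents the alternant factorizes when two
  variables have ratio omega.  On a geometric progression z k = omega * t ^ k the alternants are
  Vandermonde products; t -> 1 turns them into A_num and C_num.  At lam = 0 every state has
  the same weight, so the formula also counts states, that is, alternating sign matrices.
*)
theory Submission
  imports Defs "Jordan_Normal_Form.Determinant"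
begin

section \<open>Alternants\<close>

text \<open>The obstacle is the number of nodes. At size \<open>Suc n\<close> the partition function
  has degree n + 1 in the last Y, and the top right corner with the symmetry yields only the n + 1
  points \<open>X i\<close>; the bottom right corner supplies the one that is missing. With the
  Vandermonde factor multiplied in, the count is 3n + 3 zeros against degree 3n + 2, since 2n + 1
  further zeros are coincidences with other spectral variables. At the homogeneous point every
  determinant degenerates. On the geometric progression all of them carry the same power of t - 1,
  which is divided out before t tends to 1. The rational weights also make sense at L = 0, where L
  has no logarithm. The count of states therefore uses \<open>Zt\<close> and not
  \<open>Ztilde\<close>.\<close>

definition alternant :: "(nat \<Rightarrow> nat) \<Rightarrow> nat \<Rightarrow> (nat \<Rightarrow> complex) \<Rightarrow> complex" where
  "alternant l N z = Determinant.det (mat N N (\<lambda>(i, j). z i ^ l j))"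

lemma alternant_cong:
  assumes "\<And>i. i < N \<Longrightarrow> z i = z' i"
  shows "alternant l N z = alternant l N z'"
  unfolding alternant_def using assms by (intro arg_cong[where f = Determinant.det] eq_matI) auto

lemma alternant_eq_0:
  assumes "i < N" "j < N" "i \<noteq> j" "z i = z j"
  shows "alternant l N z = 0"
  unfolding alternant_def
  by (rule det_identical_rows[of _ N i j]) (use assms in \<open>auto intro!: eq_vecI\<close>)

lemma alternant_permute:
  assumes "\<pi> permutes {0..<N}"
  shows "alternant l N (\<lambda>i. z (\<pi> i)) = signof \<pi> * alternant l N z"
proof -
  have "mat N N (\<lambda>(i, j). mat N N (\<lambda>(i, j). z i ^ l j) $$ (\<pi> i, j)) =
        mat N N (\<lambda>(i, j). z (\<pi> i) ^ l j)"
    using permutes_in_image[OF assms] by (intro eq_matI) auto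
  then show ?thesis
    using det_permute_rows[OF _ assms, of "mat N N (\<lambda>(i, j). z i ^ l j)"] by (simp add: alternant_def)
qed

lemma alternant_swap:
  assumes "a < N" "b < N" "a \<noteq> b"
  shows "alternant l N (\<lambda>i. z (Transposition.transpose a b i)) = - alternant l N z"
proof -
  have "Transposition.transpose a b permutes {0..<N}"
    using assms by (intro permutes_swap_id) auto
  from alternant_permute[OF this] show ?thesis
    using assms by (simp add: sign_swap_id)
qed

lemma det_scale_rows:
  "Determinant.det (mat N N (\<lambda>(i, j). d i * f i j)) = (\<Prod>i<N. d i) *
        Determinant.det (mat N N (\<lambda>(i, j). f i j :: complex))"
proof -
  have "(\<Prod>i = 0..<N. mat N N (\<lambda>(i, j). d i * f i j) $$ (i, p i)) =
      (\<Prod>i<N. d i) * (\<Prod>i = 0..<N. mat N N (\<lambda>(i, j). f i j) $$ (i, p i))"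
    if "p permutes {0..<N}" for p
    using permutes_in_image[OF that] by (simp add: prod.distrib flip: lessThan_atLeast0)
  then show ?thesis
    by (simp add: det_def'[of _ N] sum_distrib_left mult.left_commute)
qed

text \<open>Subtracting \<open>c\<close> times column \<open>j\<close> from column \<open>s + j\<close> annihilates the first \<open>s\<close> rows of
  the last \<open>N\<close> columns.\<close>
lemma alternant_split:
  assumes "s > 0" and l: "\<And>j. l (s + j) = l j + e" and c: "\<And>i. i < s \<Longrightarrow> z i ^ e = c"
  shows "alternant l (s + N) z =
    alternant l s z * (\<Prod>i<N. z (s + i) ^ e - c) * alternant l N (\<lambda>i. z (s + i))"
proof -
  let ?A = "mat (s + N) (s + N) (\<lambda>(i, j). z i ^ l j)"
  let ?U = "mat (s + N) (s + N) (\<lambda>(k, j). if k = j then 1 else if k + s = j then - c else 0)"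
  let ?A1 = "mat s s (\<lambda>(i, j). z i ^ l j)"
  let ?A3 = "mat N s (\<lambda>(i, j). z (s + i) ^ l j)"
  let ?A4 = "mat N N (\<lambda>(i, j). (z (s + i) ^ e - c) * z (s + i) ^ l j)"
  have "Determinant.det ?U = prod_list (diag_mat ?U)"
    by (rule det_upper_triangular[of _ "s + N"]) (use \<open>s > 0\<close> in \<open>auto simp: upper_triangular_def\<close>)
  also have "\<dots> = 1"
    by (simp add: prod_list_diag_prod)
  finally have U: "Determinant.det ?U = 1" .
  have "(?A * ?U) $$ (i, j) = four_block_mat ?A1 (0\<^sub>m s N) ?A3 ?A4 $$ (i, j)"
    if i: "i < s + N" and j: "j < s + N" for i j
  proof -
    have "(?A * ?U) $$ (i, j) =
        (\<Sum>k = 0..<s + N. z i ^ l k * (if k = j then 1 else if k + s = j then - c else 0))"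
      using i j by (simp add: scalar_prod_def)
    also have "\<dots> = (\<Sum>k = 0..<s + N. (if k = j then z i ^ l k else 0) +
        (if k + s = j then - c * z i ^ l k else 0))"
      using \<open>s > 0\<close> by (intro sum.cong) auto
    also have "\<dots> = z i ^ l j + (if s \<le> j then - c * z i ^ l (j - s) else 0)"
    proof -
      have "(\<Sum>k = 0..<s + N. if k + s = j then - c * z i ^ l k else 0) =
          (\<Sum>k = 0..<s + N. if k = j - s then if s \<le> j then - c * z i ^ l k else 0 else 0)"
        by (intro sum.cong) auto
      then show ?thesis using j by (simp add: sum.distrib less_imp_diff_less)
    qed
    also have "\<dots> = four_block_mat ?A1 (0\<^sub>m s N) ?A3 ?A4 $$ (i, j)"
    proof (cases "s \<le> j")
      case True
      then have "l j = l (j - s) + e" using l[of "j - s"] by simp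
      then show ?thesis using True i j c[of i]
        by (cases "i < s") (auto simp: power_add algebra_simps)
    qed (use i j in auto)
    finally show ?thesis .
  qed
  then have "?A * ?U = four_block_mat ?A1 (0\<^sub>m s N) ?A3 ?A4"
    by (intro eq_matI) auto
  then have "Determinant.det ?A = Determinant.det (four_block_mat ?A1 (0\<^sub>m s N) ?A3 ?A4)"
    using det_mult[of ?A "s + N" ?U] U by simp
  also have "\<dots> = Determinant.det ?A1 * Determinant.det ?A4"
    by (rule det_four_block_mat_upper_right_zero) auto
  finally show ?thesis
    by (simp add: alternant_def det_scale_rows)
qed

lemma vandermonde: "alternant (\<lambda>j. j) N z = (\<Prod>j<N. \<Prod>i<j. z j - z i)"
proof (induction N arbitrary: z)
  case 0
  then show ?case by (simp add: alternant_def)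
next
  case (Suc N)
  \<comment> \<open>\<open>alternant_split\<close> with period s = 1 and increment e = 1 peels off
    the variable \<open>z 0\<close>.\<close>
  have 1: "alternant (\<lambda>j. j) (1 + N) z =
      alternant (\<lambda>j. j) 1 z * (\<Prod>i<N. z (1 + i) ^ 1 - z 0) * alternant (\<lambda>j. j) N (\<lambda>i. z (1 + i))"
    by (rule alternant_split) auto
  have 2: "alternant (\<lambda>j. j) 1 z = 1"
    unfolding alternant_def by (subst det_single) auto
  have "(\<Prod>j<Suc N. \<Prod>i<j. z j - z i) = (\<Prod>j<N. \<Prod>i<Suc j. z (Suc j) - z i)"
    by (subst prod.lessThan_Suc_shift) simp
  also have "\<dots> = (\<Prod>j<N. (z (Suc j) - z 0) * (\<Prod>i<j. z (Suc j) - z (Suc i)))"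
    by (subst prod.lessThan_Suc_shift) simp
  finally show ?case
    using 1 2 Suc.IH[of "\<lambda>i. z (Suc i)"] by (simp add: prod.distrib)
qed

lemma alternant_2: "alternant l 2 z = z 0 ^ l 0 * z 1 ^ l 1 - z 0 ^ l 1 * z 1 ^ l 0"
  unfolding alternant_def
  by (subst laplace_expansion_row[of _ 2 0])
    (auto simp: numeral_2_eq_2 cofactor_def det_single mat_delete_def)

text \<open>Nodes and exponents trade places: the entry (w t^i)^(l j) equals w^(l j) (t^(l j))^i, so
  the transposed matrix is, up to row factors, a Vandermonde matrix with nodes t^(l j).\<close>

lemma alternant_geometric:
  "alternant l N (\<lambda>k. w * t ^ k) = (\<Prod>j<N. w ^ l j) * (\<Prod>j<N. \<Prod>i<j. t ^ l j - t ^ l i)"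
proof -
  let ?A = "mat N N (\<lambda>(i, j). (w * t ^ i) ^ l j)"
  have "alternant l N (\<lambda>k. w * t ^ k) = Determinant.det (transpose_mat ?A)"
    by (simp add: alternant_def det_transpose[of _ N])
  also have "transpose_mat ?A = mat N N (\<lambda>(j, i). w ^ l j * (t ^ l j) ^ i)"
    by (intro eq_matI) (auto simp: power_mult_distrib mult.commute simp flip: power_mult)
  also have "Determinant.det \<dots> = (\<Prod>j<N. w ^ l j) *
        alternant (\<lambda>j. j) N (\<lambda>j. t ^ l j)"
    by (simp only: det_scale_rows alternant_def)
  finally show ?thesis by (simp add: vandermonde)
qed

text \<open>Expansion along row k: the cofactors do not see row k, so they may be computed with
  \<open>z k\<close> set to 0 and serve as the coefficients.\<close>

lemma alternant_poly:
  assumes "k < N" and "\<And>j. j < N \<Longrightarrow> l j \<le> d"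
  shows "\<exists>p. degree p \<le> d \<and> (\<forall>w. poly p w = alternant l N (z(k := w)))"
proof -
  let ?A = "\<lambda>w. mat N N (\<lambda>(i, j). (z(k := w)) i ^ l j)"
  define p where "p = (\<Sum>j<N. monom (cofactor (?A 0) k j) (l j))"
  have "degree p \<le> d"
    unfolding p_def using assms(2)
    by (intro degree_sum_le) (auto intro: order.trans[OF degree_monom_le])
  moreover have "poly p w = alternant l N (z(k := w))" for w
  proof -
    have "mat_delete (?A w) k j = mat_delete (?A 0) k j" if "j < N" for j
      unfolding mat_delete_def using assms(1) that by (intro eq_matI) auto
    then have "cofactor (?A w) k j = cofactor (?A 0) k j" if "j < N" for j
      using that by (simp add: cofactor_def)
    then show ?thesis
      unfolding alternant_def p_def
      by (subst laplace_expansion_row[of _ N k]) (auto simp: assms(1) poly_sum poly_monom intro!: sum.cong)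
  qed
  ultimately show ?thesis by blast
qed

section \<open>The dynamical Yang-Baxter equation\<close>

text \<open>These are the block weights at p = 0 multiplied by q^((x+y)/2), in the variables X =
  q^x, Y = q^y, L = q^lam; \<open>Rweight_eq_wt\<close> proves this. The factor removes all
  half-integral powers and leaves functions affine in X and in Y.\<close>

definition wt :: "complex \<Rightarrow> complex \<Rightarrow> complex \<Rightarrow> complex \<Rightarrow> int \<Rightarrow> int \<Rightarrow> int \<Rightarrow> int \<Rightarrow> complex" where
  "wt q L X Y a b c d =
    (let l = L * q powi a; t = (b - a, d - b, d - c, c - a) in
     if t = (1, 1, 1, 1) \<or> t = (-1, -1, -1, -1) then (Y - q * X) / (1 - q)
     else if t = (1, -1, 1, -1) then (Y - X) * (1 - q * l) / ((1 - q) * (1 - l))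
     else if t = (-1, 1, -1, 1) then (Y - X) * (q - l) / ((1 - q) * (1 - l))
     else if t = (-1, 1, 1, -1) then (Y - l * X) / (1 - l)
     else if t = (1, -1, -1, 1) then (X - l * Y) / (1 - l)
     else 0)"

lemma wt_shift:
  assumes "q \<noteq> 0"
  shows "wt q L X Y (h + a) (h + b) (h + c) (h + d) = wt q (L * q powi h) X Y a b c d"
  using assms by (simp add: wt_def power_int_add mult.assoc)

text \<open>The weight itself enforces the adjacency condition. Sums over heights can therefore be
  enlarged or cut down to neighbours without changing their value.\<close>

lemma wt_neq_0D:
  assumes "wt q L X Y a b c d \<noteq> 0"
  shows "\<bar>b - a\<bar> = 1" "\<bar>d - b\<bar> = 1" "\<bar>d - c\<bar> = 1" "\<bar>c - a\<bar> = 1"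
  using assms by (auto simp: wt_def Let_def split: if_splits)

text \<open>The hypothesis lists the twenty closed walks \<open>0, a1, e, c1, c, f1, 0\<close> with steps of length one.\<close>
lemma yang_baxter_0:
  assumes "q \<noteq> 0" "q \<noteq> 1" and L: "\<And>k. L * q powi k \<noteq> 1"
    and "(a1, e, c1, c, f1) \<in> {
      (1, 2, 3, 2, 1), (1, 2, 1, 2, 1), (1, 2, 1, 0, 1), (1, 2, 1, 0, -1), (1, 0, 1, 2, 1),
      (1, 0, 1, 0, 1), (1, 0, 1, 0, -1), (1, 0, -1, 0, 1), (1, 0, -1, 0, -1), (1, 0, -1, -2, -1),
      (-1, 0, 1, 2, 1), (-1, 0, 1, 0, 1), (-1, 0, 1, 0, -1), (-1, 0, -1, 0, 1), (-1, 0, -1, 0, -1),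
      (-1, 0, -1, -2, -1), (-1, -2, -1, 0, 1), (-1, -2, -1, 0, -1), (-1, -2, -1, -2, -1), (-1, -2, -3, -2, -1)}"
  shows "wt q L x2 y 0 a1 f1 (a1 - 1) * wt q L x1 y f1 (a1 - 1) c c1 * wt q L x2 x1 a1 e (a1 - 1) c1 +
     wt q L x2 y 0 a1 f1 (a1 + 1) * wt q L x1 y f1 (a1 + 1) c c1 * wt q L x2 x1 a1 e (a1 + 1) c1 =
     wt q L x2 x1 0 (-1) f1 c * wt q L x1 y 0 a1 (-1) e * wt q L x2 y (-1) e c c1 +
     wt q L x2 x1 0 1 f1 c * wt q L x1 y 0 a1 1 e * wt q L x2 y 1 e c c1"
proof -
  \<comment> \<open>With base height 0 the dynamical denominators are 1 - L q^k for k = -1, 0, 1.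
    Substituting L = m q makes them the polynomials \<open>u\<close>, \<open>v\<close>,
    \<open>w\<close>, which stay atomic while fractions are cleared and are expanded only
    afterwards.\<close>
  obtain m where m: "L = m * q"
    using assms(1) by (metis nonzero_divide_eq_eq)
  define u v w s where "u = 1 - m" and "v = 1 - m * q" and "w = 1 - m * (q * q)" and "s = 1 - q"
  note uvws = u_def v_def w_def s_def
  have nz: "u \<noteq> 0" "v \<noteq> 0" "w \<noteq> 0" "s \<noteq> 0"
    using L[of 0] L[of 1] L[of "-1"] assms(1,2)
    by (auto simp: m uvws power_int_minus mult.assoc)
  have fold: "1 - m = u" "1 - m * q = v" "1 - q * m = v" "1 - m * (q * q) = w" "1 - q * (m * q) = w"
    "1 - q = s" "q - m * q = q * u" "q - m * (q * q) = q * v"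
    by (simp_all add: uvws algebra_simps)
  show ?thesis
    using assms(4) unfolding m
    apply (elim insertE emptyE; simp only: prod.inject; elim conjE; hypsubst; simp only: wt_def Let_def)
    apply (simp_all add: mult.assoc assms(1) fold nz)
    apply (simp_all add: divide_simps nz)
    apply (simp_all only: uvws)
    apply (simp_all add: algebra_simps)
    done
qed

text \<open>The hexagon with boundary heights a, a1, e, c1, c, f1 is cut into three blocks in two
  ways; each side sums over the inner height. If some boundary step is not a unit step, every term
  vanishes. Otherwise \<open>wt_shift\<close> moves a to 0 and leaves twenty cases.\<close>

lemma yang_baxter:
  assumes "q \<noteq> 0" "q \<noteq> 1" and L: "\<And>k. L * q powi k \<noteq> 1"
  shows "(\<Sum>e1\<in>{a1 - 1, a1 + 1}. wt q L x2 y a a1 f1 e1 * wt q L x1 y f1 e1 c c1 *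
        wt q L x2 x1 a1 e e1 c1) =
    (\<Sum>f\<in>{a - 1, a + 1}. wt q L x2 x1 a f f1 c * wt q L x1 y a a1 f e * wt q L x2 y f e c c1)"
proof (cases "\<bar>a1 - a\<bar> = 1 \<and> \<bar>e - a1\<bar> = 1 \<and> \<bar>c1 - e\<bar> =
      1 \<and> \<bar>c1 - c\<bar> = 1 \<and> \<bar>c - f1\<bar> = 1 \<and> \<bar>f1 - a\<bar> = 1")
  case False
  have wt_eq_0: "wt q L u v i j k l = 0" if "\<bar>j - i\<bar> \<noteq> 1 \<or> \<bar>l -
        j\<bar> \<noteq> 1 \<or> \<bar>l - k\<bar> \<noteq> 1 \<or> \<bar>k - i\<bar> \<noteq> 1" for u v i j k l
    using wt_neq_0D[of q L u v i j k l] that by blast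
  have "wt q L x2 y a a1 f1 e1 * wt q L x1 y f1 e1 c c1 * wt q L x2 x1 a1 e e1 c1 = 0"
    "wt q L x2 x1 a f f1 c * wt q L x1 y a a1 f e * wt q L x2 y f e c c1 = 0" for e1 f
    using False by (auto simp: wt_eq_0)
  then show ?thesis by (simp only: sum.neutral_const)
next
  case True
  define A1 E C1 C F1 where "A1 = a1 - a" and "E = e - a" and "C1 = c1 - a" and "C = c - a" and "F1 = f1 - a"
  have eqs: "a1 = a + A1" "e = a + E" "c1 = a + C1" "c = a + C" "f1 = a + F1"
    by (simp_all add: A1_def E_def C1_def C_def F1_def)
  have "(L * q powi a) * q powi k \<noteq> 1" for k
    using L[of "a + k"] assms(1) by (simp add: power_int_add mult.assoc)
  moreover have "(A1, E, C1, C, F1) \<in> {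
      (1, 2, 3, 2, 1), (1, 2, 1, 2, 1), (1, 2, 1, 0, 1), (1, 2, 1, 0, -1), (1, 0, 1, 2, 1),
      (1, 0, 1, 0, 1), (1, 0, 1, 0, -1), (1, 0, -1, 0, 1), (1, 0, -1, 0, -1), (1, 0, -1, -2, -1),
      (-1, 0, 1, 2, 1), (-1, 0, 1, 0, 1), (-1, 0, 1, 0, -1), (-1, 0, -1, 0, 1), (-1, 0, -1, 0, -1),
      (-1, 0, -1, -2, -1), (-1, -2, -1, 0, 1), (-1, -2, -1, 0, -1), (-1, -2, -1, -2, -1), (-1, -2, -3, -2, -1)}"
    using True by (auto simp: eqs abs_if split: if_splits)
  ultimately have "wt q (L * q powi a) x2 y 0 A1 F1 (A1 - 1) * wt q (L * q powi a) x1 y F1 (A1 - 1) C C1 *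
        wt q (L * q powi a) x2 x1 A1 E (A1 - 1) C1 +
      wt q (L * q powi a) x2 y 0 A1 F1 (A1 + 1) * wt q (L * q powi a) x1 y F1 (A1 + 1) C C1 *
        wt q (L * q powi a) x2 x1 A1 E (A1 + 1) C1 =
      wt q (L * q powi a) x2 x1 0 (-1) F1 C * wt q (L * q powi a) x1 y 0 A1 (-1) E *
        wt q (L * q powi a) x2 y (-1) E C C1 +
      wt q (L * q powi a) x2 x1 0 1 F1 C * wt q (L * q powi a) x1 y 0 A1 1 E *
        wt q (L * q powi a) x2 y 1 E C C1"
    by (intro yang_baxter_0 assms(1,2))
  from this[folded wt_shift[OF assms(1)]] show ?thesis
    by (simp add: eqs algebra_simps)
qed

text \<open>A transfer matrix product kept as a row vector: the total weight of the height sequences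
  through the sets \<open>S j\<close> that arrive at height e in column m. This form lets a crossing
  be moved one column at a time.\<close>

primrec path_vec :: "(nat \<Rightarrow> int \<Rightarrow> int \<Rightarrow> complex) \<Rightarrow> (nat \<Rightarrow> int set) \<Rightarrow> nat \<Rightarrow> int \<Rightarrow> complex" where
  "path_vec g S 0 e = 1"
| "path_vec g S (Suc m) e = (\<Sum>f\<in>S m. path_vec g S m f * g m f e)"

lemma sum_PiE_insert:
  assumes "x \<notin> A" "finite A" "\<And>i. i \<in> insert x A \<Longrightarrow> finite (S i)"
  shows "(\<Sum>f\<in>PiE (insert x A) S. F f) = (\<Sum>f\<in>PiE A S. \<Sum>v\<in>S x. F (f(x := v)))"
proof -
  have "(\<Sum>f\<in>PiE (insert x A) S. F f) = (\<Sum>(v, f)\<in>S x \<times> PiE A S. F (f(x := v)))"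
    unfolding PiE_insert_eq using inj_combinator[OF assms(1), of S]
    by (subst sum.reindex) (auto simp: case_prod_unfold)
  also have "\<dots> = (\<Sum>v\<in>S x. \<Sum>f\<in>PiE A S. F (f(x := v)))"
    by (simp add: sum.cartesian_product)
  finally show ?thesis by (subst (asm) sum.swap)
qed

text \<open>The function \<phi> of the end height is arbitrary so that the induction can absorb the
  sum over the last height into it.\<close>

lemma sum_paths:
  assumes "\<And>j. j \<le> m \<Longrightarrow> finite (S j)"
  shows "(\<Sum>r\<in>PiE {..m} S. (\<Prod>j<m. g j (r j) (r (Suc j))) * \<phi> (r m)) =
        (\<Sum>e\<in>S m. path_vec g S m e * \<phi> e)"
  using assms
proof (induction m arbitrary: \<phi>)
  case 0
  then show ?case using sum_PiE_insert[of 0 "{}" S "\<lambda>r. \<phi> (r 0)"] by simp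
next
  case (Suc m)
  have "(\<Sum>r\<in>PiE {..Suc m} S. (\<Prod>j<Suc m. g j (r j) (r (Suc j))) * \<phi> (r (Suc m))) =
      (\<Sum>r\<in>PiE {..m} S. \<Sum>v\<in>S (Suc m). (\<Prod>j<m. g j (r j) (r (Suc j))) * g m (r m) v * \<phi> v)"
    using Suc.prems unfolding atMost_Suc by (subst sum_PiE_insert) (auto intro!: sum.cong prod.cong)
  also have "\<dots> = (\<Sum>r\<in>PiE {..m} S. (\<Prod>j<m. g j (r j) (r (Suc j))) *
        (\<Sum>v\<in>S (Suc m). g m (r m) v * \<phi> v))"
    by (simp add: sum_distrib_left mult.assoc)
  also have "\<dots> = (\<Sum>e\<in>S m. path_vec g S m e * (\<Sum>v\<in>S (Suc m). g m e v * \<phi> v))"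
    using Suc.prems by (intro Suc.IH) auto
  also have "\<dots> = (\<Sum>v\<in>S (Suc m). path_vec g S (Suc m) v * \<phi> v)"
    by (simp add: sum_distrib_left sum_distrib_right mult.assoc) (rule sum.swap)
  finally show ?case .
qed

definition two_rows :: "complex \<Rightarrow> complex \<Rightarrow> (nat \<Rightarrow> int) \<Rightarrow> (nat \<Rightarrow> int) \<Rightarrow> (nat \<Rightarrow> complex) \<Rightarrow>
    complex \<Rightarrow> complex \<Rightarrow> nat \<Rightarrow> int \<Rightarrow> int \<Rightarrow> complex" where
  "two_rows q L a c Y x x' j b b' =
     wt q L x (Y j) (a j) (a (Suc j)) b b' * wt q L x' (Y j) b b' (c j) (c (Suc j))"

text \<open>Here \<open>a\<close> and \<open>c\<close> are the rows of heights above and below the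
  row that is summed over. The assumption on \<open>S j\<close> says that it misses no height
  adjacent to both neighbours. At the ends the domain walls force the heights to rise by one twice
  on the left and to fall by one twice on the right.\<close>

context
  fixes q L :: complex and a c :: "nat \<Rightarrow> int" and Y :: "nat \<Rightarrow> complex" and S :: "nat \<Rightarrow> int set" and n :: nat
  assumes q: "q \<noteq> 0" "q \<noteq> 1" and L: "\<And>k. L * q powi k \<noteq> 1"
    and S: "\<And>j v. j \<le> n \<Longrightarrow> v \<in> {a j - 1, a j + 1} \<Longrightarrow>
          v \<in> S j \<or> \<bar>c j - v\<bar> \<noteq> 1"
    and fin: "\<And>j. j \<le> n \<Longrightarrow> finite (S j)"
    and S0: "S 0 = {a 0 + 1}" "c 0 = a 0 + 2" and Sn: "S n = {a n - 1}" "c n = a n - 2"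
begin

text \<open>The Yang-Baxter equation moves an extra crossing of the two rows past the columns, from left to right.\<close>
lemma zipper:
  assumes "m \<le> n" "e \<in> S m"
  shows "(\<Sum>f\<in>S m. path_vec (two_rows q L a c Y x2 x1) S m f * wt q L x2 x1 (a m) e f (c m)) =
    (x1 - q * x2) / (1 - q) * path_vec (two_rows q L a c Y x1 x2) S m e"
  using assms
proof (induction m arbitrary: e)
  case 0
  \<comment> \<open>The left end rises twice, so the crossing is of type (1, 1, 1, 1), whose weight
    contains no dynamical factor.\<close>
  then show ?case using S0 by (simp add: wt_def)
next
  case (Suc m)
  let ?R = "\<lambda>m e f. wt q L x2 x1 (a m) e f (c m)"
  let ?v12 = "path_vec (two_rows q L a c Y x1 x2) S m" and ?v21 = "path_vec (two_rows q L a c Y x2 x1) S m"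
  have fm: "finite (S m)" "finite (S (Suc m))" using fin Suc.prems by auto
  \<comment> \<open>\<open>yang_baxter\<close> for column m. Its sum over the two neighbours of
    \<open>a (Suc m)\<close> and the sum over \<open>S (Suc m)\<close> agree because they differ
    only by vanishing weights.\<close>
  have YB: "(\<Sum>e1\<in>S (Suc m). two_rows q L a c Y x2 x1 m f1 e1 * ?R (Suc m) e e1) =
      (\<Sum>f\<in>{a m - 1, a m + 1}. ?R m f f1 * two_rows q L a c Y x1 x2 m f e)" for f1
  proof -
    have "(\<Sum>e1\<in>S (Suc m). two_rows q L a c Y x2 x1 m f1 e1 * ?R (Suc m) e e1) =
        (\<Sum>e1\<in>S (Suc m) \<union> {a (Suc m) - 1, a (Suc m) + 1}. two_rows q L a c Y x2 x1 m f1 e1 * ?R (Suc m) e e1)"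
      using fm S[OF Suc.prems(1)]
      by (intro sum.mono_neutral_left) (auto dest: wt_neq_0D)
    also have "\<dots> = (\<Sum>e1\<in>{a (Suc m) - 1, a (Suc m) + 1}. two_rows q L a c Y x2 x1 m f1 e1 *
          ?R (Suc m) e e1)"
      using fm by (intro sum.mono_neutral_right) (auto simp: abs_if dest!: wt_neq_0D split: if_splits)
    finally show ?thesis
      using yang_baxter[OF q L, where ?a = "a m" and ?a1.0 = "a (Suc m)" and ?f1.0 = f1 and c = "c m"
          and ?c1.0 = "c (Suc m)" and e = e and y = "Y m" and ?x1.0 = x1 and ?x2.0 = x2]
      by (simp add: two_rows_def mult.assoc)
  qed
  have "(\<Sum>e1\<in>S (Suc m). path_vec (two_rows q L a c Y x2 x1) S (Suc m) e1 * ?R (Suc m) e e1) =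
      (\<Sum>f1\<in>S m. ?v21 f1 * (\<Sum>e1\<in>S (Suc m). two_rows q L a c Y x2 x1 m f1 e1 * ?R (Suc m) e e1))"
    by (simp add: sum_distrib_left sum_distrib_right mult.assoc) (rule sum.swap)
  also have "\<dots> = (\<Sum>f\<in>{a m - 1, a m + 1}. (\<Sum>f1\<in>S m. ?v21 f1 * ?R m f f1) *
        two_rows q L a c Y x1 x2 m f e)"
    unfolding YB sum_distrib_left sum_distrib_right
    by (subst sum.swap) (simp only: mult.assoc)
  also have "\<dots> = (\<Sum>f\<in>{a m - 1, a m + 1} \<inter> S m. (\<Sum>f1\<in>S m. ?v21 f1 *
        ?R m f f1) * two_rows q L a c Y x1 x2 m f e)"
  \<comment> \<open>A neighbour of \<open>a m\<close> outside \<open>S m\<close> is not adjacent to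
    \<open>c m\<close>, so the crossing weight is zero; the induction hypothesis is then needed only
    on \<open>S m\<close>.\<close>
  proof (intro sum.mono_neutral_right ballI)
    fix f assume f: "f \<in> {a m - 1, a m + 1} - {a m - 1, a m + 1} \<inter> S m"
    then have "\<bar>c m - f\<bar> \<noteq> 1" using S[of m f] Suc.prems by auto
    then have "?R m f f1 = 0" for f1 using wt_neq_0D(2)[of q L x2 x1 "a m" f f1 "c m"] by blast
    then show "(\<Sum>f1\<in>S m. ?v21 f1 * ?R m f f1) * two_rows q L a c Y x1 x2 m f e = 0" by simp
  qed auto
  also have "\<dots> = (\<Sum>f\<in>{a m - 1, a m + 1} \<inter> S m. (x1 - q * x2) / (1 - q) * ?v12 f *
        two_rows q L a c Y x1 x2 m f e)"
    using Suc by (intro sum.cong) auto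
  also have "\<dots> = (\<Sum>f\<in>S m. (x1 - q * x2) / (1 - q) * ?v12 f * two_rows q L a c Y x1 x2 m f e)"
    using fm by (intro sum.mono_neutral_left) (auto simp: two_rows_def abs_if dest!: wt_neq_0D split: if_splits)
  finally show ?case by (simp add: sum_distrib_left mult.assoc)
qed

text \<open>On the right the heights fall twice, and the type (-1, -1, -1, -1) has the same weight
  as the crossing on the left. The hypothesis says that this weight is nonzero, so that it can be
  cancelled.\<close>

lemma two_rows_commute:
  assumes "x1 \<noteq> q * x2"
  shows "(\<Sum>r\<in>PiE {..n} S. \<Prod>j<n. two_rows q L a c Y x2 x1 j (r j) (r (Suc j))) =
    (\<Sum>r\<in>PiE {..n} S. \<Prod>j<n. two_rows q L a c Y x1 x2 j (r j) (r (Suc j)))"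
proof -
  have *: "(\<Sum>r\<in>PiE {..n} S. \<Prod>j<n. g j (r j) (r (Suc j))) = path_vec g S n (a n - 1)" for g
    using sum_paths[of n S g "\<lambda>_. 1"] fin Sn by simp
  have "wt q L x2 x1 (a n) (a n - 1) (a n - 1) (c n) = (x1 - q * x2) / (1 - q)"
    using Sn by (simp add: wt_def)
  with zipper[of n "a n - 1" x2 x1] show ?thesis
    unfolding * using assms q by (simp add: Sn)
qed

end

section \<open>The partition function\<close>

text \<open>The normalised partition function as a rational function of the multiplicative
  variables. No logarithms are involved, so L = 0 is a legitimate argument.\<close>

definition Zt :: "complex \<Rightarrow> nat \<Rightarrow> (nat \<Rightarrow> complex) \<Rightarrow> (nat \<Rightarrow> complex) \<Rightarrow> complex \<Rightarrow> complex" where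
  "Zt q n X Y L = (\<Sum>M\<in>states n. \<Prod>i<n. \<Prod>j<n.
     wt q L (X i) (Y j) (M $$ (i, j)) (M $$ (i, Suc j)) (M $$ (Suc i, j)) (M $$ (Suc i, Suc j)))"

lemma statesI:
  assumes "M \<in> carrier_mat (n + 1) (n + 1)"
    and "\<And>i j. i \<le> n \<Longrightarrow> j < n \<Longrightarrow> \<bar>M $$ (i, Suc j) -
          M $$ (i, j)\<bar> = 1"
    and "\<And>i j. i < n \<Longrightarrow> j \<le> n \<Longrightarrow> \<bar>M $$ (Suc i, j) -
          M $$ (i, j)\<bar> = 1"
    and "\<And>k. k \<le> n \<Longrightarrow> M $$ (0, k) = int k" "\<And>k. k \<le> n \<Longrightarrow>
          M $$ (k, 0) = int k"
    and "\<And>k. k \<le> n \<Longrightarrow> M $$ (n, k) = int n - int k" "\<And>k. k \<le> n \<Longrightarrow>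
          M $$ (k, n) = int n - int k"
  shows "M \<in> states n"
  unfolding states_def mem_Collect_eq Suc_eq_plus1[symmetric] using assms by simp

lemma statesD:
  assumes "M \<in> states n"
  shows "M \<in> carrier_mat (Suc n) (Suc n)"
    and "\<And>i j. i \<le> n \<Longrightarrow> j < n \<Longrightarrow> \<bar>M $$ (i, Suc j) -
          M $$ (i, j)\<bar> = 1"
    and "\<And>i j. i < n \<Longrightarrow> j \<le> n \<Longrightarrow> \<bar>M $$ (Suc i, j) -
          M $$ (i, j)\<bar> = 1"
    and "\<And>k. k \<le> n \<Longrightarrow> M $$ (0, k) = int k" "\<And>k. k \<le> n \<Longrightarrow>
          M $$ (k, 0) = int k"
    and "\<And>k. k \<le> n \<Longrightarrow> M $$ (n, k) = int n - int k" "\<And>k. k \<le> n \<Longrightarrow>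
          M $$ (k, n) = int n - int k"
  using assms unfolding states_def mem_Collect_eq Suc_eq_plus1[symmetric] by auto

lemma unit_steps_bound:
  fixes f :: "nat \<Rightarrow> int"
  assumes "\<And>j. j < n \<Longrightarrow> \<bar>f (Suc j) - f j\<bar> = 1" "j \<le> k" "k \<le> n"
  shows "\<bar>f k - f j\<bar> \<le> int (k - j)"
  using assms(2,3)
proof (induction k rule: dec_induct)
  case (step m)
  then show ?case using assms(1)[of m] by (auto simp: Suc_diff_le)
qed simp

lemma states_row_bound:
  assumes "M \<in> states n" "i \<le> n" "j \<le> k" "k \<le> n"
  shows "\<bar>M $$ (i, k) - M $$ (i, j)\<bar> \<le> int (k - j)"
  using unit_steps_bound[of n "\<lambda>j. M $$ (i, j)"] statesD(2)[OF assms(1)] assms by auto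

lemma states_col_bound:
  assumes "M \<in> states n" "j \<le> n" "i \<le> k" "k \<le> n"
  shows "\<bar>M $$ (k, j) - M $$ (i, j)\<bar> \<le> int (k - i)"
  using unit_steps_bound[of n "\<lambda>i. M $$ (i, j)"] statesD(3)[OF assms(1)] assms by auto

text \<open>A box around all states: boundary heights are fixed, and inner ones are bounded by the
  number of steps from the corner (0, 0). It is coarse on purpose, since inadmissible heights have
  weight zero.\<close>

definition heights :: "nat \<Rightarrow> nat \<Rightarrow> nat \<Rightarrow> int set" where
  "heights n i j =
    (if i = 0 then {int j} else if j = 0 then {int i}
     else if i = n then {int n - int j} else if j = n then {int n - int i}
     else {- int (i + j)..int (i + j)})"

lemma finite_heights [simp]: "finite (heights n i j)"
  by (simp add: heights_def)

lemma states_heights: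
  assumes "M \<in> states n" "i \<le> n" "j \<le> n"
  shows "M $$ (i, j) \<in> heights n i j"
  using states_row_bound[OF assms(1,2), of 0 j] assms statesD(4-)[OF assms(1)]
  by (auto simp: heights_def)

text \<open>Passing from states to arbitrary families of rows makes the rows independent summation
  variables, so a single row can be summed with the others fixed. A family that violates adjacency
  has a block of weight zero.\<close>

lemma Zt_eq_sum_rows:
  assumes "n > 0"
  shows "Zt q n X Y L = (\<Sum>R\<in>PiE {..n} (\<lambda>i. PiE {..n} (heights n i)). \<Prod>i<n. \<Prod>j<n.
     wt q L (X i) (Y j) (R i j) (R i (Suc j)) (R (Suc i) j) (R (Suc i) (Suc j)))"
    (is "_ = sum ?F ?P")
proof -
  define \<Theta> :: "int mat \<Rightarrow> nat \<Rightarrow> nat \<Rightarrow> int"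
    where "\<Theta> M = (\<lambda>i\<in>{..n}. \<lambda>j\<in>{..n}. M $$ (i, j))" for M
  have \<Theta>: "\<Theta> M i j = M $$ (i, j)" if "i \<le> n" "j \<le> n" for M i j
    using that by (simp add: \<Theta>_def)
  have "inj_on \<Theta> (states n)"
  proof (intro inj_onI eq_matI)
    fix M N i j assume MN: "M \<in> states n" "N \<in> states n" "\<Theta> M =
          \<Theta> N" "i < dim_row N" "j < dim_col N"
    then have "i \<le> n" "j \<le> n" using statesD(1)[of N n] by auto
    then show "M $$ (i, j) = N $$ (i, j)" using \<Theta>[of i j] MN(3) by metis
  qed (auto dest!: statesD(1))
  have "Zt q n X Y L = sum (?F \<circ> \<Theta>) (states n)"
    unfolding Zt_def by (auto intro!: sum.cong prod.cong simp: \<Theta>)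
  also have "\<dots> = sum ?F (\<Theta> ` states n)"
    by (rule sum.reindex[symmetric]) fact
  also have "\<dots> = sum ?F ?P"
  proof (intro sum.mono_neutral_left ballI)
    show "finite ?P" by (intro finite_PiE) auto
    show "\<Theta> ` states n \<subseteq> ?P"
      unfolding \<Theta>_def image_subset_iff restrict_PiE_iff atMost_iff using states_heights by blast
    fix R assume R: "R \<in> ?P - \<Theta> ` states n"
    show "?F R = 0"
    proof (rule ccontr)
      assume "?F R \<noteq> 0"
      then have w: "wt q L (X i) (Y j) (R i j) (R i (Suc j)) (R (Suc i) j) (R (Suc i) (Suc j)) \<noteq> 0"
        if "i < n" "j < n" for i j using that by auto
      have hR: "R i j \<in> heights n i j" if "i \<le> n" "j \<le> n" for i j
        using R that by (auto simp: PiE_iff)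
      let ?M = "mat (n + 1) (n + 1) (\<lambda>(i, j). R i j)"
      have "?M \<in> states n"
      proof (rule statesI)
        show "\<bar>?M $$ (i, Suc j) - ?M $$ (i, j)\<bar> = 1" if "i \<le> n" "j < n" for i j
          using wt_neq_0D(1)[OF w[of i j]] wt_neq_0D(3)[OF w[of "i - 1" j]] that by (cases "i < n") auto
        show "\<bar>?M $$ (Suc i, j) - ?M $$ (i, j)\<bar> = 1" if "i < n" "j \<le> n" for i j
          using wt_neq_0D(4)[OF w[of i j]] wt_neq_0D(2)[OF w[of i "j - 1"]] that by (cases "j < n") auto
        show "?M $$ (0, k) = int k" if "k \<le> n" for k
          using hR[of 0 k] that by (simp add: heights_def)
        show "?M $$ (k, 0) = int k" if "k \<le> n" for k
          using hR[of k 0] that by (simp add: heights_def split: if_splits)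
        show "?M $$ (n, k) = int n - int k" if "k \<le> n" for k
          using hR[of n k] that assms by (simp add: heights_def split: if_splits)
        show "?M $$ (k, n) = int n - int k" if "k \<le> n" for k
          using hR[of k n] that assms by (simp add: heights_def split: if_splits)
      qed simp
      \<comment> \<open>Outside the index range both sides are \<open>undefined\<close>, because the
        members of \<open>PiE\<close> are extensional in either index.\<close>
      moreover have "\<Theta> ?M = R"
      proof (intro ext)
        fix i j
        show "\<Theta> ?M i j = R i j"
        proof (cases "i \<le> n")
          case True
          then have "R i \<in> PiE {..n} (heights n i)" using R by (auto simp: PiE_iff)
          then have "R i j = undefined" if "\<not> j \<le> n" using that by (auto simp: PiE_def extensional_def)
          then show ?thesis using True by (simp add: \<Theta>_def)
        next
          case False
          then have "R i = undefined" using R by (auto simp: PiE_def extensional_def)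
          then show ?thesis using False by (simp add: \<Theta>_def)
        qed
      qed
      ultimately show False using R by force
    qed
  qed
  finally show ?thesis .
qed

text \<open>The row of heights number \<open>Suc k\<close> lies between the block rows with
  parameters \<open>X k\<close> and \<open>X (Suc k)\<close> and meets no others. Fixing the
  remaining rows reduces the exchange to \<open>two_rows_commute\<close>.\<close>

lemma Zt_swap:
  assumes q: "q \<noteq> 0" "q \<noteq> 1" and L: "\<And>k. L * q powi k \<noteq> 1"
    and k: "Suc k < n" and X: "X k \<noteq> q * X (Suc k)"
  shows "Zt q n (\<lambda>i. X (Transposition.transpose k (Suc k) i)) Y L = Zt q n X Y L"
proof -
  define A where "A = {..n} - {Suc k}"
  define B where "B = {..<n} - {k, Suc k}"
  define T where "T X i R = (\<Prod>j<n. wt q L (X i) (Y j) (R i j) (R i (Suc j)) (R (Suc i) j) (R (Suc i) (Suc j)))"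
    for X :: "nat \<Rightarrow> complex" and i and R :: "nat \<Rightarrow> nat \<Rightarrow> int"
  let ?P = "PiE A (\<lambda>i. PiE {..n} (heights n i))" and ?S = "heights n (Suc k)"
  have A: "{..n} = insert (Suc k) A" "Suc k \<notin> A" "finite A" using k by (auto simp: A_def)
  have B: "{..<n} = insert k (insert (Suc k) B)" "k \<notin> B" "Suc k \<notin> B" "finite B"
    using k by (auto simp: B_def)
  have *: "Zt q n X Y L = (\<Sum>f\<in>?P. (\<Prod>i\<in>B. T X i f) *
      (\<Sum>r\<in>PiE {..n} ?S. \<Prod>j<n. two_rows q L (f k) (f (Suc (Suc k))) Y (X k) (X (Suc k)) j (r j) (r (Suc j))))"
    for X
  proof -
    have "n > 0" using k by auto
    then have "Zt q n X Y L = (\<Sum>R\<in>PiE (insert (Suc k) A) (\<lambda>i. PiE {..n} (heights n i)). \<Prod>i<n. T X i R)"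
      by (simp add: Zt_eq_sum_rows T_def A(1))
    also have "\<dots> = (\<Sum>f\<in>?P. \<Sum>r\<in>PiE {..n} ?S. \<Prod>i<n. T X i (f(Suc k := r)))"
      using A by (intro sum_PiE_insert) (auto intro!: finite_PiE)
    also have "\<dots> = (\<Sum>f\<in>?P. \<Sum>r\<in>PiE {..n} ?S. (\<Prod>i\<in>B. T X i f) *
        (\<Prod>j<n. two_rows q L (f k) (f (Suc (Suc k))) Y (X k) (X (Suc k)) j (r j) (r (Suc j))))"
    proof (intro sum.cong refl)
      fix f :: "nat \<Rightarrow> nat \<Rightarrow> int" and r
      let ?f = "f(Suc k := r)"
      have "(\<Prod>i<n. T X i ?f) = T X k ?f * T X (Suc k) ?f * (\<Prod>i\<in>B. T X i ?f)"
        using B by simp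
      also have "(\<Prod>i\<in>B. T X i ?f) = (\<Prod>i\<in>B. T X i f)"
        by (intro prod.cong) (auto simp: T_def B_def)
      also have "T X k ?f * T X (Suc k) ?f =
          (\<Prod>j<n. two_rows q L (f k) (f (Suc (Suc k))) Y (X k) (X (Suc k)) j (r j) (r (Suc j)))"
        by (simp add: T_def two_rows_def prod.distrib)
      finally show "(\<Prod>i<n. T X i ?f) = (\<Prod>i\<in>B. T X i f) *
          (\<Prod>j<n. two_rows q L (f k) (f (Suc (Suc k))) Y (X k) (X (Suc k)) j (r j) (r (Suc j)))"
        by (simp only: mult.commute)
    qed
    finally show ?thesis by (simp add: sum_distrib_left)
  qed
  show ?thesis
    unfolding *
  proof (rule sum.cong[OF refl], rule arg_cong2[where f = "(*)"])
    fix f assume f: "f \<in> ?P"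
    show "(\<Prod>i\<in>B. T (\<lambda>i. X (Transposition.transpose k (Suc k) i)) i f) =
          (\<Prod>i\<in>B. T X i f)"
      by (intro prod.cong) (auto simp: T_def B_def Transposition.transpose_def)
    have h: "f i j \<in> heights n i j" if "i \<in> {k, Suc (Suc k)}" "j \<le> n" for i j
      using f that k by (auto simp: A_def PiE_iff)
    \<comment> \<open>In an inner column the box grows by one from row k to row
      \<open>Suc k\<close>, so both neighbours lie in it. The second alternative serves the first
      and last columns, where the height is prescribed.\<close>
    have S: "v \<in> ?S j \<or> \<bar>f (Suc (Suc k)) j - v\<bar> \<noteq> 1" if "j \<le> n" "v \<in> {f k j - 1, f k j + 1}" for j v
      using h[of k j] h[of "Suc (Suc k)" j] that k by (auto simp: heights_def split: if_splits)
    have ends: "?S 0 = {f k 0 + 1}" "f (Suc (Suc k)) 0 = f k 0 + 2"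
      "?S n = {f k n - 1}" "f (Suc (Suc k)) n = f k n - 2"
      using h[of k 0] h[of "Suc (Suc k)" 0] h[of k n] h[of "Suc (Suc k)" n] k
      by (auto simp: heights_def split: if_splits)
    show "(\<Sum>r\<in>PiE {..n} ?S. \<Prod>j<n. two_rows q L (f k) (f (Suc (Suc k))) Y
          (X (Transposition.transpose k (Suc k) k)) (X (Transposition.transpose k (Suc k) (Suc k))) j (r j) (r (Suc j))) =
      (\<Sum>r\<in>PiE {..n} ?S. \<Prod>j<n. two_rows q L (f k) (f (Suc (Suc k))) Y (X k) (X (Suc k)) j (r j) (r (Suc j)))"
      using two_rows_commute[OF q L S _ ends X] by simp
  qed
qed

section \<open>Frozen corners and reduction of the size\<close>

definition state_weight :: "complex \<Rightarrow> nat \<Rightarrow> (nat \<Rightarrow> complex) \<Rightarrow> (nat \<Rightarrow> complex) \<Rightarrow> complex \<Rightarrow> int mat \<Rightarrow> complex" where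
  "state_weight q n X Y L M = (\<Prod>i<n. \<Prod>j<n.
     wt q L (X i) (Y j) (M $$ (i, j)) (M $$ (i, Suc j)) (M $$ (Suc i, j)) (M $$ (Suc i, Suc j)))"

lemma Zt_alt: "Zt q n X Y L = (\<Sum>M\<in>states n. state_weight q n X Y L M)"
  by (simp add: Zt_def state_weight_def)

lemma prod_square_top_right:
  fixes f :: "nat \<Rightarrow> nat \<Rightarrow> complex"
  shows "(\<Prod>i<Suc n. \<Prod>j<Suc n. f i j) = f 0 n * (\<Prod>j<n. f 0 j) * (\<Prod>i<n. f (Suc i) n) *
        (\<Prod>i<n. \<Prod>j<n. f (Suc i) j)"
proof -
  have "(\<Prod>i<Suc n. \<Prod>j<Suc n. f i j) = (\<Prod>j<Suc n. f 0 j) *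
        (\<Prod>i<n. \<Prod>j<Suc n. f (Suc i) j)"
    by (rule prod.lessThan_Suc_shift)
  then show ?thesis
    by (simp only: prod.lessThan_Suc prod.distrib mult.assoc mult.left_commute mult.commute)
qed

lemma prod_square_bottom_right:
  fixes f :: "nat \<Rightarrow> nat \<Rightarrow> complex"
  shows "(\<Prod>i<Suc n. \<Prod>j<Suc n. f i j) = f n n * (\<Prod>j<n. f n j) * (\<Prod>i<n. f i n) *
        (\<Prod>i<n. \<Prod>j<n. f i j)"
  by (simp only: prod.lessThan_Suc prod.distrib mult.assoc mult.left_commute mult.commute)

text \<open>At Y n = X 0 the corner block whose lower left height is n - 1 carries the factor Y - X
  and vanishes, so that height is n + 1. This forces height row 1 and column n. Deleting the first
  row and the last column leaves a state of size n with all heights raised by one, which is why L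
  becomes L q.\<close>

lemma Zt_frozen_top_right:
  assumes q: "q \<noteq> 0" "q \<noteq> 1" and L: "L * q ^ n \<noteq> 1" and XY: "Y n = X 0"
  shows "Zt q (Suc n) X Y L = X 0 * (\<Prod>j<n. (Y j - q * X 0) / (1 - q)) *
    (\<Prod>i<n. (X 0 - q * X (Suc i)) / (1 - q)) * Zt q n (\<lambda>i. X (Suc i)) Y (L * q)"
proof -
  let ?N = "Suc n"
  let ?S = "{M \<in> states ?N. M $$ (1, n) = int ?N}"
  define up where "up M = mat (Suc ?N) (Suc ?N)
    (\<lambda>(i, j). if i = 0 then int j else if j = ?N then int ?N - int i else M $$ (i - 1, j) + 1)" for M :: "int mat"
  define down where "down M = mat ?N ?N (\<lambda>(i, j). M $$ (Suc i, j) - 1)" for M :: "int mat"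
  have up: "up M \<in> ?S" if M: "M \<in> states n" for M
  proof -
    note D = statesD[OF M]
    have "up M \<in> states ?N"
    proof (rule statesI)
      show "up M \<in> carrier_mat (?N + 1) (?N + 1)" by (simp add: up_def)
      show "\<bar>up M $$ (i, Suc j) - up M $$ (i, j)\<bar> = 1" if "i \<le> ?N" "j < ?N" for i j
        using that D(2)[of "i - 1" j] D(7)[of "i - 1"] by (cases i; cases "j = n") (auto simp: up_def)
      show "\<bar>up M $$ (Suc i, j) - up M $$ (i, j)\<bar> = 1" if "i < ?N" "j \<le> ?N" for i j
        using that D(3)[of "i - 1" j] D(4)[of j] by (cases i; cases "j = ?N") (auto simp: up_def)
      show "up M $$ (0, k) = int k" if "k \<le> ?N" for k
        using that by (simp add: up_def)
      show "up M $$ (k, 0) = int k" if "k \<le> ?N" for k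
        using that D(5)[of "k - 1"] by (auto simp: up_def)
      show "up M $$ (?N, k) = int ?N - int k" if "k \<le> ?N" for k
        using that D(6)[of k] by (auto simp: up_def)
      show "up M $$ (k, ?N) = int ?N - int k" if "k \<le> ?N" for k
        using that by (auto simp: up_def)
    qed
    moreover have "up M $$ (1, n) = int ?N"
      using D(4)[of n] by (simp add: up_def)
    ultimately show ?thesis by simp
  qed
  \<comment> \<open>The row climbs from 1 to n + 1 in n unit steps, so every step is +1. In the same
    way column n descends from n + 1 to 1 below its first entry.\<close>
  have row1: "M $$ (1, k) = int (Suc k)" if "M \<in> ?S" "k \<le> n" for M k
    using states_row_bound[of M ?N 1 0 k] states_row_bound[of M ?N 1 k n] statesD(5)[of M ?N 1] that by auto
  have coln: "M $$ (Suc k, n) = int ?N - int k" if "M \<in> ?S" "k \<le> n" for M k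
    using states_col_bound[of M ?N n 1 "Suc k"] states_col_bound[of M ?N n "Suc k" ?N] statesD(6)[of M ?N n] that by auto
  have down: "down M \<in> states n" if M: "M \<in> ?S" for M
  proof (rule statesI)
    have MN: "M \<in> states ?N" using M by simp
    note D = statesD[OF MN]
    show "down M \<in> carrier_mat (n + 1) (n + 1)" by (simp add: down_def)
    show "\<bar>down M $$ (i, Suc j) - down M $$ (i, j)\<bar> = 1" if "i \<le> n" "j < n" for i j
      using that D(2)[of "Suc i" j] by (simp add: down_def)
    show "\<bar>down M $$ (Suc i, j) - down M $$ (i, j)\<bar> = 1" if "i < n" "j \<le> n" for i j
      using that D(3)[of "Suc i" j] by (simp add: down_def)
    show "down M $$ (0, k) = int k" if "k \<le> n" for k
      using that row1[OF M, of k] by (simp add: down_def)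
    show "down M $$ (k, 0) = int k" if "k \<le> n" for k
      using that D(5)[of "Suc k"] by (simp add: down_def)
    show "down M $$ (n, k) = int n - int k" if "k \<le> n" for k
      using that D(6)[of k] by (simp add: down_def)
    show "down M $$ (k, n) = int n - int k" if "k \<le> n" for k
      using that coln[OF M, of k] by (simp add: down_def)
  qed
  have weight: "state_weight q ?N X Y L (up M) = X 0 * (\<Prod>j<n. (Y j - q * X 0) / (1 - q)) *
      (\<Prod>i<n. (X 0 - q * X (Suc i)) / (1 - q)) * state_weight q n (\<lambda>i. X (Suc i)) Y (L * q) M"
    if M: "M \<in> states n" for M
  proof -
    note D = statesD[OF M]
    let ?f = "\<lambda>i j. wt q L (X i) (Y j) (up M $$ (i, j)) (up M $$ (i, Suc j)) (up M $$ (Suc i, j)) (up M $$ (Suc i, Suc j))"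
    have "?f 0 n = X 0"
      using D(4)[of n] L XY by (simp add: up_def wt_def field_simps)
    moreover have "(\<Prod>j<n. ?f 0 j) = (\<Prod>j<n. (Y j - q * X 0) / (1 - q))"
      using D(4) by (intro prod.cong) (auto simp: up_def wt_def)
    moreover have "(\<Prod>i<n. ?f (Suc i) n) = (\<Prod>i<n. (X 0 - q * X (Suc i)) / (1 - q))"
      using D(7) XY by (intro prod.cong) (auto simp: up_def wt_def)
    moreover have "(\<Prod>i<n. \<Prod>j<n. ?f (Suc i) j) = state_weight q n (\<lambda>i. X (Suc i)) Y (L *
          q) M"
      unfolding state_weight_def
    proof (intro prod.cong refl)
      fix i j assume ij: "i \<in> {..<n}" "j \<in> {..<n}"
      show "?f (Suc i) j = wt q (L * q) (X (Suc i)) (Y j) (M $$ (i, j)) (M $$ (i, Suc j))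
          (M $$ (Suc i, j)) (M $$ (Suc i, Suc j))"
        using ij wt_shift[OF q(1), of L "X (Suc i)" "Y j" 1 "M $$ (i, j)" "M $$ (i, Suc j)"
            "M $$ (Suc i, j)" "M $$ (Suc i, Suc j)"]
        by (simp add: up_def add.commute)
    qed
    ultimately show ?thesis
      by (simp only: state_weight_def[of q ?N] prod_square_top_right)
  qed
  have "Zt q ?N X Y L = (\<Sum>M\<in>?S. state_weight q ?N X Y L M)"
    unfolding Zt_alt
  proof (intro sum.mono_neutral_right ballI finite_states)
    fix M assume M: "M \<in> states ?N - ?S"
    then have MN: "M \<in> states ?N" by simp
    note D = statesD[OF MN]
    have "M $$ (1, n) = int n - 1"
      using D(3)[of 0 n] D(4)[of n] M by auto
    then have "wt q L (X 0) (Y n) (M $$ (0, n)) (M $$ (0, Suc n)) (M $$ (Suc 0, n)) (M $$ (Suc 0, Suc n)) = 0"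
      using D(4)[of n] D(4)[of ?N] D(7)[of 1] XY by (simp add: wt_def)
    then show "state_weight q ?N X Y L M = 0"
      unfolding state_weight_def prod_square_top_right by simp
  qed auto
  also have "\<dots> = (\<Sum>M\<in>states n. state_weight q ?N X Y L (up M))"
  proof (rule sum.reindex_bij_witness[of _ up down])
    show *: "up (down M) = M" if M: "M \<in> ?S" for M
    proof (rule eq_matI)
      have MN: "M \<in> states ?N" using M by simp
      note D = statesD[OF MN]
      show "dim_row (up (down M)) = dim_row M" "dim_col (up (down M)) = dim_col M"
        using D(1) by (auto simp: up_def)
      fix i j assume "i < dim_row M" "j < dim_col M"
      then have ij: "i \<le> ?N" "j \<le> ?N" using D(1) by auto
      show "up (down M) $$ (i, j) = M $$ (i, j)"
        using ij D(4)[of j] D(7)[of i] by (cases i; cases "j = ?N") (auto simp: up_def down_def)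
    qed
    show "down (up M) = M" if M: "M \<in> states n" for M
      using statesD(1)[OF M] by (intro eq_matI) (auto simp: up_def down_def)
    show "state_weight q ?N X Y L (up (down M)) = state_weight q ?N X Y L M" if "M \<in> ?S" for M
      using *[OF that] by simp
  qed (use up down in auto)
  also have "\<dots> = (\<Sum>M\<in>states n. X 0 * (\<Prod>j<n. (Y j - q * X 0) / (1 - q)) *
      (\<Prod>i<n. (X 0 - q * X (Suc i)) / (1 - q)) * state_weight q n (\<lambda>i. X (Suc i)) Y (L * q) M)"
    by (intro sum.cong refl weight)
  finally show ?thesis
    by (simp only: Zt_alt sum_distrib_left)
qed

text \<open>Each factor is q (1 - L q^k) / (1 - L q^(k+1)).\<close>

lemma telescope_frozen_row:
  fixes q L :: complex
  assumes "\<And>k. k \<le> n \<Longrightarrow> L * q ^ k \<noteq> 1"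
  shows "(\<Prod>k<n. (q - L * q ^ Suc k) / (1 - L * q ^ Suc k)) = q ^ n * (1 - L) / (1 - L * q ^ n)"
  using assms
proof (induction n)
  case (Suc n)
  have nz: "1 - L * q ^ n \<noteq> 0" "1 - L * q ^ Suc n \<noteq> 0" using Suc.prems[of n] Suc.prems[of "Suc n"] by auto
  have "(\<Prod>k<Suc n. (q - L * q ^ Suc k) / (1 - L * q ^ Suc k)) =
      q ^ n * (1 - L) / (1 - L * q ^ n) * (q * (1 - L * q ^ n) / (1 - L * q ^ Suc n))"
    using Suc.IH Suc.prems by (simp add: right_diff_distrib mult.left_commute)
  then show ?case using nz by (simp only:) simp
qed simp

lemma telescope_frozen_col:
  fixes q L :: complex
  assumes "\<And>k. 0 < k \<Longrightarrow> k \<le> Suc n \<Longrightarrow> L * q ^ k \<noteq> 1"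
  shows "(\<Prod>k<n. (1 - L * q ^ Suc (Suc k)) / (1 - L * q ^ Suc k)) = (1 - L * q ^ Suc n) / (1 - L * q)"
  using assms
proof (induction n)
  case 0
  then show ?case using 0[of 1] by simp
next
  case (Suc n)
  have "1 - L * q ^ Suc n \<noteq> 0" "1 - L * q \<noteq> 0" using Suc.prems[of "Suc n"] Suc.prems[of 1] by auto
  moreover have "(\<Prod>k<n. (1 - L * q ^ Suc (Suc k)) / (1 - L * q ^ Suc k)) = (1 - L * q ^ Suc n) / (1 -
        L * q)"
    by (rule Suc.IH) (use Suc.prems in auto)
  ultimately show ?case by (simp only: prod.lessThan_Suc) (simp add: divide_simps)
qed

lemma Zt_frozen_bottom_right:
  assumes q: "q \<noteq> 0" "q \<noteq> 1" and L: "\<And>k. L * q ^ k \<noteq> 1" and XY: "Y n = q * X n"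
  shows "Zt q (Suc n) X Y L = X n * q ^ n * (1 - L * q ^ Suc n) / (1 - L * q ^ n) *
    (\<Prod>j<n. (Y j - X n) / (1 - q)) * (\<Prod>i<n. (Y n - X i) / (1 - q)) * Zt q n X Y L"
proof -
  let ?N = "Suc n"
  let ?S = "{M \<in> states ?N. M $$ (n, n) = 0}"
  define up where "up M = mat (Suc ?N) (Suc ?N)
    (\<lambda>(i, j). if i = ?N then int ?N - int j else if j = ?N then int ?N - int i else M $$ (i, j))" for M :: "int mat"
  define down where "down M = mat ?N ?N (\<lambda>(i, j). M $$ (i, j))" for M :: "int mat"
  have up: "up M \<in> ?S" if M: "M \<in> states n" for M
  proof -
    note D = statesD[OF M]
    have "up M \<in> states ?N"
    proof (rule statesI)
      show "up M \<in> carrier_mat (?N + 1) (?N + 1)" by (simp add: up_def)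
      show "\<bar>up M $$ (i, Suc j) - up M $$ (i, j)\<bar> = 1" if "i \<le> ?N" "j < ?N" for i j
        using that D(2)[of i j] D(7)[of i] by (cases "i = ?N"; cases "j = n") (auto simp: up_def)
      show "\<bar>up M $$ (Suc i, j) - up M $$ (i, j)\<bar> = 1" if "i < ?N" "j \<le> ?N" for i j
        using that D(3)[of i j] D(6)[of j] by (cases "i = n"; cases "j = ?N") (auto simp: up_def)
      show "up M $$ (0, k) = int k" if "k \<le> ?N" for k
        using that D(4)[of k] by (auto simp: up_def)
      show "up M $$ (k, 0) = int k" if "k \<le> ?N" for k
        using that D(5)[of k] by (auto simp: up_def)
      show "up M $$ (?N, k) = int ?N - int k" if "k \<le> ?N" for k
        using that by (auto simp: up_def)
      show "up M $$ (k, ?N) = int ?N - int k" if "k \<le> ?N" for k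
        using that by (auto simp: up_def)
    qed
    moreover have "up M $$ (n, n) = 0"
      using D(6)[of n] by (simp add: up_def)
    ultimately show ?thesis by simp
  qed
  have rown: "M $$ (n, k) = int n - int k" if "M \<in> ?S" "k \<le> n" for M k
    using states_row_bound[of M ?N n 0 k] states_row_bound[of M ?N n k n] statesD(5)[of M ?N n] that by auto
  have coln: "M $$ (k, n) = int n - int k" if "M \<in> ?S" "k \<le> n" for M k
    using states_col_bound[of M ?N n 0 k] states_col_bound[of M ?N n k n] statesD(4)[of M ?N n] that by auto
  have down: "down M \<in> states n" if M: "M \<in> ?S" for M
  proof (rule statesI)
    have MN: "M \<in> states ?N" using M by simp
    note D = statesD[OF MN]
    show "down M \<in> carrier_mat (n + 1) (n + 1)" by (simp add: down_def)
    show "\<bar>down M $$ (i, Suc j) - down M $$ (i, j)\<bar> = 1" if "i \<le> n" "j < n" for i j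
      using that D(2)[of i j] by (simp add: down_def)
    show "\<bar>down M $$ (Suc i, j) - down M $$ (i, j)\<bar> = 1" if "i < n" "j \<le> n" for i j
      using that D(3)[of i j] by (simp add: down_def)
    show "down M $$ (0, k) = int k" if "k \<le> n" for k
      using that D(4)[of k] by (simp add: down_def)
    show "down M $$ (k, 0) = int k" if "k \<le> n" for k
      using that D(5)[of k] by (simp add: down_def)
    show "down M $$ (n, k) = int n - int k" if "k \<le> n" for k
      using that rown[OF M, of k] by (simp add: down_def)
    show "down M $$ (k, n) = int n - int k" if "k \<le> n" for k
      using that coln[OF M, of k] by (simp add: down_def)
  qed
  have nz: "1 - L * q ^ k \<noteq> 0" for k using L[of k] by simp
  have weight: "state_weight q ?N X Y L (up M) = X n * q ^ n * (1 - L * q ^ Suc n) / (1 - L * q ^ n) *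
      (\<Prod>j<n. (Y j - X n) / (1 - q)) * (\<Prod>i<n. (Y n - X i) / (1 - q)) * state_weight q n X Y L M"
    if M: "M \<in> states n" for M
  proof -
    note D = statesD[OF M]
    let ?f = "\<lambda>i j. wt q L (X i) (Y j) (up M $$ (i, j)) (up M $$ (i, Suc j)) (up M $$ (Suc i, j)) (up M $$ (Suc i, Suc j))"
    \<comment> \<open>Counting positions backwards from the corner, by k = n - Suc j, turns the
      dynamical variable into L q^(k+1), as the telescoping lemmas expect.\<close>
    have powi: "q powi (int n - int j) = q ^ Suc (n - Suc j)" if "j < n" for j
      using that by (simp add: of_nat_diff Suc_diff_Suc flip: power_int_of_nat)
    have "?f n n = X n * (1 - L * q) / (1 - L)"
      using D(6)[of n] XY by (simp add: up_def wt_def algebra_simps)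
    moreover have "(\<Prod>j<n. ?f n j) = (\<Prod>j<n. (Y j - X n) / (1 - q)) * (q ^ n * (1 - L) / (1 - L *
          q ^ n))"
    proof -
      have "?f n j = (Y j - X n) / (1 - q) * ((q - L * q ^ Suc (n - Suc j)) / (1 - L * q ^ Suc (n - Suc j)))"
        if "j < n" for j
        using that D(6)[of j] D(6)[of "Suc j"] powi[of j] by (simp add: up_def wt_def Let_def)
      then have "(\<Prod>j<n. ?f n j) = (\<Prod>j<n. (Y j - X n) / (1 - q)) *
          (\<Prod>j<n. (q - L * q ^ Suc (n - Suc j)) / (1 - L * q ^ Suc (n - Suc j)))"
        by (simp only: prod.distrib[symmetric]) (auto intro!: prod.cong)
      also have "(\<Prod>j<n. (q - L * q ^ Suc (n - Suc j)) / (1 - L * q ^ Suc (n - Suc j))) =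
          (\<Prod>k<n. (q - L * q ^ Suc k) / (1 - L * q ^ Suc k))"
        by (rule prod.nat_diff_reindex)
      finally show ?thesis using telescope_frozen_row[of n L q] L by simp
    qed
    moreover have "(\<Prod>i<n. ?f i n) = (\<Prod>i<n. (Y n - X i) / (1 - q)) * ((1 - L * q ^ Suc n) / (1 -
          L * q))"
    proof -
      have "?f i n = (Y n - X i) / (1 - q) * ((1 - L * q ^ Suc (Suc (n - Suc i))) / (1 - L * q ^ Suc (n -
            Suc i)))"
        if "i < n" for i
        using that D(7)[of i] D(7)[of "Suc i"] powi[of i] by (simp add: up_def wt_def Let_def mult.left_commute)
      then have "(\<Prod>i<n. ?f i n) = (\<Prod>i<n. (Y n - X i) / (1 - q)) *
          (\<Prod>i<n. (1 - L * q ^ Suc (Suc (n - Suc i))) / (1 - L * q ^ Suc (n - Suc i)))"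
        by (simp only: prod.distrib[symmetric]) (auto intro!: prod.cong)
      also have "(\<Prod>i<n. (1 - L * q ^ Suc (Suc (n - Suc i))) / (1 - L * q ^ Suc (n - Suc i))) =
          (\<Prod>k<n. (1 - L * q ^ Suc (Suc k)) / (1 - L * q ^ Suc k))"
        by (rule prod.nat_diff_reindex)
      finally show ?thesis using telescope_frozen_col[of n L q] L by simp
    qed
    moreover have "(\<Prod>i<n. \<Prod>j<n. ?f i j) = state_weight q n X Y L M"
      unfolding state_weight_def by (intro prod.cong refl) (auto simp: up_def)
    ultimately show ?thesis
      using nz[of 0] nz[of 1] nz[of n] nz[of "Suc n"]
      by (simp only: state_weight_def[of q ?N] prod_square_bottom_right) (simp add: divide_simps)
  qed
  have "Zt q ?N X Y L = (\<Sum>M\<in>?S. state_weight q ?N X Y L M)"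
    unfolding Zt_alt
  proof (intro sum.mono_neutral_right ballI finite_states)
    fix M assume M: "M \<in> states ?N - ?S"
    then have MN: "M \<in> states ?N" by simp
    note D = statesD[OF MN]
    have "M $$ (n, n) = 2"
      using D(3)[of n n] D(6)[of n] M by auto
    then have "wt q L (X n) (Y n) (M $$ (n, n)) (M $$ (n, Suc n)) (M $$ (Suc n, n)) (M $$ (Suc n, Suc n)) = 0"
      using D(6)[of n] D(6)[of ?N] D(7)[of n] XY by (simp add: wt_def)
    then show "state_weight q ?N X Y L M = 0"
      unfolding state_weight_def prod_square_bottom_right by simp
  qed auto
  also have "\<dots> = (\<Sum>M\<in>states n. state_weight q ?N X Y L (up M))"
  proof (rule sum.reindex_bij_witness[of _ up down])
    show *: "up (down M) = M" if M: "M \<in> ?S" for M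
    proof (rule eq_matI)
      have MN: "M \<in> states ?N" using M by simp
      note D = statesD[OF MN]
      show "dim_row (up (down M)) = dim_row M" "dim_col (up (down M)) = dim_col M"
        using D(1) by (auto simp: up_def)
      fix i j assume "i < dim_row M" "j < dim_col M"
      then have ij: "i \<le> ?N" "j \<le> ?N" using D(1) by auto
      show "up (down M) $$ (i, j) = M $$ (i, j)"
        using ij D(6)[of j] D(7)[of i] by (cases "i = ?N"; cases "j = ?N") (auto simp: up_def down_def)
    qed
    show "down (up M) = M" if M: "M \<in> states n" for M
      using statesD(1)[OF M] by (intro eq_matI) (auto simp: up_def down_def)
    show "state_weight q ?N X Y L (up (down M)) = state_weight q ?N X Y L M" if "M \<in> ?S" for M
      using *[OF that] by simp
  qed (use up down in auto)
  also have "\<dots> = (\<Sum>M\<in>states n. X n * q ^ n * (1 - L * q ^ Suc n) / (1 - L * q ^ n) *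
      (\<Prod>j<n. (Y j - X n) / (1 - q)) * (\<Prod>i<n. (Y n - X i) / (1 - q)) * state_weight q n X Y L M)"
    by (intro sum.cong refl weight)
  finally show ?thesis
    by (simp only: Zt_alt sum_distrib_left)
qed

section \<open>Polynomial dependence on the last column variable\<close>

lemma wt_poly: "\<exists>p. degree p \<le> 1 \<and> (\<forall>w. poly p w = wt q L X w a b c d)"
proof -
  have if_affine: "\<exists>u v. \<forall>w. (if P then f w else g w) = u + v * w"
    if "\<exists>u v. \<forall>w. f w = u + v * w" "\<exists>u v. \<forall>w. g w = u + v * w"
    for P and f g :: "complex \<Rightarrow> complex"
    using that by (cases P) auto
  have "\<exists>u v. \<forall>w. (w - x) / d = u + v * w" for x d :: complex
    by (intro exI[of _ "- x / d"] exI[of _ "1 / d"]) (simp add: diff_divide_distrib)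
  moreover have "\<exists>u v. \<forall>w. (w - x) * e / d = u + v * w" for x e d :: complex
    by (intro exI[of _ "- x * e / d"] exI[of _ "e / d"]) (simp add: diff_divide_distrib algebra_simps)
  moreover have "\<exists>u v. \<forall>w. (x - e * w) / d = u + v * w" for x e d :: complex
    by (intro exI[of _ "x / d"] exI[of _ "- e / d"]) (simp add: diff_divide_distrib)
  moreover have "\<exists>u v. \<forall>w. 0 = u + v * (w :: complex)"
    by (intro exI[of _ 0]) simp
  ultimately have "\<exists>u v. \<forall>w. wt q L X w a b c d = u + v * w"
    unfolding wt_def Let_def by (intro if_affine)
  then obtain u v where "\<forall>w. wt q L X w a b c d = u + v * w" by blast
  then show ?thesis
    by (intro exI[of _ "[:u, v:]"]) (simp add: mult.commute)
qed

text \<open>The variable \<open>Y n\<close> enters only the n + 1 blocks of the last column, each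
  affine in it.\<close>

lemma Zt_poly: "\<exists>p. degree p \<le> Suc n \<and> (\<forall>w. poly p w = Zt q (Suc n) X (Y(n := w)) L)"
proof -
  have "\<exists>p. \<forall>M i. degree (p M i) \<le> 1 \<and> (\<forall>w. poly (p M i) w =
      wt q L (X i) w (M $$ (i, n)) (M $$ (i, Suc n)) (M $$ (Suc i, n)) (M $$ (Suc i, Suc n)))"
    by (intro choice allI wt_poly)
  then obtain p where p: "degree (p M i) \<le> 1" "poly (p M i) w =
      wt q L (X i) w (M $$ (i, n)) (M $$ (i, Suc n)) (M $$ (Suc i, n)) (M $$ (Suc i, Suc n))" for M i w
    by blast
  let ?c = "\<lambda>M i. \<Prod>j<n. wt q L (X i) (Y j) (M $$ (i, j)) (M $$ (i, Suc j)) (M $$ (Suc i, j)) (M $$ (Suc i, Suc j))"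
  define P where "P = (\<Sum>M\<in>states (Suc n). \<Prod>i<Suc n. Polynomial.smult (?c M i) (p M i))"
  have "degree P \<le> Suc n"
    unfolding P_def
  proof (intro degree_sum_le finite_states)
    fix M
    have "degree (\<Prod>i<Suc n. Polynomial.smult (?c M i) (p M i)) \<le> (\<Sum>i<Suc n. degree (Polynomial.smult (?c M i) (p M i)))"
      by (rule degree_prod_sum_le[unfolded o_def]) simp
    also have "\<dots> \<le> (\<Sum>i<Suc n. 1)"
      by (intro sum_mono order.trans[OF degree_smult_le] p)
    finally show "degree (\<Prod>i<Suc n. Polynomial.smult (?c M i) (p M i)) \<le> Suc n" by simp
  qed
  moreover have "poly P w = Zt q (Suc n) X (Y(n := w)) L" for w
    unfolding P_def Zt_def poly_sum poly_prod
    by (intro sum.cong prod.cong refl) (auto simp: p intro!: prod.cong)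
  ultimately show ?thesis by blast
qed

section \<open>Interpolation at the cube root of unity\<close>

lemma omega_cube: "omega ^ 3 = 1"
proof -
  have "omega ^ 3 = exp (of_nat 3 * (2 * of_real pi * \<i> / 3))"
    unfolding omega_def by (rule exp_of_nat_mult[symmetric])
  also have "of_nat 3 * (2 * of_real pi * \<i> / 3) = 2 * of_real pi * \<i>" by simp
  finally show ?thesis by (simp only: exp_two_pi_i)
qed

lemma omega_neq_1: "omega \<noteq> 1"
proof
  assume "omega = 1"
  then obtain n :: int where n: "Im (2 * of_real pi * \<i> / 3) = of_int (2 * n) * pi"
    by (auto simp: omega_def exp_eq_1)
  then have "of_int (3 * n) = (1 :: real)" by (simp add: field_simps)
  then have "3 * n = 1" by linarith
  then show False by presburger
qed

lemma omega_quadratic: "omega ^ 2 = - omega - 1"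
proof -
  have "(omega - 1) * (omega ^ 2 + omega + 1) = 0"
    using omega_cube by (simp add: algebra_simps power2_eq_square power3_eq_cube)
  then have "omega ^ 2 + omega + 1 = 0" using omega_neq_1 by simp
  then show ?thesis by Groebner_Basis.algebra
qed

lemma omega_neq_0: "omega \<noteq> 0"
  using omega_cube by auto

lemma omega_square_neq_1: "omega ^ 2 \<noteq> 1"
  using omega_cube omega_neq_1 by (auto simp: power3_eq_cube power2_eq_square)

lemma one_minus_omega_mult: "(1 - omega) * (1 - omega) = - (3 * omega)"
proof -
  have "(1 - omega) * (1 - omega) = 1 - 2 * omega + omega ^ 2"
    by (simp add: power2_eq_square left_diff_distrib right_diff_distrib)
  then show ?thesis by (simp only: omega_quadratic) simp
qed

text \<open>One condition on the cube of L excludes the zeros of all dynamical denominators, because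
  every power of omega has cube 1.\<close>

lemma cube_neq_1_omega:
  assumes "L ^ 3 \<noteq> 1"
  shows "L * omega powi k \<noteq> 1"
proof
  assume "L * omega powi k = 1"
  then have "(L * omega powi k) ^ 3 = 1" by simp
  moreover have "(omega powi k) ^ 3 = (omega ^ 3) powi k"
    using power_int_mult[of omega k 3] power_int_mult[of omega 3 k] by (simp add: mult.commute)
  ultimately show False using assms by (simp add: power_mult_distrib omega_cube)
qed

text \<open>The X are interleaved with the reversed omega Y so that \<open>X 0\<close> and the last
  Y occupy positions 0 and 1. Removing these two rows leaves the spectral variables of the next
  smaller size, and the geometric specialisation comes out in the right order.\<close>

definition spectral :: "nat \<Rightarrow> (nat \<Rightarrow> complex) \<Rightarrow> (nat \<Rightarrow> complex) \<Rightarrow> nat \<Rightarrow> complex" where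
  "spectral n X Y k = (if even k then X (k div 2) else omega * Y (n - 1 - k div 2))"

text \<open>The exponents 0, 1, 3, 4, 6, 7, ... avoid the residue 2 modulo 3, and those of
  \<open>exps1\<close>, namely 0, 2, 3, 5, 6, 8, ..., avoid the residue 1. Both grow by 3 every two
  places, which fits \<open>alternant_split\<close> with s = 2 and e = 3: two variables with equal
  cubes split off.\<close>

definition exps0 :: "nat \<Rightarrow> nat" where "exps0 j = 3 * (j div 2) + j mod 2"

definition exps1 :: "nat \<Rightarrow> nat" where "exps1 j = 3 * (j div 2) + 2 * (j mod 2)"

lemma exps_step: "exps0 (2 + j) = exps0 j + 3" "exps1 (2 + j) = exps1 j + 3"
  by (simp_all add: exps0_def exps1_def)

lemma prod_double: "(\<Prod>k<2 * n. f k) = (\<Prod>i<n. f (2 * i) * f (2 * i + 1))"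
  for f :: "nat \<Rightarrow> complex"
  by (induction n) (simp_all add: mult.assoc)

lemma prod_spectral:
  "(\<Prod>k<2 * n. g (spectral n X Y k)) = (\<Prod>i<n. g (X i)) * (\<Prod>j<n. g (omega * Y j))"
  for g :: "complex \<Rightarrow> complex"
proof -
  have "(\<Prod>k<2 * n. g (spectral n X Y k)) = (\<Prod>i<n. g (X i)) * (\<Prod>i<n. g (omega * Y (n -
        Suc i)))"
    by (simp add: prod_double spectral_def prod.distrib)
  also have "(\<Prod>i<n. g (omega * Y (n - Suc i))) = (\<Prod>i<n. g (omega * Y i))"
    by (rule prod.nat_diff_reindex)
  finally show ?thesis .
qed

lemma vandermonde_pair:
  "alternant (\<lambda>j. j) (2 + M) z = (z 1 - z 0) * (\<Prod>k<M. (z (2 + k) - z 0) * (z (2 + k) - z 1)) *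
     alternant (\<lambda>j. j) M (\<lambda>k. z (2 + k))"
proof -
  have one: "alternant (\<lambda>j. j) (1 + N) y = (\<Prod>i<N. y (1 + i) - y 0) *
        alternant (\<lambda>j. j) N (\<lambda>i. y (1 + i))" for N y
    using alternant_split[of 1 "\<lambda>j. j" 1 y "y 0" N] vandermonde[of 1 y] by simp
  show ?thesis
    using one[of "1 + M" z] one[of M "\<lambda>i. z (1 + i)"]
    by (simp add: prod.lessThan_Suc_shift prod.distrib del: prod.lessThan_Suc)
qed

text \<open>Both sides of the evaluation at \<open>q = omega\<close> are multiplied by the Vandermonde determinant of the
  \<open>spectral n X Y\<close>, so that no denominators occur.\<close>
definition defect :: "nat \<Rightarrow> (nat \<Rightarrow> complex) \<Rightarrow> (nat \<Rightarrow> complex) \<Rightarrow> complex \<Rightarrow> complex" where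
  "defect n X Y L =
    (3 * omega) ^ (n choose 2) * Zt omega n X Y L * ((1 - L * omega ^ (n + 1)) * (1 - L * omega ^ (n + 2))) *
      alternant (\<lambda>j. j) (2 * n) (spectral n X Y) -
    (((\<Prod>i<n. X i) + omega ^ (2 * n) * L ^ 2 * (\<Prod>j<n. Y j)) * alternant exps0 (2 * n) (spectral n X Y) +
      (-1) ^ n * omega ^ (2 * n) * L * alternant exps1 (2 * n) (spectral n X Y))"

lemma states_0: "states 0 = {mat 1 1 (\<lambda>_. 0)}"
proof (intro equalityI subsetI)
  fix M assume "M \<in> states 0"
  then show "M \<in> {mat 1 1 (\<lambda>_. 0)}"
    using statesD(1,4)[of M 0] by (auto intro!: eq_matI)
qed (auto simp: states_def)

lemma defect_0: "defect 0 X Y L = 0"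
proof -
  have "Zt omega 0 X Y L = 1" by (simp add: Zt_def states_0)
  moreover have "alternant l 0 z = 1" for l z by (simp add: alternant_def)
  moreover have "(1 - L * omega) * (1 - L * omega ^ 2) = 1 + L ^ 2 + L"
    using omega_quadratic by Groebner_Basis.algebra
  ultimately show ?thesis
    by (simp add: defect_def binomial_eq_0 power2_eq_square)
qed

lemma spectral_transpose:
  "spectral n (\<lambda>i. X (Transposition.transpose k (Suc k) i)) Y =
    (\<lambda>i. spectral n X Y (Transposition.transpose (2 * k) (2 * Suc k) i))"
  by (auto simp: spectral_def Transposition.transpose_def fun_eq_iff elim!: evenE)

text \<open>All three determinants change sign together, while the other factors are symmetric in
  the X.\<close>

lemma defect_swap:
  assumes "L ^ 3 \<noteq> 1" "Suc k < n" "X k \<noteq> omega * X (Suc k)"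
  shows "defect n (\<lambda>i. X (Transposition.transpose k (Suc k) i)) Y L = - defect n X Y L"
proof -
  have "Zt omega n (\<lambda>i. X (Transposition.transpose k (Suc k) i)) Y L = Zt omega n X Y L"
    using assms omega_neq_0 omega_neq_1 cube_neq_1_omega by (intro Zt_swap)
  moreover have "alternant l (2 * n) (spectral n (\<lambda>i. X (Transposition.transpose k (Suc k) i)) Y) =
      - alternant l (2 * n) (spectral n X Y)" for l
    unfolding spectral_transpose using assms by (intro alternant_swap) auto
  moreover have "(\<Prod>i<n. X (Transposition.transpose k (Suc k) i)) = (\<Prod>i<n. X i)"
    using prod.permute[OF permutes_swap_id[of k "{..<n}" "Suc k"], of X] assms by (simp add: o_def)
  moreover have "a * - b - (c * - d + e * - f) = - (a * b - (c * d + e * f))" for a b c d e f :: complex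
    by simp
  ultimately show ?thesis by (simp only: defect_def)
qed

lemma prod_cubes:
  "(\<Prod>k<M. z k ^ 3 - u ^ 3) = (\<Prod>k<M. (z k - u) * (z k - omega * u)) * (\<Prod>k<M. z k -
        omega ^ 2 * u)"
proof -
  have "(a - u) * (a - omega * u) * (a - omega ^ 2 * u) = a ^ 3 - u ^ 3" for a
  proof -
    have "(a - u) * (a - omega * u) * (a - omega ^ 2 * u) =
        a ^ 3 - (omega ^ 2 + omega + 1) * a ^ 2 * u + (omega ^ 3 + omega ^ 2 + omega) * a * u ^ 2 - omega ^ 3 * u ^ 3"
      by (simp add: power2_eq_square power3_eq_cube algebra_simps)
    then show ?thesis by (simp add: omega_cube omega_quadratic)
  qed
  then show ?thesis unfolding prod.distrib[symmetric] by (simp only:)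
qed

text \<open>The recursion with partition functions, determinants and products replaced by atoms. The
  two alternants acquire different constants, w - 1 and w^2 - 1; the identity \<open>w'\<close>
  shows that the discrepancy is absorbed by the passage from L to L w and by the alternating
  sign.\<close>

lemma frozen_top_right_algebra:
  fixes w :: complex
  assumes w: "w ^ 2 = - w - 1" and Z: "s * ZN = u * G * Zn"
  shows "r * s * ZN * D * ((w - 1) * u * H * V) -
      ((u * P + W * w ^ 2 * L ^ 2 * (Q * u)) * ((w - 1) * u * (H * G) * A0) +
        - e * (W * w ^ 2) * L * ((w ^ 2 - 1) * u ^ 2 * (H * G) * A1)) =
    u ^ 2 * (w - 1) * (H * G) * (r * Zn * D * V - ((P + W * (L * w) ^ 2 * Q) * A0 + e * W * (L * w) * A1))"
proof -
  have "r * s * ZN * D * ((w - 1) * u * H * V) = (s * ZN) * (r * D * ((w - 1) * u * H * V))"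
    by (simp only: mult_ac)
  also have "\<dots> = u ^ 2 * (w - 1) * (H * G) * (r * Zn * D * V)"
    unfolding Z by (simp only: power2_eq_square mult_ac)
  finally have 1: "r * s * ZN * D * ((w - 1) * u * H * V) = u ^ 2 * (w - 1) * (H * G) * (r * Zn * D * V)" .
  have 2: "(u * P + W * w ^ 2 * L ^ 2 * (Q * u)) * ((w - 1) * u * (H * G) * A0) =
      u ^ 2 * (w - 1) * (H * G) * ((P + W * (L * w) ^ 2 * Q) * A0)"
    by (simp add: power2_eq_square algebra_simps)
  have w': "w ^ 2 * (w ^ 2 - 1) = - ((w - 1) * w)"
    using w by Groebner_Basis.algebra
  have "- e * (W * w ^ 2) * L * ((w ^ 2 - 1) * u ^ 2 * (H * G) * A1) =
      w ^ 2 * (w ^ 2 - 1) * (- e * W * L * u ^ 2 * (H * G) * A1)"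
    by (simp only: mult_ac)
  also have "\<dots> = u ^ 2 * (w - 1) * (H * G) * (e * W * (L * w) * A1)"
    unfolding w' by (simp only: mult_ac mult_minus_left mult_minus_right minus_minus)
  finally have 3: "- e * (W * w ^ 2) * L * ((w ^ 2 - 1) * u ^ 2 * (H * G) * A1) =
      u ^ 2 * (w - 1) * (H * G) * (e * W * (L * w) * A1)" .
  show ?thesis unfolding 1 2 3 by (simp only: right_diff_distrib[symmetric] distrib_left[symmetric])
qed

lemma defect_frozen_top_right:
  assumes L: "L ^ 3 \<noteq> 1" and XY: "Y n = X 0"
  shows "defect (Suc n) X Y L = X 0 ^ 2 * (omega - 1) *
    (\<Prod>k<2 * n. spectral n (\<lambda>i. X (Suc i)) Y k ^ 3 - X 0 ^ 3) * defect n (\<lambda>i. X (Suc i)) Y (L * omega)"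
proof -
  define u X' z z' where "u = X 0" and "X' = (\<lambda>i. X (Suc i))" and "z = spectral (Suc n) X Y"
    and "z' = spectral n X' Y"
  have z: "z 0 = u" "z (Suc 0) = omega * u" using XY by (auto simp: z_def spectral_def u_def)
  have z2: "z (Suc (Suc k)) = z' k" for k
    by (simp add: z_def z'_def spectral_def X'_def)
  define F G H where "F = (\<Prod>k<2 * n. z' k ^ 3 - u ^ 3)" and "G = (\<Prod>k<2 * n. z' k - omega ^ 2 * u)"
    and "H = (\<Prod>k<2 * n. (z' k - u) * (z' k - omega * u))"
  have FGH: "F = H * G" unfolding F_def G_def H_def by (rule prod_cubes)
  have c: "z i ^ 3 = u ^ 3" if "i < 2" for i
    using that z omega_cube by (auto simp: less_2_cases_iff power_mult_distrib)
  have split: "alternant l (2 * Suc n) z = alternant l 2 z * F * alternant l (2 * n) z'"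
    if "\<And>j. l (2 + j) = l j + 3" for l
    using alternant_split[of 2 l 3 z "u ^ 3" "2 * n"] that c by (simp add: z2 F_def)
  have alt0: "alternant exps0 (2 * Suc n) z = (omega - 1) * u * F * alternant exps0 (2 * n) z'"
    by (subst split) (auto simp: exps_step alternant_2 z algebra_simps exps0_def)
  have alt1: "alternant exps1 (2 * Suc n) z = (omega ^ 2 - 1) * u ^ 2 * F * alternant exps1 (2 * n) z'"
  proof -
    have "(omega * u) ^ 2 - u ^ 2 = (omega ^ 2 - 1) * u ^ 2"
      by Groebner_Basis.algebra
    then have "alternant exps1 2 z = (omega ^ 2 - 1) * u ^ 2"
      by (simp only: alternant_2 z exps1_def One_nat_def) (simp add: power2_eq_square)
    then show ?thesis by (simp only: split[of exps1, OF exps_step(2)])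
  qed
  have alti: "alternant (\<lambda>j. j) (2 * Suc n) z = (omega - 1) * u * H * alternant (\<lambda>j. j) (2 *
        n) z'"
    using vandermonde_pair[of "2 * n" z] by (simp add: z z2 H_def algebra_simps)
  have G: "G = (\<Prod>i<n. X' i - omega ^ 2 * u) * (omega ^ n * (\<Prod>j<n. Y j - omega * u))"
    unfolding G_def z'_def prod_spectral[where g = "\<lambda>x. x - omega ^ 2 * u"]
    by (simp add: power2_eq_square mult.assoc right_diff_distrib[symmetric] prod.distrib)
  have "L * omega ^ n \<noteq> 1" using cube_neq_1_omega[OF L, of "int n"] by simp
  then have "Zt omega (Suc n) X Y L = u * (\<Prod>j<n. (Y j - omega * u) / (1 - omega)) *
      (\<Prod>i<n. (u - omega * X' i) / (1 - omega)) * Zt omega n X' Y (L * omega)"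
    unfolding u_def X'_def using XY omega_neq_0 omega_neq_1 by (intro Zt_frozen_top_right)
  also have "(\<Prod>i<n. (u - omega * X' i) / (1 - omega)) = (\<Prod>i<n. - omega * (X' i - omega ^ 2 * u) /
        (1 - omega))"
    using omega_cube by (intro prod.cong) (auto simp: algebra_simps power2_eq_square power3_eq_cube)
  also have "\<dots> = (- omega) ^ n * (\<Prod>i<n. X' i - omega ^ 2 * u) / (1 - omega) ^ n"
    by (simp only: prod_dividef prod.distrib prod_constant card_lessThan)
  also have "(\<Prod>j<n. (Y j - omega * u) / (1 - omega)) = (\<Prod>j<n. Y j - omega * u) / (1 - omega) ^ n"
    by (simp add: prod_dividef)
  finally have "(1 - omega) ^ n * (1 - omega) ^ n * Zt omega (Suc n) X Y L = u * (-1) ^ n * G *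
        Zt omega n X' Y (L * omega)"
    using omega_neq_1 by (simp add: G power_minus[of omega])
  \<comment> \<open>One reduction step costs (1 - omega)^(2n) = (-3 omega)^n. Accumulated over all
    sizes this explains the normalisation \<open>(3 * omega) ^ (n choose 2)\<close> in
    \<open>defect\<close>.\<close>
  moreover have "(1 - omega) ^ n * (1 - omega) ^ n = (-1) ^ n * (3 * omega) ^ n"
    by (simp only: power_mult_distrib[symmetric] one_minus_omega_mult mult_minus1)
  ultimately have Z: "(3 * omega) ^ n * Zt omega (Suc n) X Y L = u * G * Zt omega n X' Y (L * omega)"
    by (simp add: mult.assoc)
  have ch: "(3 * omega) ^ (Suc n choose 2) = (3 * omega) ^ (n choose 2) * (3 * omega) ^ n"
    by (simp add: numeral_2_eq_2 power_add)
  have dets: "(1 - L * omega ^ (Suc n + 1)) * (1 - L * omega ^ (Suc n + 2)) =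
      (1 - L * omega * omega ^ (n + 1)) * (1 - L * omega * omega ^ (n + 2))"
    by (simp add: algebra_simps)
  have PQ: "(\<Prod>i<Suc n. X i) = u * (\<Prod>i<n. X' i)" "(\<Prod>j<Suc n. Y j) = (\<Prod>j<n. Y j) * u"
    using XY by (simp_all add: prod.lessThan_Suc_shift[of X n] u_def X'_def del: prod.lessThan_Suc) simp
  have pw: "omega ^ (2 * Suc n) = omega ^ (2 * n) * omega ^ 2" "(-1) ^ Suc n = - ((-1 :: complex) ^ n)"
    by (simp_all add: power_add power2_eq_square)
  show ?thesis
    unfolding defect_def z_def[symmetric] z'_def[symmetric] u_def[symmetric] X'_def[symmetric] F_def[symmetric]
      alt0 alt1 alti ch dets PQ pw FGH
    by (rule frozen_top_right_algebra[OF omega_quadratic Z])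
qed

text \<open>Compared with the other corner, the constants w - 1 and w^2 - 1 have changed places. Now
  the discrepancy is only the sign and a power of w that the prefactor compensates, so L stays
  fixed.\<close>

lemma frozen_bottom_right_algebra:
  fixes w :: complex
  assumes w: "w ^ 2 = - w - 1" and Z: "s * ZN * D1 = u * G * D2 * Zn"
  shows "r * s * ZN * (D3 * D1) * ((w ^ 2 - 1) * u * H * V) -
      ((P * u + W * w ^ 2 * L ^ 2 * (Q * (w * u))) * ((w ^ 2 - 1) * u * (H * G) * A0) +
        - e * (W * w ^ 2) * L * ((w - 1) * u ^ 2 * (H * G) * A1)) =
    u ^ 2 * (w ^ 2 - 1) * (H * G) * (r * Zn * (D2 * D3) * V - ((P + W * L ^ 2 * Q) * A0 + e * W * L * A1))"
proof -
  have "r * s * ZN * (D3 * D1) * ((w ^ 2 - 1) * u * H * V) = (s * ZN * D1) * (r * D3 * ((w ^ 2 - 1) * u * H *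
        V))"
    by (simp only: mult_ac)
  also have "\<dots> = u ^ 2 * (w ^ 2 - 1) * (H * G) * (r * Zn * (D2 * D3) * V)"
    unfolding Z by (simp only: power2_eq_square[of u] mult_ac)
  finally have 1: "r * s * ZN * (D3 * D1) * ((w ^ 2 - 1) * u * H * V) =
      u ^ 2 * (w ^ 2 - 1) * (H * G) * (r * Zn * (D2 * D3) * V)" .
  have w3: "w ^ 2 * w = 1" using w by Groebner_Basis.algebra
  have "P * u + W * w ^ 2 * L ^ 2 * (Q * (w * u)) = u * (P + w ^ 2 * w * (W * L ^ 2 * Q))"
    by (simp only: mult_ac distrib_left)
  then have 2: "(P * u + W * w ^ 2 * L ^ 2 * (Q * (w * u))) * ((w ^ 2 - 1) * u * (H * G) * A0) =
      u ^ 2 * (w ^ 2 - 1) * (H * G) * ((P + W * L ^ 2 * Q) * A0)"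
    unfolding w3 by (simp only: power2_eq_square[of u] mult_ac mult_1_left)
  have w': "w ^ 2 * (w - 1) = - (w ^ 2 - 1)"
    using w by Groebner_Basis.algebra
  have "- e * (W * w ^ 2) * L * ((w - 1) * u ^ 2 * (H * G) * A1) =
      w ^ 2 * (w - 1) * (- e * W * L * u ^ 2 * (H * G) * A1)"
    by (simp only: mult_ac)
  also have "\<dots> = u ^ 2 * (w ^ 2 - 1) * (H * G) * (e * W * L * A1)"
    unfolding w' by (simp only: mult_ac mult_minus_left mult_minus_right minus_minus)
  finally have 3: "- e * (W * w ^ 2) * L * ((w - 1) * u ^ 2 * (H * G) * A1) =
      u ^ 2 * (w ^ 2 - 1) * (H * G) * (e * W * L * A1)" .
  show ?thesis unfolding 1 2 3 by (simp only: right_diff_distrib[symmetric] distrib_left[symmetric])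
qed

text \<open>A cyclic permutation of the even positions. Since its sign s is the same for every
  exponent sequence, it factors out of \<open>defect\<close> and its value does not matter.\<close>

lemma alternant_rotate:
  assumes X: "X' 0 = X n" "\<And>i. i < n \<Longrightarrow> X' (Suc i) = X i"
  shows "\<exists>s. s \<noteq> 0 \<and> (\<forall>l. alternant l (2 * Suc n) (spectral (Suc n) X Y) = s *
        alternant l (2 * Suc n) (spectral (Suc n) X' Y))"
proof -
  define \<pi> where "\<pi> k = (if odd k \<or> k \<ge> 2 * Suc n then k else if k = 2 * n then 0 else k +
        2)" for k
  define \<sigma> where "\<sigma> k = (if odd k \<or> k \<ge> 2 * Suc n then k else if k = 0 then 2 *
        n else k - 2)" for k
  have "bij_betw \<pi> {0..<2 * Suc n} {0..<2 * Suc n}"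
    by (rule bij_betw_byWitness[where f' = \<sigma>]) (auto simp: \<pi>_def \<sigma>_def odd_pos elim!: evenE)
  then have p: "\<pi> permutes {0..<2 * Suc n}"
    by (rule bij_imp_permutes) (auto simp: \<pi>_def)
  have "alternant l (2 * Suc n) (spectral (Suc n) X Y) = signof \<pi> * alternant l (2 *
        Suc n) (spectral (Suc n) X' Y)" for l
    unfolding alternant_permute[OF p, symmetric]
    by (intro alternant_cong) (auto simp: spectral_def \<pi>_def X elim!: evenE)
  moreover have "signof \<pi> \<noteq> (0 :: complex)" by (simp add: sign_def)
  ultimately show ?thesis by blast
qed

text \<open>The coupled variables \<open>X n\<close> and \<open>Y n\<close> are not neighbours in
  \<open>spectral\<close>, so \<open>X n\<close> is first rotated to the front. The leading pair is
  then u, omega^2 u, whose cubes agree, and the determinants split as before.\<close>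

lemma defect_frozen_bottom_right:
  assumes L: "L ^ 3 \<noteq> 1" and XY: "Y n = omega * X n" and d: "defect n X Y L = 0"
  shows "defect (Suc n) X Y L = 0"
proof -
  define X' where "X' i = (case i of 0 \<Rightarrow> X n | Suc i \<Rightarrow> X i)" for i
  define u z z' where "u = X n" and "z = spectral (Suc n) X' Y" and "z' = spectral n X Y"
  obtain s where s: "alternant l (2 * Suc n) (spectral (Suc n) X Y) = s * alternant l (2 * Suc n) z" for l
    using alternant_rotate[of X' X n Y] by (auto simp: X'_def z_def)
  have z: "z 0 = u" "z (Suc 0) = omega ^ 2 * u"
    using XY by (auto simp: z_def spectral_def u_def X'_def power2_eq_square)
  have z2: "z (Suc (Suc k)) = z' k" for k
    by (simp add: z_def z'_def spectral_def X'_def)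
  define F G H where "F = (\<Prod>k<2 * n. z' k ^ 3 - u ^ 3)" and "G = (\<Prod>k<2 * n. z' k - omega * u)"
    and "H = (\<Prod>k<2 * n. (z' k - u) * (z' k - omega ^ 2 * u))"
  have FGH: "F = H * G" unfolding F_def G_def H_def prod_cubes by (simp add: prod.distrib)
  have c: "z i ^ 3 = u ^ 3" if "i < 2" for i
    using that z power_mult[of omega 3 2]
    by (auto simp: less_2_cases_iff power_mult_distrib omega_cube simp flip: power_mult)
  have split: "alternant l (2 * Suc n) z = alternant l 2 z * F * alternant l (2 * n) z'"
    if "\<And>j. l (2 + j) = l j + 3" for l
    using alternant_split[of 2 l 3 z "u ^ 3" "2 * n"] that c by (simp add: z2 F_def)
  have alt0: "alternant exps0 (2 * Suc n) z = (omega ^ 2 - 1) * u * F * alternant exps0 (2 * n) z'"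
    by (subst split) (auto simp: exps_step alternant_2 z algebra_simps exps0_def)
  have alt1: "alternant exps1 (2 * Suc n) z = (omega - 1) * u ^ 2 * F * alternant exps1 (2 * n) z'"
  proof -
    have "(omega ^ 2 * u) ^ 2 - u ^ 2 = (omega - 1) * u ^ 2"
      using omega_quadratic by Groebner_Basis.algebra
    then have "alternant exps1 2 z = (omega - 1) * u ^ 2"
      by (simp only: alternant_2 z exps1_def One_nat_def) (simp add: power2_eq_square)
    then show ?thesis by (simp only: split[of exps1, OF exps_step(2)])
  qed
  have alti: "alternant (\<lambda>j. j) (2 * Suc n) z = (omega ^ 2 - 1) * u * H *
        alternant (\<lambda>j. j) (2 * n) z'"
    using vandermonde_pair[of "2 * n" z] by (simp add: z z2 H_def algebra_simps)
  have G: "G = (\<Prod>i<n. X i - omega * u) * (omega ^ n * (\<Prod>j<n. Y j - u))"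
    unfolding G_def z'_def prod_spectral[where g = "\<lambda>x. x - omega * u"]
    by (simp add: right_diff_distrib[symmetric] prod.distrib)
  have nz: "1 - L * omega ^ k \<noteq> 0" for k using cube_neq_1_omega[OF L, of "int k"] by simp
  have "Zt omega (Suc n) X Y L = u * omega ^ n * (1 - L * omega ^ Suc n) / (1 - L * omega ^ n) *
      (\<Prod>j<n. (Y j - u) / (1 - omega)) * (\<Prod>i<n. (Y n - X i) / (1 - omega)) * Zt omega n X Y L"
    unfolding u_def using XY omega_neq_0 omega_neq_1 nz by (intro Zt_frozen_bottom_right) auto
  also have "(\<Prod>i<n. (Y n - X i) / (1 - omega)) = (\<Prod>i<n. (-1) * (X i - omega * u) / (1 - omega))"
    using XY by (intro prod.cong) (auto simp: u_def)
  also have "\<dots> = (- 1) ^ n * (\<Prod>i<n. X i - omega * u) / (1 - omega) ^ n"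
    by (simp only: prod_dividef prod.distrib prod_constant card_lessThan)
  also have "(\<Prod>j<n. (Y j - u) / (1 - omega)) = (\<Prod>j<n. Y j - u) / (1 - omega) ^ n"
    by (simp add: prod_dividef)
  finally have "(1 - omega) ^ n * (1 - omega) ^ n * Zt omega (Suc n) X Y L * (1 - L * omega ^ n) =
      (-1) ^ n * (u * G * (1 - L * omega ^ Suc n) * Zt omega n X Y L)"
    using omega_neq_1 nz[of n] by (simp add: G)
  moreover have "(1 - omega) ^ n * (1 - omega) ^ n = (-1) ^ n * (3 * omega) ^ n"
    by (simp only: power_mult_distrib[symmetric] one_minus_omega_mult mult_minus1)
  ultimately have Z: "(3 * omega) ^ n * Zt omega (Suc n) X Y L * (1 - L * omega ^ n) =
      u * G * (1 - L * omega ^ Suc n) * Zt omega n X Y L"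
    by (simp add: mult.assoc)
  have ch: "(3 * omega) ^ (Suc n choose 2) = (3 * omega) ^ (n choose 2) * (3 * omega) ^ n"
    by (simp add: numeral_2_eq_2 power_add)
  have "omega ^ (Suc n + 2) = omega ^ n" using omega_cube by (simp add: power_add[of omega n 3, simplified] numeral_3_eq_3)
  then have dets: "(1 - L * omega ^ (Suc n + 1)) * (1 - L * omega ^ (Suc n + 2)) =
      (1 - L * omega ^ (n + 2)) * (1 - L * omega ^ n)"
    by simp
  have PQ: "(\<Prod>i<Suc n. X i) = (\<Prod>i<n. X i) * u" "(\<Prod>j<Suc n. Y j) = (\<Prod>j<n. Y j) *
        (omega * u)"
    using XY by (simp_all add: u_def)
  have pw: "omega ^ (2 * Suc n) = omega ^ (2 * n) * omega ^ 2" "(-1) ^ Suc n = - ((-1 :: complex) ^ n)"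
    by (simp_all add: power_add power2_eq_square)
  have factor: "a * (s * b) - (c * (s * d) + e * (s * f)) = s * (a * b - (c * d + e * f))" for a b c d e f
    by (simp add: algebra_simps)
  let ?A = "\<lambda>l. alternant l (2 * Suc n) z"
  have "defect (Suc n) X Y L = s * ((3 * omega) ^ (Suc n choose 2) * Zt omega (Suc n) X Y L *
      ((1 - L * omega ^ (Suc n + 1)) * (1 - L * omega ^ (Suc n + 2))) * ?A (\<lambda>j. j) -
    (((\<Prod>i<Suc n. X i) + omega ^ (2 * Suc n) * L ^ 2 * (\<Prod>j<Suc n. Y j)) * ?A exps0 +
      (-1) ^ Suc n * omega ^ (2 * Suc n) * L * ?A exps1))"
    unfolding defect_def s by (rule factor)
  also have "\<dots> = s * (u ^ 2 * (omega ^ 2 - 1) * (H * G) * defect n X Y L)"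
    unfolding defect_def z'_def[symmetric] alt0 alt1 alti ch dets PQ pw FGH Suc_eq_plus1[of n, symmetric]
    by (rule arg_cong[where f = "(*) s"], rule frozen_bottom_right_algebra[OF omega_quadratic Z])
  finally show ?thesis using d by simp
qed

text \<open>Cubes are compared because the interpolation nodes are the X and Y up to cube roots of
  unity. The number m of controlled Y is separate so that the last one can serve as the
  interpolation variable.\<close>

definition generic :: "nat \<Rightarrow> nat \<Rightarrow> (nat \<Rightarrow> complex) \<Rightarrow> (nat \<Rightarrow> complex) \<Rightarrow> bool" where
  "generic n m X Y \<longleftrightarrow> (\<forall>i<n. X i \<noteq> 0) \<and> inj_on (\<lambda>i. X i ^ 3) {..<n} \<and> inj_on (\<lambda>j. Y j ^ 3) {..<m} \<and>
     (\<forall>i<n. \<forall>j<m. X i ^ 3 \<noteq> Y j ^ 3)"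

text \<open>Adjacent exchanges, each changing only the sign of \<open>defect\<close>, carry
  \<open>X i\<close> to position 0. The hypothesis covers all X and L because the recursion drops an
  X and multiplies L by omega.\<close>

lemma defect_zero_top_right:
  assumes L: "L ^ 3 \<noteq> 1" and IH: "\<And>X L. L ^ 3 \<noteq> 1 \<Longrightarrow> generic n n X Y \<Longrightarrow>
        defect n X Y L = 0"
  shows "i < Suc n \<Longrightarrow> generic (Suc n) n X Y \<Longrightarrow> Y n = X i \<Longrightarrow>
        defect (Suc n) X Y L = 0"
proof (induction i arbitrary: X)
  case 0
  have "generic n n (\<lambda>i. X (Suc i)) Y"
    unfolding generic_def
  proof (intro conjI inj_onI)
    show "i = j" if "i \<in> {..<n}" "j \<in> {..<n}" "X (Suc i) ^ 3 = X (Suc j) ^ 3" for i j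
      using inj_onD[of "\<lambda>i. X i ^ 3" "{..<Suc n}" "Suc i" "Suc j"] 0(2) that by (simp add: generic_def)
  qed (use 0(2) in \<open>auto simp: generic_def dest: inj_onD\<close>)
  moreover have "(L * omega) ^ 3 \<noteq> 1" using L by (simp add: power_mult_distrib omega_cube)
  ultimately have "defect n (\<lambda>i. X (Suc i)) Y (L * omega) = 0" by (intro IH)
  then show ?case using defect_frozen_top_right[OF L, of Y n X] 0 by simp
next
  case (Suc i)
  let ?t = "Transposition.transpose i (Suc i)"
  have t: "?t j < Suc n" if "j < Suc n" for j
    using that Suc.prems by (auto simp: Transposition.transpose_def)
  have "generic (Suc n) n (\<lambda>j. X (?t j)) Y"
    unfolding generic_def
  proof (intro conjI inj_onI)
    show "j = k" if "j \<in> {..<Suc n}" "k \<in> {..<Suc n}" "X (?t j) ^ 3 = X (?t k) ^ 3" for j k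
    proof -
      have "?t j = ?t k"
        using inj_onD[of "\<lambda>i. X i ^ 3" "{..<Suc n}" "?t j" "?t k"] Suc.prems(2) t that by (simp add: generic_def)
      then show ?thesis by (metis transpose_involutory)
    qed
  qed (use Suc.prems(2) t in \<open>auto simp: generic_def dest: inj_onD\<close>)
  then have "defect (Suc n) (\<lambda>j. X (?t j)) Y L = 0"
    using Suc.prems by (intro Suc.IH) auto
  moreover have "X i \<noteq> omega * X (Suc i)"
  proof
    assume "X i = omega * X (Suc i)"
    then have "X i ^ 3 = X (Suc i) ^ 3" by (simp add: power_mult_distrib omega_cube)
    then show False
      using inj_onD[of "\<lambda>i. X i ^ 3" "{..<Suc n}" i "Suc i"] Suc.prems by (simp add: generic_def)
  qed
  ultimately show ?case using defect_swap[OF L, of i "Suc n" X Y] Suc.prems by simp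
qed

text \<open>The last Y sits at position 1 of \<open>spectral\<close> only. The three terms have
  degree at most (n + 1) + (2n + 1), 1 + (3n + 1) and 3n + 2.\<close>

lemma defect_poly:
  "\<exists>p. degree p \<le> 3 * n + 2 \<and> (\<forall>w. poly p w = defect (Suc n) X (Y(n := w)) L)"
proof -
  have le: "exps0 j \<le> 3 * n + 1" "exps1 j \<le> 3 * n + 2" "j \<le> 2 * n + 1" if "j < 2 * Suc n" for j
  proof -
    have "j div 2 < Suc n" using that by (intro less_mult_imp_div_less) simp
    moreover have "j mod 2 < 2" by simp
    ultimately show "exps0 j \<le> 3 * n + 1" "exps1 j \<le> 3 * n + 2"
      by (simp_all add: exps0_def exps1_def)
    show "j \<le> 2 * n + 1" using that by simp
  qed
  let ?z = "spectral (Suc n) X Y"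
  have sp: "spectral (Suc n) X (Y(n := w)) k = (?z(1 := omega * w)) k" if "k < 2 * Suc n" for w k
    using that by (auto simp: spectral_def elim!: oddE)
  have alt: "alternant l (2 * Suc n) (spectral (Suc n) X (Y(n := w))) = alternant l (2 *
        Suc n) (?z(1 := omega * w))" for l w
    by (intro alternant_cong sp)
  have "\<exists>p. degree p \<le> d \<and> (\<forall>w. poly p w = alternant l (2 * Suc n) (?z(1 := omega *
        w)))"
    if "\<And>j. j < 2 * Suc n \<Longrightarrow> l j \<le> d" for l d
  proof -
    have "1 < 2 * Suc n" by simp
    from alternant_poly[where N = "2 * Suc n" and k = 1 and l = l and d = d and z = ?z, OF this that]
    obtain p where p: "degree p \<le> d" "\<And>w. poly p w = alternant l (2 * Suc n) (?z(1 := w))"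
      by blast
    have "degree (pcompose p [:0, omega:]) \<le> d"
      using p(1) by (simp add: degree_pcompose omega_neq_0)
    then show ?thesis
      by (intro exI[of _ "pcompose p [:0, omega:]"]) (simp add: p(2) poly_pcompose mult.commute)
  qed note alt_poly = this
  obtain pi where pi: "degree pi \<le> 2 * n + 1" "poly pi w = alternant (\<lambda>j. j) (2 *
        Suc n) (?z(1 := omega * w))" for w
    using alt_poly[of "\<lambda>j. j", OF le(3)] by blast
  obtain p0 where p0: "degree p0 \<le> 3 * n + 1" "poly p0 w = alternant exps0 (2 * Suc n) (?z(1 := omega *
        w))" for w
    using alt_poly[of exps0, OF le(1)] by blast
  obtain p1 where p1: "degree p1 \<le> 3 * n + 2" "poly p1 w = alternant exps1 (2 * Suc n) (?z(1 := omega *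
        w))" for w
    using alt_poly[of exps1, OF le(2)] by blast
  obtain pZ where pZ: "degree pZ \<le> Suc n" "poly pZ w = Zt omega (Suc n) X (Y(n := w)) L" for w
    using Zt_poly[of n omega X Y L] by auto
  define P where "P = Polynomial.smult ((3 * omega) ^ (Suc n choose 2) *
      ((1 - L * omega ^ (Suc n + 1)) * (1 - L * omega ^ (Suc n + 2)))) (pZ * pi) -
    ([:\<Prod>i<Suc n. X i, omega ^ (2 * Suc n) * L ^ 2 * (\<Prod>j<n. Y j):] * p0 +
      Polynomial.smult ((-1) ^ Suc n * omega ^ (2 * Suc n) * L) p1)"
  have "degree (pZ * pi) \<le> 3 * n + 2"
    using degree_mult_le[of pZ pi] pi(1) pZ(1) by linarith
  moreover have "degree ([:\<Prod>i<Suc n. X i, omega ^ (2 * Suc n) * L ^ 2 * (\<Prod>j<n. Y j):] *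
        p0) \<le> 3 * n + 2"
    (is "degree (?a * p0) \<le> _")
    using degree_mult_le[of ?a p0] degree_pCons_le[of "\<Prod>i<Suc n. X i" "[:omega ^ (2 * Suc n) * L ^ 2 *
          (\<Prod>j<n. Y j):]"] p0(1)
    by simp
  ultimately have "degree P \<le> 3 * n + 2"
    unfolding P_def using p1(1)
    by (intro degree_diff_le degree_add_le order.trans[OF degree_smult_le])
  moreover have "poly P w = defect (Suc n) X (Y(n := w)) L" for w
  proof -
    have Q: "(\<Prod>j<Suc n. (Y(n := w)) j) = (\<Prod>j<n. Y j) * w" by simp
    have lin: "poly [:a, b * c:] w = a + b * (c * w)" for a b c :: complex by simp
    show ?thesis
      unfolding defect_def alt Q P_def poly_diff poly_add poly_mult poly_smult lin pi(2) p0(2) p1(2) pZ(2)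
      by (simp only: mult_ac)
  qed
  ultimately show ?thesis by blast
qed

theorem defect_eq_0:
  assumes "L ^ 3 \<noteq> 1" "generic n n X Y"
  shows "defect n X Y L = 0"
  using assms
proof (induction n arbitrary: X Y L)
  case 0
  show ?case by (rule defect_0)
next
  case (Suc n)
  note L = Suc.prems(1) and g = Suc.prems(2)
  have gn: "generic (Suc n) n X Y" "generic n n X Y"
    using g by (auto simp: generic_def inj_on_def)
  define R where "R = (\<lambda>i. X i / omega) ` {..n} \<union> Y ` {..<n} \<union> X ` {..n} \<union> {omega * X n}"
  obtain p where p: "degree p \<le> 3 * n + 2" "poly p w = defect (Suc n) X (Y(n := w)) L" for w
    using defect_poly[of n X Y L] by auto
  have "poly p w = 0" if w: "w \<in> R" for w
  proof -
    define Y' where "Y' = Y(n := w)"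
    have gw: "generic (Suc n) n X Y'" "generic n n X Y'" and Y'n: "Y' n = w"
      using gn by (auto simp: generic_def inj_on_def Y'_def)
    consider k where "k < 2 * Suc n" "k \<noteq> 1" "omega * w = spectral (Suc n) X Y' k"
      | i where "i < Suc n" "w = X i" | "w = omega * X n"
    proof -
      consider i where "i \<le> n" "w = X i / omega" | j where "j < n" "w = Y j"
        | i where "i \<le> n" "w = X i" | "w = omega * X n"
        using w unfolding R_def by blast
      then show ?thesis
      proof cases
        case (1 i)
        then show ?thesis using that(1)[of "2 * i"] omega_neq_0 by (simp add: spectral_def Y'_def)
      next
        case (2 j)
        then show ?thesis using that(1)[of "2 * (n - j) + 1"] by (simp add: spectral_def Y'_def)
      next
        case (3 i)
        then show ?thesis using that(2)[of i] by simp
      next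
        case 4
        then show ?thesis by (rule that(3))
      qed
    qed
    then have "defect (Suc n) X Y' L = 0"
    proof cases
      case (1 k)
      then have "alternant l (2 * Suc n) (spectral (Suc n) X Y') = 0" for l
        by (intro alternant_eq_0[of 1 _ k]) (auto simp: spectral_def Y'n)
      then show ?thesis by (simp add: defect_def)
    next
      case (2 i)
      have "defect n X' Y' L' = 0" if "L' ^ 3 \<noteq> 1" "generic n n X' Y'" for X' L'
        using that by (rule Suc.IH)
      from defect_zero_top_right[OF L this 2(1) gw(1)] show ?thesis using 2 Y'n by simp
    next
      case 3
      then show ?thesis
        using L gw(2) Y'n by (intro defect_frozen_bottom_right Suc.IH) simp_all
    qed
    then show ?thesis by (simp add: p Y'_def)
  qed
  then have R: "R \<subseteq> {w. poly p w = 0}" by auto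
  \<comment> \<open>Two coinciding nodes would have equal cubes. By genericity they then come from
    one and the same nonzero X, and a nontrivial cube root of unity would have to be 1.\<close>
  have X3: "X i = X j * c \<Longrightarrow> c ^ 3 = 1 \<Longrightarrow> i \<le> n \<Longrightarrow>
        j \<le> n \<Longrightarrow> i = j" for i j c
    using g by (auto simp: generic_def inj_on_def power_mult_distrib)
  have XY3: "X i \<noteq> Y j * c" if "c ^ 3 = 1" "i \<le> n" "j < n" for i j c
  proof
    assume "X i = Y j * c"
    then have "X i ^ 3 = Y j ^ 3" using that by (simp add: power_mult_distrib)
    then show False using g that by (auto simp: generic_def)
  qed
  have X0: "X i \<noteq> 0" if "i \<le> n" for i using g that by (auto simp: generic_def)
  have cubes: "(omega ^ 2) ^ 3 = 1"
    using omega_cube by (metis power_mult mult.commute power_one)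
  have div: "a / omega = b \<longleftrightarrow> a = b * omega" "b = a / omega \<longleftrightarrow> a = b *
        omega" for a b
    using omega_neq_0 by (auto simp: nonzero_divide_eq_eq)
  have injX: "inj_on X {..n}"
  proof (rule inj_onI)
    show "i = j" if "i \<in> {..n}" "j \<in> {..n}" "X i = X j" for i j
      by (rule X3[of i j 1]) (use that in simp_all)
  qed
  then have "inj_on (\<lambda>i. X i / omega) {..n}"
    using omega_neq_0 unfolding inj_on_def by simp
  moreover have "inj_on Y {..<n}"
  proof (rule inj_onI)
    show "i = j" if "i \<in> {..<n}" "j \<in> {..<n}" "Y i = Y j" for i j
      using inj_onD[of "\<lambda>j. Y j ^ 3" "{..<Suc n}" i j] g that by (simp add: generic_def)
  qed
  ultimately have cards[simp]: "card ((\<lambda>i. X i / omega) ` {..n}) = Suc n" "card (Y ` {..<n}) =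
        n" "card (X ` {..n}) = Suc n"
    using card_image[OF injX] by (simp_all add: card_image)
  have neqs: "X i / omega \<noteq> X j" "X i / omega \<noteq> omega * X j" "omega *
        X j \<noteq> X i" if "i \<le> n" "j \<le> n" for i j
  proof -
    show "X i / omega \<noteq> X j"
    proof
      assume "X i / omega = X j"
      then have eq: "X i = X j * omega" unfolding div .
      then have "i = j" by (rule X3[OF _ omega_cube that])
      then show False using eq X0[OF that(2)] omega_neq_1 by simp
    qed
    show "omega * X j \<noteq> X i"
    proof
      assume "omega * X j = X i"
      then have eq: "X i = X j * omega" by (simp only: mult.commute)
      then have "i = j" by (rule X3[OF _ omega_cube that])
      then show False using eq X0[OF that(2)] omega_neq_1 by simp
    qed
    show "X i / omega \<noteq> omega * X j"
    proof
      assume "X i / omega = omega * X j"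
      then have eq: "X i = X j * omega ^ 2" unfolding div by (simp only: power2_eq_square mult_ac)
      then have "i = j" by (rule X3[OF _ cubes that])
      then show False using eq X0[OF that(2)] omega_square_neq_1 by simp
    qed
  qed
  have neqY: "X i / omega \<noteq> Y j" "X i \<noteq> Y j" "omega *
        X i \<noteq> Y j" if "i \<le> n" "j < n" for i j
  proof -
    show "X i / omega \<noteq> Y j" using XY3[OF omega_cube that] unfolding div .
    show "X i \<noteq> Y j" using XY3[OF _ that, of 1] by simp
    show "omega * X i \<noteq> Y j"
    proof
      assume "omega * X i = Y j"
      then have "Y j * omega ^ 2 = omega ^ 3 * X i" by (simp only: power2_eq_square power3_eq_cube mult_ac)
      then show False using XY3[OF cubes that] omega_cube by simp
    qed
  qed
  have d1: "(\<lambda>i. X i / omega) ` {..n} \<inter> Y ` {..<n} = {}"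
    by (rule equals0I) (elim IntE imageE, use neqY(1) in simp)
  have d2: "((\<lambda>i. X i / omega) ` {..n} \<union> Y ` {..<n}) \<inter> X ` {..n} = {}"
  proof -
    have "(\<lambda>i. X i / omega) ` {..n} \<inter> X ` {..n} = {}"
      by (rule equals0I) (elim IntE imageE, use neqs(1) in simp)
    moreover have "Y ` {..<n} \<inter> X ` {..n} = {}"
      by (rule equals0I) (elim IntE imageE, use neqY(2) in simp)
    ultimately show ?thesis by (simp only: Int_Un_distrib2 Un_empty_left)
  qed
  have d3: "omega * X n \<notin> (\<lambda>i. X i / omega) ` {..n} \<union> Y ` {..<n} \<union> X ` {..n}"
  proof
    assume "omega * X n \<in> (\<lambda>i. X i / omega) ` {..n} \<union> Y ` {..<n} \<union> X ` {..n}"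
    then consider i where "i \<le> n" "omega * X n = X i / omega" | j where "j < n" "omega * X n = Y j"
      | i where "i \<le> n" "omega * X n = X i"
      by (elim UnE imageE) simp_all
    then show False
    proof cases
      case (1 i)
      then show False using neqs(2)[of i n] by simp
    next
      case (2 j)
      then show False using neqY(3)[of n j] by simp
    next
      case (3 i)
      then show False using neqs(3)[of i n] by simp
    qed
  qed
  have "card (insert v (A \<union> B \<union> C)) = Suc (card A + card B + card C)"
    if "finite A" "finite B" "finite C" "A \<inter> B = {}" "(A \<union> B) \<inter> C =
          {}" "v \<notin> A \<union> B \<union> C" for v :: complex and A B C
    using that by (simp only: card_insert_disjoint finite_Un simp_thms card_Un_disjoint)
  from this[OF _ _ _ d1 d2 d3] have "card R = 3 * n + 3"
    by (simp add: R_def)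
  have "p = 0"
  proof (rule ccontr)
    assume "p \<noteq> 0"
    then have "card R \<le> degree p"
      by (intro order.trans[OF card_mono[OF poly_roots_finite R] card_poly_roots_bound])
    then show False using \<open>card R = 3 * n + 3\<close> p(1) by linarith
  qed
  then show ?case using p(2)[of "Y n"] by simp
qed

section \<open>The homogeneous limit\<close>

text \<open>What remains of the alternant on a geometric progression at t = 1 after the power of t -
  1 is removed. Divided by the value for the exponents 0, 1, 2, ..., it is Weyl's dimension formula
  for the Schur polynomial.\<close>

definition gaps :: "(nat \<Rightarrow> nat) \<Rightarrow> nat \<Rightarrow> complex" where
  "gaps l N = (\<Prod>j<N. \<Prod>i<j. of_nat (l j) - of_nat (l i))"

lemma gaps_double_Suc:
  "gaps l (2 * Suc n) = gaps l (2 * n) *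
     (\<Prod>m<n. (of_nat (l (2 * n)) - of_nat (l (2 * m))) * (of_nat (l (2 * n)) - of_nat (l (2 * m + 1)))) *
     ((\<Prod>m<n. (of_nat (l (2 * n + 1)) - of_nat (l (2 * m))) * (of_nat (l (2 * n + 1)) - of_nat (l (2 * m + 1)))) *
      (of_nat (l (2 * n + 1)) - of_nat (l (2 * n))))"
proof -
  have "gaps l (2 * Suc n) = gaps l (2 * n) * (\<Prod>i<2 * n. of_nat (l (2 * n)) - of_nat (l i)) *
      ((\<Prod>i<2 * n. of_nat (l (2 * n + 1)) - of_nat (l i)) * (of_nat (l (2 * n + 1)) - of_nat (l (2 * n))))"
    by (simp add: gaps_def)
  then show ?thesis by (simp only: prod_double)
qed

lemma prod_reverse_diff:
  fixes f :: "complex \<Rightarrow> complex"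
  shows "(\<Prod>m<n. f (of_nat n - of_nat m)) = (\<Prod>k<n. f (of_nat k + 1))"
proof -
  have "(\<Prod>m<n. f (of_nat n - of_nat m)) = (\<Prod>m<n. f (of_nat (n - Suc m) + 1))"
    by (intro prod.cong) (auto simp: of_nat_diff algebra_simps)
  also have "\<dots> = (\<Prod>k<n. f (of_nat k + 1))"
    by (rule prod.nat_diff_reindex[where g = "\<lambda>k. f (of_nat k + 1)"])
  finally show ?thesis .
qed

lemma gaps_id_Suc: "gaps (\<lambda>j. j) (Suc N) = gaps (\<lambda>j. j) N * fact N"
proof -
  have "(\<Prod>i<N. of_nat N - of_nat i) = (fact N :: complex)"
    using prod_reverse_diff[of "\<lambda>x. x" N]
    by (simp add: fact_prod_Suc lessThan_atLeast0 add.commute)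
  then show ?thesis by (simp add: gaps_def)
qed

text \<open>The differences from 3n and 3n + 1 to the earlier exponents are 3k, 3k - 1, 3k + 1, 3k
  for k = 1, ..., n. Three of them fill (3n+1)!, and the second 3k gives 3^n n!.\<close>

lemma gaps_exps0_Suc:
  "gaps exps0 (2 * Suc n) = gaps exps0 (2 * n) * (3 ^ n * fact n * fact (3 * n + 1))"
proof -
  have e: "exps0 (2 * m) = 3 * m" "exps0 (2 * m + 1) = 3 * m + 1" for m
    by (simp_all add: exps0_def)
  have 1: "(\<Prod>m<n. (of_nat (exps0 (2 * n)) - of_nat (exps0 (2 * m))) * (of_nat (exps0 (2 * n)) -
        of_nat (exps0 (2 * m + 1)))) =
      (\<Prod>k<n. 3 * (of_nat k + 1) * (3 * (of_nat k + 1) - 1 :: complex))"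
    unfolding e prod_reverse_diff[of "\<lambda>x. 3 * x * (3 * x - 1)" n, symmetric]
    by (intro prod.cong) (auto simp: algebra_simps)
  have 2: "(\<Prod>m<n. (of_nat (exps0 (2 * n + 1)) - of_nat (exps0 (2 * m))) * (of_nat (exps0 (2 * n + 1)) -
        of_nat (exps0 (2 * m + 1)))) =
      (\<Prod>k<n. (3 * (of_nat k + 1) + 1) * (3 * (of_nat k + 1) :: complex))"
    unfolding e prod_reverse_diff[of "\<lambda>x. (3 * x + 1) * (3 * x)" n, symmetric]
    by (intro prod.cong) (auto simp: algebra_simps)
  have 3: "of_nat (exps0 (2 * n + 1)) - of_nat (exps0 (2 * n)) = (1 :: complex)"
    unfolding e by simp
  have "(\<Prod>k<n. 3 * (of_nat k + 1) * (3 * (of_nat k + 1) - 1)) * (\<Prod>k<n. (3 * (of_nat k + 1) + 1) *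
        (3 * (of_nat k + 1))) =
      (3 ^ n * fact n * fact (3 * n + 1) :: complex)"
  proof (induction n)
    case (Suc n)
    have shift: "3 * (of_nat n + 1) - 1 = 3 * of_nat n + (2 :: complex)"
      "3 * (of_nat n + 1) + 1 = 3 * of_nat n + (4 :: complex)"
      "3 * (of_nat n + 1) = 3 * of_nat n + (3 :: complex)"
      by simp_all
    have "fact (3 * Suc n + 1) = (3 * of_nat n + 4) * (3 * of_nat n + 3) * (3 * of_nat n + 2) * (fact (3 *
          n + 1) :: complex)"
      by (simp add: numeral_3_eq_3 algebra_simps)
    moreover have "3 ^ Suc n * fact (Suc n) = 3 * (of_nat n + 1) * (3 ^ n * (fact n :: complex))"
      by (simp add: algebra_simps)
    ultimately have eq: "3 ^ Suc n * fact (Suc n) * (fact (3 * Suc n + 1) :: complex) = (3 ^ n * fact n *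
          fact (3 * n + 1)) *
        (3 * (of_nat n + 1) * (3 * (of_nat n + 1) - 1) * ((3 * (of_nat n + 1) + 1) * (3 * (of_nat n + 1))))"
      unfolding shift(1,2) by (simp only: shift(3) mult_ac)
    let ?f = "\<lambda>k. 3 * (of_nat k + 1) * (3 * (of_nat k + 1) -
          1) :: complex" and ?g = "\<lambda>k. (3 * (of_nat k + 1) + 1) * (3 * (of_nat k + 1)) :: complex"
    have "(\<Prod>k<Suc n. ?f k) * ((\<Prod>k<Suc n. ?g k)) = (\<Prod>k<n. ?f k) * ((\<Prod>k<n. ?g k)) *
          (?f n * ?g n)"
      by (simp only: prod.lessThan_Suc mult_ac)
    then show ?case unfolding eq Suc.IH .
  qed simp
  then show ?thesis unfolding gaps_double_Suc 1 2 3 by (simp only: mult.assoc mult_1_right)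
qed

text \<open>Here the differences are 3k, 3k - 2, 3k + 2, 3k and the final 2. One 3k gives 3^n n!;
  the 2 shifts the factors 3k + 2 down by one place, so that the rest fills (3n)! and leaves 3n +
  2.\<close>

lemma gaps_exps1_Suc:
  "gaps exps1 (2 * Suc n) = gaps exps1 (2 * n) * (3 ^ n * fact n * ((3 * of_nat n + 2) * fact (3 * n)))"
proof -
  have e: "exps1 (2 * m) = 3 * m" "exps1 (2 * m + 1) = 3 * m + 2" for m
    by (simp_all add: exps1_def)
  have 1: "(\<Prod>m<n. (of_nat (exps1 (2 * n)) - of_nat (exps1 (2 * m))) * (of_nat (exps1 (2 * n)) -
        of_nat (exps1 (2 * m + 1)))) =
      (\<Prod>k<n. 3 * (of_nat k + 1) * (3 * (of_nat k + 1) - 2 :: complex))"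
    unfolding e prod_reverse_diff[of "\<lambda>x. 3 * x * (3 * x - 2)" n, symmetric]
    by (intro prod.cong) (auto simp: algebra_simps)
  have 2: "(\<Prod>m<n. (of_nat (exps1 (2 * n + 1)) - of_nat (exps1 (2 * m))) * (of_nat (exps1 (2 * n + 1)) -
        of_nat (exps1 (2 * m + 1)))) =
      (\<Prod>k<n. (3 * (of_nat k + 1) + 2) * (3 * (of_nat k + 1) :: complex))"
    unfolding e prod_reverse_diff[of "\<lambda>x. (3 * x + 2) * (3 * x)" n, symmetric]
    by (intro prod.cong) (auto simp: algebra_simps)
  have 3: "of_nat (exps1 (2 * n + 1)) - of_nat (exps1 (2 * n)) = (2 :: complex)"
    unfolding e by simp
  have "(\<Prod>k<n. 3 * (of_nat k + 1) * (3 * (of_nat k + 1) - 2)) * ((\<Prod>k<n. (3 * (of_nat k + 1) +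
        2) * (3 * (of_nat k + 1))) * 2) =
      (3 ^ n * fact n * ((3 * of_nat n + 2) * fact (3 * n)) :: complex)"
  proof (induction n)
    case (Suc n)
    have shift: "3 * (of_nat n + 1) - 2 = 3 * of_nat n + (1 :: complex)"
      "3 * (of_nat n + 1) + 2 = 3 * of_nat (Suc n) + (2 :: complex)"
      "3 * (of_nat n + 1) = 3 * of_nat n + (3 :: complex)"
      by simp_all
    have "fact (3 * Suc n) = (3 * of_nat n + 3) * (3 * of_nat n + 2) * (3 * of_nat n + 1) * (fact (3 *
          n) :: complex)"
      by (simp add: numeral_3_eq_3 algebra_simps)
    moreover have "3 ^ Suc n * fact (Suc n) = 3 * (of_nat n + 1) * (3 ^ n * (fact n :: complex))"
      by (simp add: algebra_simps)
    ultimately have eq: "3 ^ Suc n * fact (Suc n) * ((3 * of_nat (Suc n) + 2) * (fact (3 * Suc n) :: complex)) =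
        (3 ^ n * fact n * ((3 * of_nat n + 2) * fact (3 * n))) *
        (3 * (of_nat n + 1) * (3 * (of_nat n + 1) - 2) * ((3 * (of_nat n + 1) + 2) * (3 * (of_nat n + 1))))"
      unfolding shift(1,2) by (simp only: shift(3) mult_ac)
    let ?f = "\<lambda>k. 3 * (of_nat k + 1) * (3 * (of_nat k + 1) -
          2) :: complex" and ?g = "\<lambda>k. (3 * (of_nat k + 1) + 2) * (3 * (of_nat k + 1)) :: complex"
    have "(\<Prod>k<Suc n. ?f k) * ((\<Prod>k<Suc n. ?g k) * 2) = (\<Prod>k<n. ?f k) * ((\<Prod>k<n. ?g k) *
          2) * (?f n * ?g n)"
      by (simp only: prod.lessThan_Suc mult_ac)
    then show ?case unfolding eq Suc.IH .
  qed simp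
  then show ?thesis unfolding gaps_double_Suc 1 2 3 by (simp only: mult.assoc)
qed

text \<open>The window of denominators F n, ..., F (2n - 1) moves to F (n + 1), ..., F (2n + 1): it
  gains F (2n) and F (2n + 1) and loses F n.\<close>

lemma ratio_prod_Suc:
  fixes num F :: "nat \<Rightarrow> complex"
  assumes F: "\<And>k. F k \<noteq> 0"
  shows "(\<Prod>j=1..Suc n. num j / F (Suc n + j - 1)) * (F (2 * n) * F (2 * n + 1)) =
    (\<Prod>j=1..n. num j / F (n + j - 1)) * (num (Suc n) * F n)"
proof -
  have D: "(\<Prod>j=1..m. F (m + j - 1)) = (\<Prod>k<m. F (m + k))" for m
    by (rule prod.reindex_bij_witness[of _ Suc "\<lambda>j. j - 1"]) auto
  have nz: "(\<Prod>k<m. F (l + k)) \<noteq> 0" for l m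
    using F by simp
  have "(\<Prod>k<n. F (n + k)) * (F (2 * n) * F (2 * n + 1)) = (\<Prod>k<Suc (Suc n). F (n + k))"
    by (simp add: mult_2 mult.assoc)
  also have "\<dots> = F n * (\<Prod>k<Suc n. F (Suc n + k))"
    by (subst prod.lessThan_Suc_shift) simp
  finally have "F (2 * n) * F (2 * n + 1) = F n * (\<Prod>k<Suc n. F (Suc n + k)) / (\<Prod>k<n. F (n + k))"
    using nz by (metis nonzero_mult_div_cancel_left)
  then show ?thesis
    unfolding prod_dividef D using nz[of "Suc n" "Suc n"] by simp
qed

lemma A_num_Suc: "A_num (Suc n) * (fact (2 * n) * fact (2 * n + 1)) = A_num n * (fact (3 * n + 1) * fact n)"
  using ratio_prod_Suc[of fact "\<lambda>j. fact (3 * j - 2)" n] by (simp add: A_num_def)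

lemma C_num_Suc: "C_num (Suc n) * (fact (2 * n) * fact (2 * n + 1)) = C_num n * ((3 * of_nat n + 2) *
      fact (3 * n) * fact n)"
  using ratio_prod_Suc[of fact "\<lambda>j. of_nat (3 * j - 1) * fact (3 * j - 3)" n]
  by (simp add: C_num_def add.commute)

lemma choose_2_Suc: "Suc n choose 2 = (n choose 2) + n"
  by (simp add: numeral_2_eq_2)

lemma gaps_exps0: "gaps exps0 (2 * n) = 3 ^ (n choose 2) * A_num n * gaps (\<lambda>j. j) (2 * n)"
proof (induction n)
  case 0
  then show ?case by (simp add: gaps_def A_num_def binomial_eq_0)
next
  case (Suc n)
  have "gaps (\<lambda>j. j) (2 * Suc n) = gaps (\<lambda>j. j) (2 * n) * (fact (2 * n) * fact (2 * n + 1))"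
    using gaps_id_Suc[of "2 * n"] gaps_id_Suc[of "2 * n + 1"] by (simp del: fact_Suc)
  then have "3 ^ (Suc n choose 2) * A_num (Suc n) * gaps (\<lambda>j. j) (2 * Suc n) =
      3 ^ (n choose 2) * 3 ^ n * (A_num (Suc n) * (fact (2 * n) * fact (2 * n + 1))) * gaps (\<lambda>j. j) (2 * n)"
    by (simp only: choose_2_Suc power_add mult_ac)
  then show ?case unfolding gaps_exps0_Suc Suc A_num_Suc by (simp only: mult_ac)
qed

lemma gaps_exps1: "gaps exps1 (2 * n) = 3 ^ (n choose 2) * C_num n * gaps (\<lambda>j. j) (2 * n)"
proof (induction n)
  case 0
  then show ?case by (simp add: gaps_def C_num_def binomial_eq_0)
next
  case (Suc n)
  have "gaps (\<lambda>j. j) (2 * Suc n) = gaps (\<lambda>j. j) (2 * n) * (fact (2 * n) * fact (2 * n + 1))"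
    using gaps_id_Suc[of "2 * n"] gaps_id_Suc[of "2 * n + 1"] by (simp del: fact_Suc)
  then have "3 ^ (Suc n choose 2) * C_num (Suc n) * gaps (\<lambda>j. j) (2 * Suc n) =
      3 ^ (n choose 2) * 3 ^ n * (C_num (Suc n) * (fact (2 * n) * fact (2 * n + 1))) * gaps (\<lambda>j. j) (2 * n)"
    by (simp only: choose_2_Suc power_add mult_ac)
  then show ?case unfolding gaps_exps1_Suc Suc C_num_Suc by (simp only: mult_ac)
qed

text \<open>The quotient of t^b - t^a by t - 1, written as a polynomial so that it can be evaluated
  at t = 1.\<close>

definition qgap :: "nat \<Rightarrow> nat \<Rightarrow> complex \<Rightarrow> complex" where
  "qgap a b t = t ^ a * (\<Sum>k<b - a. t ^ k)"

lemma qgap: "a \<le> b \<Longrightarrow> t ^ b - t ^ a = (t - 1) * qgap a b t"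
proof -
  assume "a \<le> b"
  then have "t ^ b = t ^ a * t ^ (b - a)" by (simp flip: power_add)
  then have "t ^ b - t ^ a = t ^ a * (t ^ (b - a) - 1)" by (simp only: right_diff_distrib mult_1_right)
  then show ?thesis by (simp only: power_diff_1_eq qgap_def mult_ac)
qed

lemma qgap_1: "a \<le> b \<Longrightarrow> qgap a b 1 = of_nat b - of_nat a"
  by (simp add: qgap_def of_nat_diff)

definition qgaps :: "(nat \<Rightarrow> nat) \<Rightarrow> nat \<Rightarrow> complex \<Rightarrow> complex" where
  "qgaps l N t = (\<Prod>j<N. \<Prod>i<j. qgap (l i) (l j) t)"

text \<open>The exponent of t - 1 depends only on N and not on l, so the three determinants in
  \<open>defect\<close> share this factor.\<close>

lemma alternant_geometric_qgaps:
  assumes "mono l"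
  shows "alternant l N (\<lambda>k. w * t ^ k) = (\<Prod>j<N. w ^ l j) * ((t - 1) ^ (\<Sum>j<N. j) *
        qgaps l N t)"
proof -
  have "(\<Prod>j<N. \<Prod>i<j. t ^ l j - t ^ l i) = (\<Prod>j<N. \<Prod>i<j. (t - 1) * qgap (l i) (l j) t)"
    by (intro prod.cong refl qgap monoD[OF assms]) simp
  also have "\<dots> = (t - 1) ^ (\<Sum>j<N. j) * qgaps l N t"
    by (simp add: qgaps_def prod.distrib power_sum)
  finally show ?thesis by (simp only: alternant_geometric)
qed

lemma qgaps_1:
  assumes "mono l"
  shows "qgaps l N 1 = gaps l N"
  unfolding qgaps_def gaps_def by (intro prod.cong refl qgap_1 monoD[OF assms]) simp

lemma isCont_qgaps: "isCont (qgaps l N) t"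
  unfolding qgaps_def qgap_def by (intro continuous_intros)

lemma mono_exps: "mono exps0" "mono exps1"
proof -
  have "exps0 j \<le> exps0 (Suc j)" "exps1 j \<le> exps1 (Suc j)" for j
    unfolding exps0_def exps1_def by (cases "even j"; auto elim!: evenE oddE)+
  then show "mono exps0" "mono exps1" by (simp_all add: mono_iff_le_Suc)
qed

lemma isCont_wt:
  fixes X Y :: "complex \<Rightarrow> complex"
  assumes "isCont X t" "isCont Y t"
  shows "isCont (\<lambda>t. wt q L (X t) (Y t) a b c d) t"
proof -
  have if_cont: "isCont (\<lambda>t. if P then f t else g t) t" if "isCont f t" "isCont g t"
    for P and f g :: "complex \<Rightarrow> complex"
    using that by (cases P) auto
  show ?thesis
    unfolding wt_def Let_def divide_inverse by (intro if_cont continuous_intros assms)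
qed

lemma isCont_Zt:
  fixes X Y :: "nat \<Rightarrow> complex \<Rightarrow> complex"
  assumes "\<And>i. isCont (X i) t" "\<And>i. isCont (Y i) t"
  shows "isCont (\<lambda>t. Zt q n (\<lambda>i. X i t) (\<lambda>i. Y i t) L) t"
  unfolding Zt_def using assms by (intro continuous_intros isCont_wt)

lemma prod_omega_exps:
  "(\<Prod>j<2 * n. omega ^ j) = omega ^ (4 * (n choose 2) + n)"
  "(\<Prod>j<2 * n. omega ^ exps0 j) = omega ^ n"
  "(\<Prod>j<2 * n. omega ^ exps1 j) = omega ^ (2 * n)"
proof -
  have o3: "omega ^ (3 * k + m) = omega ^ m" for k m
    by (simp add: power_add power_mult omega_cube)
  have "(\<Prod>j<2 * n. omega ^ exps0 j) = (\<Prod>m<n. omega)"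
    unfolding prod_double
    by (intro prod.cong refl) (simp add: exps0_def power_add power_mult omega_cube)
  then show "(\<Prod>j<2 * n. omega ^ exps0 j) = omega ^ n" by simp
  have "(\<Prod>j<2 * n. omega ^ exps1 j) = (\<Prod>m<n. omega ^ 2)"
    unfolding prod_double
    by (intro prod.cong refl) (simp add: exps1_def power_add power_mult omega_cube power2_eq_square)
  then show "(\<Prod>j<2 * n. omega ^ exps1 j) = omega ^ (2 * n)" by (simp add: power_mult)
  show "(\<Prod>j<2 * n. omega ^ j) = omega ^ (4 * (n choose 2) + n)"
  proof (induction n)
    case (Suc n)
    have "4 * (Suc n choose 2) + Suc n = (4 * (n choose 2) + n) + 2 * n + (2 * n + 1)"
      by (simp add: choose_2_Suc)
    moreover have "(\<Prod>j<2 * Suc n. omega ^ j) = (\<Prod>j<2 * n. omega ^ j) * omega ^ (2 * n) *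
          omega ^ (2 * n + 1)"
      by simp
    ultimately show ?case by (simp only: Suc.IH power_add)
  qed (simp add: binomial_eq_0)
qed

text \<open>Cubing removes omega from the X. Their exponents are even and those of the Y odd, and
  distinct powers of a real number above 1 are different.\<close>

lemma generic_geometric:
  fixes \<tau> :: real
  assumes "\<tau> > 1"
  shows "generic n n (\<lambda>i. omega * of_real \<tau> ^ (2 * i)) (\<lambda>j. of_real \<tau> ^ (2 * (n -
        1 - j) + 1))"
proof -
  have inj: "(of_real \<tau> ^ a) ^ 3 = ((of_real \<tau> ^ b) ^ 3 :: complex) \<longleftrightarrow> a =
        b" for a b
  proof -
    have "(of_real \<tau> ^ a) ^ 3 = ((of_real \<tau> ^ b) ^ 3 :: complex) \<longleftrightarrow>
          of_real (\<tau> ^ (a * 3)) = (of_real (\<tau> ^ (b * 3)) :: complex)"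
      by (simp only: power_mult of_real_power)
    also have "\<dots> \<longleftrightarrow> a = b"
      using assms by (simp only: of_real_eq_iff power_inject_exp) simp
    finally show ?thesis .
  qed
  have "2 * i \<noteq> 2 * k + 1" for i k :: nat
    by (metis even_mult_iff even_plus_one_iff even_numeral)
  then show ?thesis
    using assms omega_neq_0
    unfolding generic_def inj_on_def power_mult_distrib[of omega] omega_cube mult_1_left inj by auto
qed

lemma spectral_geometric:
  assumes "k < 2 * n"
  shows "spectral n (\<lambda>i. omega * t ^ (2 * i)) (\<lambda>j. t ^ (2 * (n - 1 - j) + 1)) k = omega * t ^ k"
  using assms by (auto simp: spectral_def elim!: evenE oddE)

theorem Zt_omega:
  assumes L: "L ^ 3 \<noteq> 1"
  shows "Zt omega n (\<lambda>_. omega) (\<lambda>_. 1) L * ((1 - L * omega ^ (n + 1)) * (1 - L *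
        omega ^ (n + 2))) =
    omega ^ (Suc n choose 2) * (A_num n * (1 + omega ^ n * L ^ 2) + (-1) ^ n * C_num n * omega ^ (2 * n) * L)"
proof -
  define X where "X t i = omega * t ^ (2 * i)" for t :: complex and i :: nat
  define Y where "Y t j = t ^ (2 * (n - 1 - j) + 1)" for t :: complex and j :: nat
  define D where "D = (1 - L * omega ^ (n + 1)) * (1 - L * omega ^ (n + 2))"
  \<comment> \<open>This is \<open>defect\<close> on the geometric progression without the common
    power of t - 1. It is meaningful at t = 1, where all X are omega and all Y are 1.\<close>
  define f where "f t = (3 * omega) ^ (n choose 2) * Zt omega n (X t) (Y t) L * D *
      (omega ^ (4 * (n choose 2) + n) * qgaps (\<lambda>j. j) (2 * n) t) -
    (((\<Prod>i<n. X t i) + omega ^ (2 * n) * L ^ 2 * (\<Prod>j<n. Y t j)) * (omega ^ n * qgaps exps0 (2 * n) t) +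
      (-1) ^ n * omega ^ (2 * n) * L * (omega ^ (2 * n) * qgaps exps1 (2 * n) t))" for t
  have mono_id: "mono (\<lambda>j :: nat. j)" by (simp add: mono_def)
  have f0: "f (of_real \<tau>) = 0" if "\<tau> > 1" for \<tau>
  proof -
    let ?t = "of_real \<tau> :: complex"
    let ?s = "(?t - 1) ^ (\<Sum>j<2 * n. j)"
    have "?t \<noteq> 1" using that by simp
    then have "?s \<noteq> 0" by simp
    have alt: "alternant l (2 * n) (spectral n (X ?t) (Y ?t)) = (\<Prod>j<2 * n. omega ^ l j) * (?s *
          qgaps l (2 * n) ?t)"
      if "mono l" for l
    proof -
      have "alternant l (2 * n) (spectral n (X ?t) (Y ?t)) = alternant l (2 * n) (\<lambda>k. omega * ?t ^ k)"
        unfolding X_def Y_def by (intro alternant_cong spectral_geometric)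
      then show ?thesis using alternant_geometric_qgaps[OF that] by (simp only:)
    qed
    have factor: "a * (b * (s * c)) - (d * (e * (s * g)) + h * (k * (s * m))) = s * (a * (b * c) - (d * (e *
          g) + h * (k * m)))"
      for a b c d e g h k m s :: complex
      by (simp add: algebra_simps)
    have d: "defect n (X ?t) (Y ?t) L = 0"
      unfolding X_def Y_def by (intro defect_eq_0 L generic_geometric that)
    have "defect n (X ?t) (Y ?t) L = ?s * f ?t"
      unfolding defect_def f_def D_def alt[OF mono_exps(1)] alt[OF mono_exps(2)] alt[OF mono_id] prod_omega_exps
      by (rule factor)
    with d show ?thesis using \<open>?s \<noteq> 0\<close> by (metis mult_eq_0_iff)
  qed
  \<comment> \<open>The defect is known to vanish only for generic parameters, here real t > 1;
    continuity transfers this to the excluded point t = 1.\<close>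
  have "isCont f 1"
    unfolding f_def by (intro continuous_intros isCont_Zt isCont_qgaps) (simp_all add: X_def Y_def)
  moreover have "(\<lambda>m. of_real (1 + 1 / real (Suc m)) :: complex) \<longlonglongrightarrow> of_real (1 + 0)"
    by (intro tendsto_intros LIMSEQ_Suc lim_1_over_n)
  ultimately have "(\<lambda>m. f (of_real (1 + 1 / real (Suc m)))) \<longlonglongrightarrow> f 1"
    by (intro isCont_tendsto_compose[of _ f]) auto
  moreover have "f (of_real (1 + 1 / real (Suc m))) = 0" for m
    by (rule f0) simp
  ultimately have f1: "f 1 = 0"
    by (simp only: LIMSEQ_const_iff)
  let ?g = "gaps (\<lambda>j. j) (2 * n)" and ?Z = "Zt omega n (\<lambda>_. omega) (\<lambda>_. 1) L"
  let ?R = "A_num n * (1 + omega ^ n * L ^ 2) + (-1) ^ n * C_num n * omega ^ (2 * n) * L"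
  have XY: "X 1 = (\<lambda>_. omega)" "Y 1 = (\<lambda>_. 1)" by (auto simp: X_def Y_def)
  have g0: "?g \<noteq> 0" by (auto simp: gaps_def)
  have eq: "(3 * omega) ^ (n choose 2) * ?Z * D * (omega ^ (4 * (n choose 2) + n) * ?g) =
      (omega ^ n + omega ^ (2 * n) * L ^ 2) * (omega ^ n * (3 ^ (n choose 2) * A_num n * ?g)) +
        (-1) ^ n * omega ^ (2 * n) * L * (omega ^ (2 * n) * (3 ^ (n choose 2) * C_num n * ?g))"
    using f1 unfolding f_def XY qgaps_1[OF mono_exps(1)] qgaps_1[OF mono_exps(2)] qgaps_1[OF mono_id]
      gaps_exps0 gaps_exps1 by simp
  have p5: "omega ^ (5 * (n choose 2)) = omega ^ (n choose 2) * omega ^ (4 * (n choose 2))"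
    unfolding power_add[symmetric] by simp
  have "3 ^ (n choose 2) * ?g * omega ^ n * (omega ^ (5 * (n choose 2)) * (?Z * D)) =
      (3 * omega) ^ (n choose 2) * ?Z * D * (omega ^ (4 * (n choose 2) + n) * ?g)"
    unfolding p5 by (simp only: power_mult_distrib power_add mult_ac)
  also have "\<dots> = 3 ^ (n choose 2) * ?g * omega ^ n * (omega ^ n * ?R)"
    unfolding eq unfolding mult_2 power_add
    by (simp only: distrib_left distrib_right mult_1_left mult_1_right mult_ac)
  finally have "3 ^ (n choose 2) * ?g * omega ^ n * (omega ^ (5 * (n choose 2)) * (?Z * D)) =
      3 ^ (n choose 2) * ?g * omega ^ n * (omega ^ n * ?R)" .
  then have "omega ^ (5 * (n choose 2)) * (?Z * D) = omega ^ n * ?R"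
    using g0 omega_neq_0 by simp
  \<comment> \<open>The total exponent 6 (n choose 2) is divisible by 3, so omega^(n choose 2)
    inverts the factor on the left of the previous equation.\<close>
  moreover have "omega ^ (n choose 2) * omega ^ (5 * (n choose 2)) = 1"
  proof -
    have "omega ^ (n choose 2) * omega ^ (5 * (n choose 2)) = omega ^ (3 * (2 * (n choose 2)))"
      by (simp only: power_add[symmetric]) simp
    then show ?thesis by (simp only: power_mult[of omega 3] omega_cube power_one)
  qed
  ultimately have "?Z * D = omega ^ (n choose 2) * (omega ^ n * ?R)"
    by (metis mult.assoc mult_1_left)
  then show ?thesis
    unfolding D_def choose_2_Suc power_add[of omega "n choose 2" n] by (simp only: mult.assoc)
qed

section \<open>Additive and multiplicative variables\<close>

lemma qpow_add: "qpow \<eta> (x + y) = qpow \<eta> x * qpow \<eta> y"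
  by (simp add: qpow_def distrib_left exp_add)

lemma qpow_0 [simp]: "qpow \<eta> 0 = 1"
  by (simp add: qpow_def)

lemma qpow_neq_0 [simp]: "qpow \<eta> x \<noteq> 0"
  by (simp add: qpow_def)

lemma qpow_minus: "qpow \<eta> (- x) = inverse (qpow \<eta> x)"
  by (simp add: qpow_def exp_minus)

lemma qpow_of_nat: "qpow \<eta> (of_nat k) = qpow \<eta> 1 ^ k"
  by (induction k) (simp_all add: qpow_add)

lemma qpow_of_int: "qpow \<eta> (of_int k) = qpow \<eta> 1 powi k"
  by (cases k rule: int_cases2) (simp_all add: qpow_minus qpow_of_nat power_int_minus)

lemma qpow_sum: "qpow \<eta> (\<Sum>i\<in>A. f i) = (\<Prod>i\<in>A. qpow \<eta> (f i))"
  by (induction A rule: infinite_finite_induct) (simp_all add: qpow_add)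

lemma qpow_surj:
  assumes "\<eta> \<noteq> 0" "z \<noteq> 0"
  shows "\<exists>x. qpow \<eta> x = z"
proof
  have "2 * of_real pi * \<i> * \<eta> * (Ln z / (2 * of_real pi * \<i> * \<eta>)) = Ln z"
    using assms(1) by simp
  then show "qpow \<eta> (Ln z / (2 * of_real pi * \<i> * \<eta>)) = z"
    unfolding qpow_def using assms(2) by simp
qed

text \<open>At p = 0 the bracket [x] is a Laurent polynomial in q^(x/2). Taking x / 2 as an argument
  of \<open>qpow\<close> fixes the square root consistently and keeps it multiplicative.\<close>

definition qhalf :: "complex \<Rightarrow> complex \<Rightarrow> complex" where
  "qhalf \<eta> x = qpow \<eta> (x / 2)"

lemma qhalf_neq_0 [simp]: "qhalf \<eta> x \<noteq> 0"
  by (simp add: qhalf_def)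

lemma qhalf_add: "qhalf \<eta> (x + y) = qhalf \<eta> x * qhalf \<eta> y"
  by (simp add: qhalf_def add_divide_distrib qpow_add)

lemma qhalf_diff: "qhalf \<eta> (x - y) = qhalf \<eta> x / qhalf \<eta> y"
proof -
  have "(x - y) / 2 = x / 2 + - (y / 2)" by (simp add: diff_divide_distrib)
  then show ?thesis by (simp only: qhalf_def qpow_add qpow_minus divide_inverse)
qed

lemma qpow_eq_qhalf: "qpow \<eta> x = qhalf \<eta> x ^ 2"
  by (simp add: qhalf_def power2_eq_square flip: qpow_add)

definition trig :: "complex \<Rightarrow> complex" where
  "trig t = (1 - t ^ 2) / t"

lemma br_trig: "br 0 \<eta> x = trig (qhalf \<eta> x)"
proof -
  have "qpow \<eta> (- x / 2) = inverse (qhalf \<eta> x)"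
    unfolding qhalf_def using qpow_minus[of \<eta> "x / 2"] by simp
  then show ?thesis unfolding br_nome_0 trig_def qpow_eq_qhalf[of \<eta> x] by (simp only: divide_inverse mult.commute)
qed

lemma trig_divide: "s \<noteq> 0 \<Longrightarrow> t \<noteq> 0 \<Longrightarrow> trig (t / s) = (s ^ 2 -
      t ^ 2) / (s * t)"
  by (simp add: trig_def power_divide divide_simps power2_eq_square)

text \<open>The variables x, y, h, l stand for square roots of q^x, q^y, q and q^(lam+a). The
  prefactor x y makes every weight a function of the squares alone. Five formulas suffice, as the
  types with four equal signs share one.\<close>

lemma trig_quotients:
  assumes "x \<noteq> 0" "y \<noteq> 0" "h \<noteq> 0" "l \<noteq> 0" "h ^ 2 \<noteq> 1" "l ^ 2 \<noteq> 1"
  shows "x * y * (trig (x * h / y) / trig h) = (y ^ 2 - h ^ 2 * x ^ 2) / (1 - h ^ 2)"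
    and "x * y * (trig (x / y) * trig (l * h) / (trig h * trig l)) =
      (y ^ 2 - x ^ 2) * (1 - h ^ 2 * l ^ 2) / ((1 - h ^ 2) * (1 - l ^ 2))"
    and "x * y * (trig (x / y) * trig (l / h) / (trig h * trig l)) =
      (y ^ 2 - x ^ 2) * (h ^ 2 - l ^ 2) / ((1 - h ^ 2) * (1 - l ^ 2))"
    and "x * y * (trig (l * x / y) / trig l) = (y ^ 2 - l ^ 2 * x ^ 2) / (1 - l ^ 2)"
    and "x * y * (trig (l * y / x) / trig l) = (x ^ 2 - l ^ 2 * y ^ 2) / (1 - l ^ 2)"
proof -
  have e: "trig (x * h / y) = (y ^ 2 - h ^ 2 * x ^ 2) / (y * x * h)" "trig (x / y) = (y ^ 2 - x ^ 2) / (y * x)"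
    "trig (l / h) = (h ^ 2 - l ^ 2) / (h * l)" "trig (l * x / y) = (y ^ 2 - l ^ 2 * x ^ 2) / (y * l * x)"
    "trig (l * y / x) = (x ^ 2 - l ^ 2 * y ^ 2) / (x * l * y)"
    using assms by (simp_all add: trig_divide power_mult_distrib mult_ac)
  have t: "trig h = (1 - h ^ 2) / h" "trig l = (1 - l ^ 2) / l" "trig (l * h) = (1 - h ^ 2 * l ^ 2) / (l * h)"
    by (simp_all add: trig_def power_mult_distrib mult_ac)
  have nz: "1 - h ^ 2 \<noteq> 0" "1 - l ^ 2 \<noteq> 0" using assms by auto
  have c1: "x * y * (A / (y * x * h) / (B / h)) = A / B" for A B
    using assms by simp
  have c2: "x * y * (A / (y * x) * (C / (l * h)) / (B / h * (D / l))) = A * C / (B * D)" for A B C D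
    using assms by simp
  have c3: "x * y * (A / (y * x) * (C / (h * l)) / (B / h * (D / l))) = A * C / (B * D)" for A B C D
    using assms by simp
  have c4: "x * y * (A / (y * l * x) / (B / l)) = A / B" "x * y * (A / (x * l * y) / (B / l)) = A / B" for A B
    using assms by simp_all
  show "x * y * (trig (x * h / y) / trig h) = (y ^ 2 - h ^ 2 * x ^ 2) / (1 - h ^ 2)"
    unfolding e t by (rule c1)
  show "x * y * (trig (x / y) * trig (l * h) / (trig h * trig l)) =
      (y ^ 2 - x ^ 2) * (1 - h ^ 2 * l ^ 2) / ((1 - h ^ 2) * (1 - l ^ 2))"
    unfolding e t by (rule c2)
  show "x * y * (trig (x / y) * trig (l / h) / (trig h * trig l)) =
      (y ^ 2 - x ^ 2) * (h ^ 2 - l ^ 2) / ((1 - h ^ 2) * (1 - l ^ 2))"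
    unfolding e t by (rule c3)
  show "x * y * (trig (l * x / y) / trig l) = (y ^ 2 - l ^ 2 * x ^ 2) / (1 - l ^ 2)"
    unfolding e t by (rule c4)
  show "x * y * (trig (l * y / x) / trig l) = (x ^ 2 - l ^ 2 * y ^ 2) / (1 - l ^ 2)"
    unfolding e t by (rule c4)
qed

lemma Rweight_eq_wt:
  assumes q: "qpow \<eta> 1 \<noteq> 1" and L: "qpow \<eta> lam * qpow \<eta> 1 powi a \<noteq> 1"
  shows "qpow \<eta> ((x + y) / 2) * Rweight 0 \<eta> (b - a) (d - b) (d - c) (c - a) (lam + of_int a) (x - y) =
    wt (qpow \<eta> 1) (qpow \<eta> lam) (qpow \<eta> x) (qpow \<eta> y) a b c d"
proof -
  define u v h l where "u = qhalf \<eta> x" and "v = qhalf \<eta> y" and "h = qhalf \<eta> 1" and "l =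
        qhalf \<eta> (lam + of_int a)"
  have nz: "u \<noteq> 0" "v \<noteq> 0" "h \<noteq> 0" "l \<noteq> 0" by (simp_all add: u_def v_def h_def l_def)
  have sq: "qpow \<eta> x = u ^ 2" "qpow \<eta> y = v ^ 2" "qpow \<eta> 1 = h ^ 2"
    by (simp_all only: u_def v_def h_def qpow_eq_qhalf)
  have l2: "qpow \<eta> lam * qpow \<eta> 1 powi a = l ^ 2"
    unfolding l_def qpow_eq_qhalf[symmetric] by (simp add: qpow_add qpow_of_int)
  have h1: "h ^ 2 \<noteq> 1" "l ^ 2 \<noteq> 1" using q L sq l2 by auto
  have pre: "qpow \<eta> ((x + y) / 2) = u * v"
    by (simp only: qhalf_def[symmetric] qhalf_add u_def v_def)
  have brs: "br 0 \<eta> (x - y + 1) = trig (u * h / v)" "br 0 \<eta> 1 = trig h" "br 0 \<eta> (x - y) =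
        trig (u / v)"
    "br 0 \<eta> (lam + of_int a + 1) = trig (l * h)" "br 0 \<eta> (lam + of_int a - 1) = trig (l / h)"
    "br 0 \<eta> (lam + of_int a) = trig l" "br 0 \<eta> (lam + of_int a + (x - y)) = trig (l * u / v)"
    "br 0 \<eta> (lam + of_int a - (x - y)) = trig (l * v / u)"
    unfolding br_trig by (simp_all add: qhalf_add[of _ "lam + of_int a"] qhalf_add[of _ _ 1] qhalf_diff flip: u_def v_def h_def l_def)
  note Q = trig_quotients[OF nz h1]
  show ?thesis
    unfolding Rweight_def wt_def Let_def l2 unfolding brs pre sq
    by (simp only: if_distrib[where f = "\<lambda>z. u * v * z"] Q mult_zero_right)
qed

text \<open>The normalisation distributes over the blocks: n (|x| + |y|) / 2 is the sum of (x_i +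
  y_j) / 2 over all positions.\<close>

lemma block_weight_product:
  assumes q: "qpow \<eta> 1 \<noteq> 1" and L: "\<And>a. qpow \<eta> lam * qpow \<eta> 1 powi a \<noteq> 1"
  shows "qpow \<eta> (of_nat n * ((\<Sum>i<n. x i) + (\<Sum>i<n. y i)) / 2) * Z 0 \<eta> n x y lam =
    Zt (qpow \<eta> 1) n (\<lambda>i. qpow \<eta> (x i)) (\<lambda>j. qpow \<eta> (y j)) (qpow \<eta> lam)"
proof -
  have "(\<Sum>i<n. \<Sum>j<n. (x i + y j) / 2) = of_nat n * ((\<Sum>i<n. x i) + (\<Sum>i<n. y i)) / 2"
    by (simp add: sum.distrib sum_divide_distrib[symmetric] sum_distrib_left[symmetric] distrib_left)
  then have "qpow \<eta> (of_nat n * ((\<Sum>i<n. x i) + (\<Sum>i<n. y i)) / 2) =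
        (\<Prod>i<n. \<Prod>j<n. qpow \<eta> ((x i + y j) / 2))"
    by (simp only: qpow_sum[symmetric])
  then have "qpow \<eta> (of_nat n * ((\<Sum>i<n. x i) + (\<Sum>i<n. y i)) / 2) * Z 0 \<eta> n x y lam =
      (\<Sum>M\<in>states n. \<Prod>i<n. \<Prod>j<n. qpow \<eta> ((x i + y j) / 2) * block_weight 0 \<eta> x y lam M i j)"
    by (simp only: Z_def sum_distrib_left prod.distrib)
  also have "\<dots> = Zt (qpow \<eta> 1) n (\<lambda>i. qpow \<eta> (x i)) (\<lambda>j. qpow \<eta> (y j)) (qpow \<eta> lam)"
    unfolding Zt_def block_weight_def Let_def Suc_eq_plus1
    by (intro sum.cong prod.cong refl Rweight_eq_wt q L)
  finally show ?thesis .
qed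

text \<open>The description is justified because the normalised sum depends on the logarithms only
  through their exponentials, which is \<open>eq\<close>.\<close>

lemma Ztilde_eq_Zt:
  assumes \<eta>: "qpow \<eta> 1 = omega" and L: "L \<noteq> 0" "L ^ 3 \<noteq> 1"
    and XY: "\<And>i. X i \<noteq> 0" "\<And>j. Y j \<noteq> 0"
  shows "Ztilde 0 \<eta> n X Y L = Zt omega n X Y L"
  unfolding Ztilde_def
proof (rule the_equality)
  have eq: "qpow \<eta> (of_nat n * ((\<Sum>i<n. x i) + (\<Sum>i<n. y i)) / 2) * Z 0 \<eta> n x y lam =
        Zt omega n X Y L"
    if "\<forall>i<n. qpow \<eta> (x i) = X i" "\<forall>i<n. qpow \<eta> (y i) = Y i" "qpow \<eta> lam =
          L" for x y lam
  proof -
    have "qpow \<eta> (of_nat n * ((\<Sum>i<n. x i) + (\<Sum>i<n. y i)) / 2) * Z 0 \<eta> n x y lam =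
        Zt (qpow \<eta> 1) n (\<lambda>i. qpow \<eta> (x i)) (\<lambda>j. qpow \<eta> (y j)) (qpow \<eta> lam)"
      using cube_neq_1_omega[OF L(2)] omega_neq_1 by (intro block_weight_product) (simp_all only: \<eta> that not_False_eq_True)
    also have "\<dots> = Zt omega n X Y L"
      unfolding Zt_def using that \<eta> by (intro sum.cong prod.cong refl) simp
    finally show ?thesis .
  qed
  then show "\<forall>x y lam. (\<forall>i<n. qpow \<eta> (x i) =
        X i) \<and> (\<forall>i<n. qpow \<eta> (y i) = Y i) \<and> qpow \<eta> lam = L \<longrightarrow>
      Zt omega n X Y L = qpow \<eta> (of_nat n * ((\<Sum>i<n. x i) + (\<Sum>i<n. y i)) / 2) * Z 0 \<eta> n x y lam"
    by metis
  fix z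
  assume z: "\<forall>x y lam. (\<forall>i<n. qpow \<eta> (x i) =
        X i) \<and> (\<forall>i<n. qpow \<eta> (y i) = Y i) \<and> qpow \<eta> lam = L \<longrightarrow>
      z = qpow \<eta> (of_nat n * ((\<Sum>i<n. x i) + (\<Sum>i<n. y i)) / 2) * Z 0 \<eta> n x y lam"
  \<comment> \<open>Uniqueness needs at least one admissible choice of logarithms, as the defining
    condition would otherwise hold vacuously for every value.\<close>
  have "\<eta> \<noteq> 0" using \<eta> omega_neq_1 by (auto simp: qpow_def)
  then have "\<forall>i. \<exists>x. qpow \<eta> x = X i" "\<forall>i. \<exists>x. qpow \<eta> x =
        Y i" "\<exists>x. qpow \<eta> x = L"
    using qpow_surj XY L by auto
  then obtain x y lam where xyl: "\<forall>i. qpow \<eta> (x i) = X i" "\<forall>i. qpow \<eta> (y i) =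
        Y i" "qpow \<eta> lam = L"
    by metis
  then have "z = qpow \<eta> (of_nat n * ((\<Sum>i<n. x i) + (\<Sum>i<n. y i)) / 2) * Z 0 \<eta> n x y lam"
    using z by blast
  also have "\<dots> = Zt omega n X Y L"
    using xyl by (intro eq) auto
  finally show "z = Zt omega n X Y L" .
qed

section \<open>States and alternating sign matrices\<close>

text \<open>Alternating signs make the partial sums oscillate between 0 and the first nonzero entry
  \<open>e\<close>; the total 1 then forces e = 1.\<close>

lemma partial_sums_of_alternating:
  fixes f :: "nat \<Rightarrow> int"
  assumes val: "\<And>j. j < n \<Longrightarrow> f j \<in> {-1, 0, 1}" and total: "(\<Sum>j<n. f j) = 1"
    and alt: "\<And>j k. j < k \<Longrightarrow> k < n \<Longrightarrow> f j \<noteq> 0 \<Longrightarrow>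
          f k \<noteq> 0 \<Longrightarrow> (\<And>l. j < l \<Longrightarrow> l < k \<Longrightarrow> f l = 0) \<Longrightarrow> f k = - f j"
    and m: "m \<le> n"
  shows "(\<Sum>j<m. f j) \<in> {0, 1}"
proof -
  have "\<exists>j<n. f j \<noteq> 0"
  proof (rule ccontr)
    assume "\<not> (\<exists>j<n. f j \<noteq> 0)"
    then have "(\<Sum>j<n. f j) = 0" by (intro sum.neutral) auto
    then show False using total by simp
  qed
  then obtain i where i: "f i \<noteq> 0" by blast
  define j0 where "j0 = (LEAST j. f j \<noteq> 0)"
  have first: "f j = 0" if "j < j0" for j
    using not_less_Least[of j "\<lambda>j. f j \<noteq> 0"] that unfolding j0_def by blast
  have j0: "f j0 \<noteq> 0"
    unfolding j0_def by (rule LeastI[of "\<lambda>j. f j \<noteq> 0", OF i])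
  define e where "e = f j0"
  \<comment> \<open>The last nonzero entry before position m is v. This state variable determines
    the current partial sum in \<open>inv\<close>.\<close>
  define last where "last m v \<longleftrightarrow> v \<noteq> 0 \<and> (\<exists>j<m. f j =
        v \<and> (\<forall>l. j < l \<and> l < m \<longrightarrow> f l = 0))" for m v
  have inv: "(\<forall>j<m. f j = 0) \<and> (\<Sum>j<m. f j) = 0 \<or> last m e \<and> (\<Sum>j<m. f j) =
        e \<or> last m (- e) \<and> (\<Sum>j<m. f j) = 0"
    if "m \<le> n" for m
    using that
  proof (induction m)
    case (Suc m)
    have last_Suc: "last (Suc m) v" if "last m v" "f m = 0" for v
    proof -
      obtain j where j: "j < m" "f j = v" "\<forall>l. j < l \<and> l < m \<longrightarrow> f l =
            0" "v \<noteq> 0"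
        using \<open>last m v\<close> unfolding last_def by blast
      have "f l = 0" if "j < l" "l < Suc m" for l
        using that j(3) \<open>f m = 0\<close> by (cases "l = m") simp_all
      then show ?thesis unfolding last_def using j by (intro conjI exI[of _ j]) simp_all
    qed
    have new: "last (Suc m) (f m)" if "f m \<noteq> 0"
      unfolding last_def using that by (intro conjI exI[of _ m]) simp_all
    have flip: "f m = - v" if v: "last m v" and fm: "f m \<noteq> 0" for v
    proof -
      obtain j where j: "j < m" "f j = v" "\<forall>l. j < l \<and> l < m \<longrightarrow> f l =
            0" "v \<noteq> 0"
        using v unfolding last_def by blast
      have "f m = - f j" by (rule alt) (use j fm Suc.prems in simp_all)
      then show ?thesis using j by simp
    qed
    show ?case
    proof (cases "f m = 0")
      case True
      moreover have "(\<forall>j<Suc m. f j = 0) \<longleftrightarrow> (\<forall>j<m. f j =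
            0)" using True by (simp add: All_less_Suc)
      ultimately show ?thesis using Suc.IH Suc.prems last_Suc[of e] last_Suc[of "- e"] by simp blast
    next
      case False
      consider "\<forall>j<m. f j = 0" "(\<Sum>j<m. f j) = 0" | "last m e" "(\<Sum>j<m. f j) =
            e" | "last m (- e)" "(\<Sum>j<m. f j) = 0"
        using Suc.IH Suc.prems Suc_leD by blast
      then show ?thesis
      proof cases
        case 1
        have "\<not> m < j0" using False first by blast
        moreover have "\<not> j0 < m" using 1(1) j0 by blast
        ultimately have "m = j0" by simp
        then show ?thesis using 1(2) new[OF False] by (simp add: e_def)
      next
        case 2
        then show ?thesis using flip[OF 2(1) False] new[OF False] by simp
      next
        case 3
        then show ?thesis using flip[OF 3(1) False] new[OF False] by simp
      qed
    qed
  qed simp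
  have "e = 1" using inv[OF order.refl] total by (elim disjE conjE) simp_all
  then show ?thesis using inv[OF m] by (elim disjE conjE) simp_all
qed

text \<open>Where \<open>g\<close> keeps its sign \<open>f\<close> is 0, and where it changes sign
  \<open>f\<close> is that change. Successive changes are opposite, hence so are consecutive nonzero
  entries.\<close>

lemma alternating_of_differences:
  fixes f g :: "nat \<Rightarrow> int"
  assumes g: "\<And>j. j \<le> n \<Longrightarrow> g j \<in> {-1, 1}" "g 0 = -1" "g n = 1"
    and f: "\<And>j. j < n \<Longrightarrow> f j = (g (Suc j) - g j) div 2"
  shows "m \<le> n \<Longrightarrow> 2 * (\<Sum>j<m. f j) = g m + 1"
    and "j < n \<Longrightarrow> f j \<in> {-1, 0, 1}" and "(\<Sum>j<n. f j) = 1"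
    and "j < k \<Longrightarrow> k < n \<Longrightarrow> f j \<noteq> 0 \<Longrightarrow> f k \<noteq> 0 \<Longrightarrow>
          (\<And>l. j < l \<Longrightarrow> l < k \<Longrightarrow> f l = 0) \<Longrightarrow> f k = - f j"
proof -
  have f2: "2 * f j = g (Suc j) - g j" if "j < n" for j
  proof -
    have "g j = -1 \<or> g j = 1" "g (Suc j) = -1 \<or> g (Suc j) = 1"
      using g(1)[of j] g(1)[of "Suc j"] that by simp_all
    then show ?thesis unfolding f[OF that] by (elim disjE) simp_all
  qed
  show ps: "2 * (\<Sum>j<m. f j) = g m + 1" if "m \<le> n" for m
    using that
  proof (induction m)
    case (Suc m)
    then have "2 * (\<Sum>j<m. f j) = g m + 1" by linarith
    then show ?case using f2[of m] Suc.prems by (simp add: distrib_left)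
  qed (use g(2) in simp)
  show "f j \<in> {-1, 0, 1}" if "j < n" for j
  proof -
    have "g j = -1 \<or> g j = 1" "g (Suc j) = -1 \<or> g (Suc j) = 1"
      using g(1)[of j] g(1)[of "Suc j"] that by simp_all
    then show ?thesis unfolding f[OF that] by (elim disjE) simp_all
  qed
  show "(\<Sum>j<n. f j) = 1" using ps[of n] g(3) by simp
  show "f k = - f j" if jk: "j < k" "k < n" "f j \<noteq> 0" "f k \<noteq> 0" "\<And>l. j < l \<Longrightarrow>
        l < k \<Longrightarrow> f l = 0" for j k
  proof -
    have "Suc j \<le> l \<Longrightarrow> l \<le> k \<Longrightarrow> g l = g (Suc j)" for l
    proof (induction l rule: dec_induct)
      case (step l)
      have "f l = 0" by (rule jk(5)) (use step in linarith)+
      moreover have "l < n" using step jk(2) by linarith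
      ultimately have "g (Suc l) = g l" using f2[of l] by linarith
      then show ?case using step by linarith
    qed simp
    then have "g k = g (Suc j)" using jk(1) by (metis Suc_leI order.refl)
    moreover have "g i = - g (Suc i)" if "i < n" "f i \<noteq> 0" for i
    proof -
      have "g i = -1 \<or> g i = 1" "g (Suc i) = -1 \<or> g (Suc i) = 1" "g (Suc i) \<noteq> g i"
        using g(1)[of i] g(1)[of "Suc i"] f2[of i] that by simp_all
      then show ?thesis by linarith
    qed
    from this[of j] this[of k] have "g j = - g (Suc j)" "g k = - g (Suc k)" using jk(1-4) by simp_all
    ultimately show ?thesis using f2[of j] f2[of k] jk(1,2) by linarith
  qed
qed

text \<open>Minus half the mixed second difference of the heights. The division is exact on states,
  because it halves the difference of two unit steps.\<close>

definition asm_of_state :: "nat \<Rightarrow> int mat \<Rightarrow> int mat" where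
  "asm_of_state n M = mat n n (\<lambda>(i, j).
     (M $$ (i, Suc j) + M $$ (Suc i, j) - M $$ (i, j) - M $$ (Suc i, Suc j)) div 2)"

text \<open>The heights encode the corner sums of the matrix; partial row and column sums in {0, 1}
  are exactly what makes the height steps 1 or -1.\<close>

definition state_of_asm :: "nat \<Rightarrow> int mat \<Rightarrow> int mat" where
  "state_of_asm n A = mat (Suc n) (Suc n) (\<lambda>(i, j). int i + int j - 2 *
        (\<Sum>k<i. \<Sum>l<j. A $$ (k, l)))"

lemma asm_of_state_rows:
  assumes M: "M \<in> states n" and i: "i < n"
  defines "f \<equiv> \<lambda>j. asm_of_state n M $$ (i, j)" and "g \<equiv> \<lambda>j. M $$ (i, j) -
        M $$ (Suc i, j)"
  shows "j \<le> n \<Longrightarrow> g j \<in> {-1, 1}" "g 0 = -1" "g n = 1" "j < n \<Longrightarrow> f j =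
        (g (Suc j) - g j) div 2"
proof -
  show "g j \<in> {-1, 1}" if "j \<le> n"
    using statesD(3)[OF M i that] unfolding g_def insert_iff empty_iff by arith
  show "g 0 = -1" "g n = 1"
    using statesD(5)[OF M] statesD(7)[OF M] i by (simp_all add: g_def)
  show "f j = (g (Suc j) - g j) div 2" if "j < n"
    using that i by (simp add: f_def g_def asm_of_state_def algebra_simps)
qed

lemma asm_of_state_cols:
  assumes M: "M \<in> states n" and j: "j < n"
  defines "f \<equiv> \<lambda>i. asm_of_state n M $$ (i, j)" and "g \<equiv> \<lambda>i. M $$ (i, j) -
        M $$ (i, Suc j)"
  shows "i \<le> n \<Longrightarrow> g i \<in> {-1, 1}" "g 0 = -1" "g n = 1" "i < n \<Longrightarrow> f i =
        (g (Suc i) - g i) div 2"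
proof -
  show "g i \<in> {-1, 1}" if "i \<le> n"
    using statesD(2)[OF M that j] unfolding g_def insert_iff empty_iff by arith
  show "g 0 = -1" "g n = 1"
    using statesD(4)[OF M] statesD(6)[OF M] j by (simp_all add: g_def)
  show "f i = (g (Suc i) - g i) div 2" if "i < n"
    using that j by (simp add: f_def g_def asm_of_state_def algebra_simps)
qed

lemma asm_of_state_in:
  assumes "M \<in> states n"
  shows "asm_of_state n M \<in> alternating_sign_matrices n"
proof -
  note R = alternating_of_differences[OF asm_of_state_rows[OF assms]]
  note C = alternating_of_differences[OF asm_of_state_cols[OF assms]]
  have "asm_of_state n M \<in> carrier_mat n n" by (simp add: asm_of_state_def)
  then show ?thesis
    unfolding alternating_sign_matrices_def mem_Collect_eq
    apply (intro conjI allI impI)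
    subgoal by assumption
    subgoal for i j by (rule R(2))
    subgoal for i by (rule R(3))
    subgoal for j by (rule C(3))
    subgoal for i j k by (elim conjE, rule R(4)) auto
    subgoal for j i k by (elim conjE, rule C(4)) auto
    done
qed

lemma asm_partial_sums:
  assumes A: "A \<in> alternating_sign_matrices n"
  shows "i < n \<Longrightarrow> m \<le> n \<Longrightarrow> (\<Sum>j<m. A $$ (i, j)) \<in> {0, 1}"
    and "j < n \<Longrightarrow> m \<le> n \<Longrightarrow> (\<Sum>i<m. A $$ (i, j)) \<in> {0, 1}"
proof -
  have val: "A $$ (i, j) \<in> {-1, 0, 1}" if "i < n" "j < n" for i j
    using A that by (auto simp: alternating_sign_matrices_def)
  have sums: "(\<Sum>j<n. A $$ (i, j)) = 1" "(\<Sum>k<n. A $$ (k, i)) = 1" if "i < n" for i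
    using A that by (auto simp: alternating_sign_matrices_def)
  have row: "\<forall>i<n. \<forall>j<n. \<forall>k<n. j < k \<and> A $$ (i, j) \<noteq> 0 \<and> A $$ (i, k) \<noteq> 0 \<and>
      (\<forall>l. j < l \<and> l < k \<longrightarrow> A $$ (i, l) = 0) \<longrightarrow> A $$ (i, k) = - A $$ (i, j)"
    and col: "\<forall>j<n. \<forall>i<n. \<forall>k<n. i < k \<and> A $$ (i, j) \<noteq> 0 \<and> A $$ (k, j) \<noteq> 0 \<and>
      (\<forall>l. i < l \<and> l < k \<longrightarrow> A $$ (l, j) = 0) \<longrightarrow> A $$ (k, j) = - A $$ (i, j)"
    using A unfolding alternating_sign_matrices_def by blast+
  show "(\<Sum>j<m. A $$ (i, j)) \<in> {0, 1}" if "i < n" "m \<le> n" for i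
  proof (rule partial_sums_of_alternating[OF _ sums(1) _ that(2)])
    show "A $$ (i, k) = - A $$ (i, j)" if "j < k" "k < n" "A $$ (i, j) \<noteq> 0" "A $$ (i, k) \<noteq> 0"
      "\<And>l. j < l \<Longrightarrow> l < k \<Longrightarrow> A $$ (i, l) = 0" for j k
    proof -
      have "j < n" using that by simp
      then show ?thesis using row \<open>i < n\<close> that by blast
    qed
  qed (use val that in auto)
  show "(\<Sum>i<m. A $$ (i, j)) \<in> {0, 1}" if "j < n" "m \<le> n" for j
  proof (rule partial_sums_of_alternating[OF _ sums(2) _ that(2)])
    show "A $$ (k, j) = - A $$ (i, j)" if "i < k" "k < n" "A $$ (i, j) \<noteq> 0" "A $$ (k, j) \<noteq> 0"
      "\<And>l. i < l \<Longrightarrow> l < k \<Longrightarrow> A $$ (l, j) = 0" for i k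
    proof -
      have "i < n" using that by simp
      then show ?thesis using col \<open>j < n\<close> that by blast
    qed
  qed (use val that in auto)
qed

lemma state_of_asm_in:
  assumes A: "A \<in> alternating_sign_matrices n"
  shows "state_of_asm n A \<in> states n"
proof (rule statesI)
  have sums: "(\<Sum>j<n. A $$ (i, j)) = 1" "(\<Sum>k<n. A $$ (k, i)) = 1" if "i < n" for i
    using A that by (auto simp: alternating_sign_matrices_def)
  show "state_of_asm n A \<in> carrier_mat (n + 1) (n + 1)" by (simp add: state_of_asm_def)
  show "\<bar>state_of_asm n A $$ (i, Suc j) - state_of_asm n A $$ (i, j)\<bar> =
        1" if "i \<le> n" "j < n" for i j
  proof -
    have "state_of_asm n A $$ (i, Suc j) - state_of_asm n A $$ (i, j) = 1 - 2 * (\<Sum>k<i. A $$ (k, j))"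
      using that by (simp add: state_of_asm_def sum.distrib)
    then show ?thesis using asm_partial_sums(2)[OF A that(2,1)] by auto
  qed
  show "\<bar>state_of_asm n A $$ (Suc i, j) - state_of_asm n A $$ (i, j)\<bar> =
        1" if "i < n" "j \<le> n" for i j
  proof -
    have "state_of_asm n A $$ (Suc i, j) - state_of_asm n A $$ (i, j) = 1 - 2 * (\<Sum>l<j. A $$ (i, l))"
      using that by (simp add: state_of_asm_def)
    then show ?thesis using asm_partial_sums(1)[OF A that] by auto
  qed
  show "state_of_asm n A $$ (n, k) = int n - int k" if "k \<le> n" for k
  proof -
    have "(\<Sum>i<n. \<Sum>l<k. A $$ (i, l)) = (\<Sum>l<k. \<Sum>i<n. A $$ (i, l))" by (rule sum.swap)
    also have "\<dots> = int k" using sums(2) that by simp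
    finally show ?thesis using that by (simp add: state_of_asm_def)
  qed
  show "state_of_asm n A $$ (k, n) = int n - int k" if "k \<le> n" for k
  proof -
    have "(\<Sum>i<k. \<Sum>l<n. A $$ (i, l)) = int k" using sums(1) that by simp
    then show ?thesis using that by (simp add: state_of_asm_def)
  qed
qed (simp_all add: state_of_asm_def)

lemma card_asm: "card (alternating_sign_matrices n) = card (states n)"
proof (rule bij_betw_same_card, rule bij_betw_byWitness[where f = "state_of_asm n" and f' = "asm_of_state n"])
  show "\<forall>A\<in>alternating_sign_matrices n. asm_of_state n (state_of_asm n A) = A"
  proof
    fix A assume "A \<in> alternating_sign_matrices n"
    then have "A \<in> carrier_mat n n" by (auto simp: alternating_sign_matrices_def)
    then show "asm_of_state n (state_of_asm n A) = A"
      by (intro eq_matI) (auto simp: asm_of_state_def state_of_asm_def sum.distrib)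
  qed
  show "\<forall>M\<in>states n. state_of_asm n (asm_of_state n M) = M"
  proof
    fix M assume M: "M \<in> states n"
    note R = alternating_of_differences[OF asm_of_state_rows[OF M]]
    show "state_of_asm n (asm_of_state n M) = M"
    proof (rule eq_matI)
      show "dim_row (state_of_asm n (asm_of_state n M)) = dim_row M"
        "dim_col (state_of_asm n (asm_of_state n M)) = dim_col M"
        using statesD(1)[OF M] by (auto simp: state_of_asm_def)
      fix i j assume "i < dim_row M" "j < dim_col M"
      then have ij: "i \<le> n" "j \<le> n" using statesD(1)[OF M] by auto
      have "2 * (\<Sum>k<i. \<Sum>l<j. asm_of_state n M $$ (k, l)) = (\<Sum>k<i. 2 *
            (\<Sum>l<j. asm_of_state n M $$ (k, l)))"
        by (rule sum_distrib_left)
      also have "\<dots> = (\<Sum>k<i. M $$ (k, j) - M $$ (Suc k, j) + 1)"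
        using ij by (intro sum.cong refl R(1)) auto
      also have "\<dots> = M $$ (0, j) - M $$ (i, j) + int i"
        using sum_lessThan_telescope'[of "\<lambda>k. M $$ (k, j)" i] by (simp add: sum.distrib)
      also have "M $$ (0, j) = int j" by (rule statesD(4)[OF M ij(2)])
      finally show "state_of_asm n (asm_of_state n M) $$ (i, j) = M $$ (i, j)"
        using ij by (simp add: state_of_asm_def)
    qed
  qed
  show "state_of_asm n ` alternating_sign_matrices n \<subseteq> states n"
    using state_of_asm_in by blast
  show "asm_of_state n ` states n \<subseteq> alternating_sign_matrices n"
    using asm_of_state_in by blast
qed

lemma one_plus_omega_square: "(1 + omega) ^ 2 = omega"
proof -
  have "(1 + omega) ^ 2 = 1 + 2 * omega + omega ^ 2"
    by (simp add: power2_eq_square distrib_left distrib_right)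
  then show ?thesis by (simp only: omega_quadratic) simp
qed

text \<open>At \<open>L = 0\<close> the exponent of the weight of a block is affine in its heights and sums telescopically.\<close>
lemma wt_omega_0:
  assumes \<theta>: "\<theta> ^ 2 = 1 + omega"
    and d: "\<bar>b - a\<bar> = 1" "\<bar>d - b\<bar> = 1" "\<bar>d - c\<bar> = 1" "\<bar>c - a\<bar> = 1"
  shows "wt omega 0 omega 1 a b c d = \<theta> powi (2 + 2 * c - a - d)"
proof -
  have t4: "\<theta> ^ 4 = omega"
  proof -
    have "\<theta> ^ 4 = (\<theta> ^ 2) ^ 2" by (simp only: power_mult[symmetric]) simp
    also have "\<dots> = omega" unfolding \<theta> by (rule one_plus_omega_square)
    finally show ?thesis .
  qed
  have nz: "1 - omega \<noteq> 0" using omega_neq_1 by simp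
  have e: "(1 - omega * omega) / (1 - omega) = 1 + omega"
    using nz by (simp add: nonzero_divide_eq_eq algebra_simps)
  have e2: "(1 - omega) * omega / (1 - omega) = omega" "(1 - omega) / (1 - omega) = 1" using nz by simp_all
  have "b = a + 1 \<or> b = a - 1" "c = a + 1 \<or> c = a - 1" "d = b + 1 \<or> d = b - 1"
    using d by arith+
  then consider "b = a + 1" "c = a + 1" "d = a + 2" | "b = a + 1" "c = a + 1" "d = a"
    | "b = a - 1" "c = a - 1" "d = a - 2" | "b = a - 1" "c = a - 1" "d = a"
    | "b = a + 1" "c = a - 1" "d = a" | "b = a - 1" "c = a + 1" "d = a"
    using d(3) by (elim disjE) simp_all
  then show ?thesis
    by cases (simp_all add: wt_def e e2 \<theta> t4 omega_neq_1)
qed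

text \<open>Each summand is 2 plus a vertical height difference plus a horizontal one in the row
  below. Both telescope to boundary heights, so the total is the same for all states.\<close>

lemma sum_blocks:
  assumes M: "M \<in> states n"
  shows "(\<Sum>i<n. \<Sum>j<n. 2 + 2 * M $$ (Suc i, j) - M $$ (i, j) - M $$ (Suc i, Suc j)) = int (2 * (n *
        (n + 1)))"
proof -
  note D = statesD[OF M]
  have "(\<Sum>i<n. \<Sum>j<n. 2 + 2 * M $$ (Suc i, j) - M $$ (i, j) - M $$ (Suc i, Suc j)) =
      (\<Sum>i<n. \<Sum>j<n. 2) + (\<Sum>j<n. \<Sum>i<n. M $$ (Suc i, j) - M $$ (i, j)) +
      (\<Sum>i<n. \<Sum>j<n. M $$ (Suc i, j) - M $$ (Suc i, Suc j))"
    unfolding sum.swap[of "\<lambda>j i. M $$ (Suc i, j) - M $$ (i, j)"] sum.distrib[symmetric]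
    by (intro sum.cong refl) simp
  also have "(\<Sum>j<n. \<Sum>i<n. M $$ (Suc i, j) - M $$ (i, j)) = (\<Sum>j<n. int n - 2 * int j)"
  proof (intro sum.cong refl)
    fix j assume "j \<in> {..<n}"
    then show "(\<Sum>i<n. M $$ (Suc i, j) - M $$ (i, j)) = int n - 2 * int j"
      using sum_lessThan_telescope[of "\<lambda>i. M $$ (i, j)" n] D(4)[of j] D(6)[of j] by simp
  qed
  also have "(\<Sum>i<n. \<Sum>j<n. M $$ (Suc i, j) - M $$ (Suc i, Suc j)) = (\<Sum>i<n. 2 * int i + 2 - int n)"
  proof (intro sum.cong refl)
    fix i assume "i \<in> {..<n}"
    then show "(\<Sum>j<n. M $$ (Suc i, j) - M $$ (Suc i, Suc j)) = 2 * int i + 2 - int n"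
      using sum_lessThan_telescope'[of "\<lambda>j. M $$ (Suc i, j)" n] D(5)[of "Suc i"] D(7)[of "Suc i"] by simp
  qed
  also have "(\<Sum>i<n. \<Sum>j<n. 2) + (\<Sum>j<n. int n - 2 * int j) + (\<Sum>i<n. 2 * int i + 2 - int n) =
      (\<Sum>i<n. 2 * int n + 2)"
  proof -
    have "(\<Sum>i<n. \<Sum>j<n. 2) = (\<Sum>i<n. 2 * int n)" by simp
    then show ?thesis
      by (simp only: sum.distrib[symmetric]) (intro sum.cong refl, simp)
  qed
  finally show ?thesis by (simp add: algebra_simps)
qed

lemma prod_power_int:
  fixes x :: complex
  assumes "x \<noteq> 0"
  shows "(\<Prod>i\<in>A. x powi f i) = x powi (\<Sum>i\<in>A. f i)"
  using assms by (induction A rule: infinite_finite_induct) (simp_all add: power_int_add)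

text \<open>Every state has weight \<theta>^(2n(n+1)) with \<theta>^4 = omega, so at L = 0 the
  partition function merely counts states.\<close>

lemma Zt_omega_0: "Zt omega n (\<lambda>_. omega) (\<lambda>_. 1) 0 = of_nat (card (states n)) *
      omega ^ (Suc n choose 2)"
proof -
  define \<theta> where "\<theta> = csqrt (1 + omega)"
  have \<theta>: "\<theta> ^ 2 = 1 + omega" by (simp add: \<theta>_def)
  have o: "1 + omega = - (omega ^ 2)" using omega_quadratic by simp
  then have t0: "\<theta> \<noteq> 0" using \<theta> omega_neq_0 by auto
  have weight: "(\<Prod>i<n. \<Prod>j<n. wt omega 0 omega 1 (M $$ (i, j)) (M $$ (i, Suc j)) (M $$ (Suc i, j)) (M $$ (Suc i, Suc j))) =
      omega ^ (Suc n choose 2)" if M: "M \<in> states n" for M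
  proof -
    note D = statesD[OF M]
    have weight: "(\<Prod>i<n. \<Prod>j<n. wt omega 0 omega 1 (M $$ (i, j)) (M $$ (i, Suc j)) (M $$ (Suc i, j)) (M $$ (Suc i, Suc j))) =
        (\<Prod>i<n. \<Prod>j<n. \<theta> powi (2 + 2 * M $$ (Suc i, j) - M $$ (i, j) - M $$ (Suc i, Suc j)))"
      using D(2,3) by (intro prod.cong refl wt_omega_0 \<theta>) auto
    also have "\<dots> = \<theta> powi int (2 * (n * (n + 1)))"
      by (simp only: prod_power_int[OF t0] sum_blocks[OF M])
    also have "\<dots> = \<theta> ^ (4 * (Suc n choose 2))"
    proof -
      have "2 * (n * (n + 1)) = 4 * (Suc n choose 2)"
      proof (induction n)
        case (Suc n)
        then show ?case by (simp only: choose_2_Suc[of "Suc n"]) simp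
      qed (simp add: binomial_eq_0)
      then show ?thesis by (simp only: power_int_of_nat)
    qed
    also have "\<dots> = ((\<theta> ^ 2) ^ 2) ^ (Suc n choose 2)"
      by (simp only: power_mult[symmetric]) simp
    finally show ?thesis unfolding \<theta> one_plus_omega_square .
  qed
  have "Zt omega n (\<lambda>_. omega) (\<lambda>_. 1) 0 = (\<Sum>M\<in>states n. omega ^ (Suc n choose 2))"
    unfolding Zt_def by (intro sum.cong refl weight)
  then show ?thesis by simp
qed

theorem theorem8p1:
  fixes p \<eta> lam :: complex and n :: nat
  assumes "p = 0"
    and "qpow \<eta> 1 = omega"
    and "lam \<noteq> 0" and "lam ^ 3 \<noteq> 1"
  shows "Ztilde p \<eta> n (\<lambda>_. omega) (\<lambda>_. 1) lam =
           omega ^ ((n + 1) choose 2) /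
             ((1 - lam * omega ^ (n + 1)) * (1 - lam * omega ^ (n + 2))) *
           (A_num n * (1 + omega ^ n * lam ^ 2) + (-1) ^ n * C_num n * omega ^ (2 * n) * lam)
       \<and> of_nat (card (alternating_sign_matrices n)) = A_num n"
proof
  have D: "1 - lam * omega ^ k \<noteq> 0" for k
    using cube_neq_1_omega[OF assms(4), of "int k"] by simp
  have "Ztilde p \<eta> n (\<lambda>_. omega) (\<lambda>_. 1) lam =
        Zt omega n (\<lambda>_. omega) (\<lambda>_. 1) lam"
    unfolding assms(1) using assms(2-4) omega_neq_0 by (intro Ztilde_eq_Zt) simp_all
  also have "\<dots> = omega ^ (Suc n choose 2) *
      (A_num n * (1 + omega ^ n * lam ^ 2) + (-1) ^ n * C_num n * omega ^ (2 * n) * lam) /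
      ((1 - lam * omega ^ (n + 1)) * (1 - lam * omega ^ (n + 2)))"
    using Zt_omega[OF assms(4), of n] D[of "n + 1"] D[of "n + 2"]
    by (intro eq_divide_imp) (simp_all only: mult_eq_0_iff simp_thms)
  finally show "Ztilde p \<eta> n (\<lambda>_. omega) (\<lambda>_. 1) lam =
      omega ^ ((n + 1) choose 2) / ((1 - lam * omega ^ (n + 1)) * (1 - lam * omega ^ (n + 2))) *
      (A_num n * (1 + omega ^ n * lam ^ 2) + (-1) ^ n * C_num n * omega ^ (2 * n) * lam)"
    by (simp only: Suc_eq_plus1 times_divide_eq_left)
  \<comment> \<open>At L = 0 the evaluation \<open>Zt_omega\<close> retains only its
    \<open>A_num\<close> term, and both sides contain the same nonzero power of omega.\<close>
  have "of_nat (card (states n)) * omega ^ (Suc n choose 2) = omega ^ (Suc n choose 2) * A_num n"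
    using Zt_omega[of 0 n] by (simp add: Zt_omega_0)
  then show "of_nat (card (alternating_sign_matrices n)) = A_num n"
    using omega_neq_0 by (simp add: card_asm)
qed

end
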